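(* Let $M$ be a 3-dimensional oriented Riemannian manifold of constant sectional curvature $c$, with a fixed spin structure, and let $m\ge0$ be an integer. Then, on $\Gamma(M,\mathbf{S}_m)$, $$D_m^0D_m^0+D_{m-2}^+D_m^-=m^2\nabla^{\ast}\nabla+\frac{m^2(m+2)}{2}c,$$ $$D_m^0D_m^0+D_{m+2}^-D_m^+=(m+2)^2\nabla^{\ast}\nabla-\frac{m(m+2)^2}{2}c,$$ $$D_{m+2}^0D_m^+-D_{m}^+D_m^0=0,\qquad D_{m-2}^0D_m^--D_{m}^-D_m^0=0,$$ where $\nabla^{\ast}\nabla$ is the connection Laplacian on $\mathbf{S}_m$. In particular, $$\Delta_mD_m^0=D_m^0\Delta_m,\qquad \widetilde{\Delta}_mD_m^0=D_m^0\widetilde{\Delta}_m,$$ $$\Delta_m(D_{m-2}^+D_m^-)=(D_{m-2}^+D_m^-)\Delta_m,\qquad \widetilde{\Delta}_m(D_{m+2}^-D_m^+)=(D_{m+2}^-D_m^+)\widetilde{\Delta}_m.$$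
   Context: Representations: for an integer $m\ge 0$, $V_m$ is the complex vector space of polynomials of degree $\le m$ in one variable $z_m$, with the Hermitian inner product for which $(z_m^k,z_m^l)=k!(m-k)!\,\delta_{kl}$. $SU(2)$ acts unitarily and irreducibly by $\rho_m(h)z_m^k=(bz_m+d)^{m-k}(az_m+c)^k$ for $h=\begin{pmatrix}a&b\\c&d\end{pmatrix}$. Put $V_{-1}=V_{-2}=0$ (all maps into or out of these are $0$). $\mathbf{R}^3$ (standard basis $e_1,e_2,e_3$, standard inner product) is identified with $\mathfrak{su}(2)$ by $e_i\leftrightarrow\sigma_i$, where $\sigma_1=\begin{pmatrix}i&0\\0&-i\end{pmatrix}$, $\sigma_2=\begin{pmatrix}0&1\\-1&0\end{pmatrix}$, $\sigma_3=\begin{pmatrix}0&i\\i&0\end{pmatrix}$. Clifford homomorphisms: for $X\in\mathbf{R}^3$ the maps $\rho_m^0(X):V_m\to V_m$ and $\rho_m^{\pm}(X):V_m\to V_{m\pm2}$ are linear in $X$ and (after complex-linear extension in $X$) given by $\rho_m^0(\frac{e_1}{2})z_m^k=i(k-\frac m2)z_m^k$, $\rho_m^0(\frac{e_2}{2}+i\frac{e_3}{2})z_m^k=-kz_m^{k-1}$, $\rho_m^0(\frac{e_2}{2}-i\frac{e_3}{2})z_m^k=(m-k)z_m^{k+1}$; $\rho_m^+(\frac{e_1}{2})z_m^k=iz_{m+2}^{k+1}$, $\rho_m^+(\frac{e_2}{2}+i\frac{e_3}{2})z_m^k=-z_{m+2}^k$, $\rho_m^+(\frac{e_2}{2}-i\frac{e_3}{2})z_m^k=-z_{m+2}^{k+2}$;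 $\rho_m^-(\frac{e_1}{2})z_m^k=ik(m-k)z_{m-2}^{k-1}$, $\rho_m^-(\frac{e_2}{2}+i\frac{e_3}{2})z_m^k=k(k-1)z_{m-2}^{k-2}$, $\rho_m^-(\frac{e_2}{2}-i\frac{e_3}{2})z_m^k=(m-k)(m-k-1)z_{m-2}^k$. Bundles: $\mathbf{Spin}(M)$ is the principal $Spin(3)=SU(2)$ bundle, $\mathbf{S}_m=\mathbf{Spin}(M)\times_{\rho_m}V_m$ with the induced Hermitian metric ($\mathbf{S}_{-1}=\mathbf{S}_{-2}=0$), and $T(M)=\mathbf{Spin}(M)\times_{\mathrm{Ad}}\mathbf{R}^3$. The Clifford homomorphisms are $SU(2)$-equivariant, so they induce bundle maps $\rho_m^0(X)\in\mathrm{End}(\mathbf{S}_m)$, $\rho_m^\pm(X)\in\mathrm{Hom}(\mathbf{S}_m,\mathbf{S}_{m\pm2})$ for tangent vectors $X$: $\rho([p,e_i])[p,v]=[p,\rho(e_i)v]$. $\nabla$ is the covariant derivative on $\mathbf{S}_m$ induced by the Levi-Civita (spin) connection. Higher spin Dirac operators: for a local positively oriented orthonormal frame $\{e_i\}$ of $T(M)$, $D_m^0=\sum_{i=1}^3\rho_m^0(e_i)\nabla_{e_i}:\Gamma(M,\mathbf{S}_m)\to\Gamma(M,\mathbf{S}_m)$ and $D_m^\pm=\sum_{i=1}^3\rho_m^\pm(e_i)\nabla_{e_i}:\Gamma(M,\mathbf{S}_m)\to\Gamma(M,\mathbf{S}_{m\pm2})$. The Laplace type operators are $\Delta_m=D_m^0D_m^0+D_{m-2}^+D_m^-$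 and $\widetilde{\Delta}_m=D_m^0D_m^0+D_{m+2}^-D_m^+$. *)

theory Defs
  imports "HOL-Analysis.Analysis" "HOL-Computational_Algebra.Polynomial"
begin

section \<open>Smooth maps between open subsets of normed spaces\<close>

primrec Ck_on :: "nat \<Rightarrow> 'a::real_normed_vector set \<Rightarrow> ('a \<Rightarrow> 'b::real_normed_vector) \<Rightarrow> bool" where
  "Ck_on 0 S f \<longleftrightarrow> continuous_on S f"
| "Ck_on (Suc k) S f \<longleftrightarrow>
     f differentiable_on S \<and> (\<forall>v. Ck_on k S (\<lambda>x. frechet_derivative f (at x) v))"

text \<open>Only used for open \<open>S\<close> in a finite-dimensional space, where this is the usual notion.\<close>

definition smooth_on :: "'a::real_normed_vector set \<Rightarrow> ('a \<Rightarrow> 'b::real_normed_vector) \<Rightarrow> bool" where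
  "smooth_on S f \<longleftrightarrow> (\<forall>k. Ck_on k S f)"


section \<open>Oriented Riemannian 3-manifolds\<close>

type_synonym 'a chart = "'a set \<times> ('a \<Rightarrow> real^3)"

text \<open>A tangent vector at a point is a derivation of the germs of smooth real functions there.\<close>
type_synonym 'a tvec = "('a \<Rightarrow> real) \<Rightarrow> real"
type_synonym 'a vfield = "'a \<Rightarrow> 'a tvec"

text \<open>\<open>LC G x v Y\<close> is the covariant derivative \<open>\<nabla>\<^sub>v Y\<close> at \<open>x\<close> of a vector field \<open>Y\<close> defined near \<open>x\<close>
  in the direction of the tangent vector \<open>v\<close>.\<close>
record 'a riem_manifold =
  mtop :: "'a topology"
  atlas :: "'a chart set"
  metric :: "'a \<Rightarrow> 'a tvec \<Rightarrow> 'a tvec \<Rightarrow> real"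
  LC :: "'a \<Rightarrow> 'a tvec \<Rightarrow> 'a vfield \<Rightarrow> 'a tvec"

text \<open>The orientation is encoded by an atlas all of whose transition maps have positive Jacobian
  determinant.\<close>
definition oriented_smooth_3manifold :: "('a, 'z) riem_manifold_scheme \<Rightarrow> bool" where
  "oriented_smooth_3manifold G \<longleftrightarrow>
     Hausdorff_space (mtop G) \<and> second_countable (mtop G) \<and>
     (\<Union>(U, \<phi>)\<in>atlas G. U) = topspace (mtop G) \<and>
     (\<forall>(U, \<phi>)\<in>atlas G. openin (mtop G) U \<and> open (\<phi> ` U) \<and>
        homeomorphic_map (subtopology (mtop G) U) (top_of_set (\<phi> ` U)) \<phi>) \<and>
     (\<forall>(U, \<phi>)\<in>atlas G. \<forall>(V, \<psi>)\<in>atlas G.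
        smooth_on (\<phi> ` (U \<inter> V)) (\<psi> \<circ> inv_into U \<phi>) \<and>
        (\<forall>y\<in>\<phi> ` (U \<inter> V). det (matrix (frechet_derivative (\<psi> \<circ> inv_into U \<phi>) (at y))) > 0))"

definition msmooth ::
    "('a, 'z) riem_manifold_scheme \<Rightarrow> 'a set \<Rightarrow> ('a \<Rightarrow> 'b::real_normed_vector) \<Rightarrow> bool" where
  "msmooth G U f \<longleftrightarrow> (\<forall>(V, \<phi>)\<in>atlas G. smooth_on (\<phi> ` (U \<inter> V)) (f \<circ> inv_into V \<phi>))"

definition msmooth_near ::
    "('a, 'z) riem_manifold_scheme \<Rightarrow> 'a \<Rightarrow> ('a \<Rightarrow> 'b::real_normed_vector) \<Rightarrow> bool" where
  "msmooth_near G x f \<longleftrightarrow> (\<exists>U. openin (mtop G) U \<and> x \<in> U \<and> msmooth G U f)"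

text \<open>The last clause normalises a derivation on functions that are not smooth near \<open>x\<close>, so that
  tangent vectors are equal as soon as they agree on germs.\<close>
definition tangent_space :: "('a, 'z) riem_manifold_scheme \<Rightarrow> 'a \<Rightarrow> 'a tvec set" where
  "tangent_space G x = {v.
     (\<forall>f h. msmooth_near G x f \<longrightarrow> msmooth_near G x h \<longrightarrow>
        v (\<lambda>y. f y + h y) = v f + v h \<and>
        v (\<lambda>y. f y * h y) = v f * h x + f x * v h) \<and>
     (\<forall>f a. msmooth_near G x f \<longrightarrow> v (\<lambda>y. a * f y) = a * v f) \<and>
     (\<forall>f h U. openin (mtop G) U \<longrightarrow> x \<in> U \<longrightarrow> (\<forall>y\<in>U. f y = h y) \<longrightarrow> v f = v h) \<and>
     (\<forall>f. \<not> msmooth_near G x f \<longrightarrow> v f = 0)}"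

definition tadd :: "'a tvec \<Rightarrow> 'a tvec \<Rightarrow> 'a tvec" where
  "tadd v w = (\<lambda>f. v f + w f)"

definition tscale :: "real \<Rightarrow> 'a tvec \<Rightarrow> 'a tvec" where
  "tscale a v = (\<lambda>f. a * v f)"

definition tsub :: "'a tvec \<Rightarrow> 'a tvec \<Rightarrow> 'a tvec" where
  "tsub v w = (\<lambda>f. v f - w f)"

definition vector_fields :: "('a, 'z) riem_manifold_scheme \<Rightarrow> 'a set \<Rightarrow> 'a vfield set" where
  "vector_fields G U = {X.
     (\<forall>x\<in>U. X x \<in> tangent_space G x) \<and>
     (\<forall>V f. openin (mtop G) V \<longrightarrow> V \<subseteq> U \<longrightarrow> msmooth G V (f :: 'a \<Rightarrow> real) \<longrightarrow>
        msmooth G V (\<lambda>x. X x f))}"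

definition bracket :: "('a, 'z) riem_manifold_scheme \<Rightarrow> 'a vfield \<Rightarrow> 'a vfield \<Rightarrow> 'a vfield" where
  "bracket G X Y = (\<lambda>x f. if msmooth_near G x f
     then X x (\<lambda>y. Y y f) - Y x (\<lambda>y. X y f) else 0)"

definition riemannian_metric :: "('a, 'z) riem_manifold_scheme \<Rightarrow> bool" where
  "riemannian_metric G \<longleftrightarrow>
     (\<forall>x\<in>topspace (mtop G). \<forall>u\<in>tangent_space G x. \<forall>v\<in>tangent_space G x.
        metric G x u v = metric G x v u \<and>
        (u \<noteq> (\<lambda>f. 0) \<longrightarrow> metric G x u u > 0) \<and>
        (\<forall>w\<in>tangent_space G x. metric G x (tadd u v) w = metric G x u w + metric G x v w) \<and>
        (\<forall>a. metric G x (tscale a u) v = a * metric G x u v)) \<and>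
     (\<forall>U. openin (mtop G) U \<longrightarrow> (\<forall>X\<in>vector_fields G U. \<forall>Y\<in>vector_fields G U.
        msmooth G U (\<lambda>x. metric G x (X x) (Y x))))"

definition oriented_riemannian_3manifold :: "('a, 'z) riem_manifold_scheme \<Rightarrow> bool" where
  "oriented_riemannian_3manifold G \<longleftrightarrow> oriented_smooth_3manifold G \<and> riemannian_metric G"

text \<open>An affine connection, as an operator on vector fields over arbitrary open sets that is
  compatible with restriction.\<close>
definition affine_connection :: "('a, 'z) riem_manifold_scheme \<Rightarrow> bool" where
  "affine_connection G \<longleftrightarrow> (\<forall>U. openin (mtop G) U \<longrightarrow> (\<forall>Y\<in>vector_fields G U.
     (\<forall>X\<in>vector_fields G U. (\<lambda>x. LC G x (X x) Y) \<in> vector_fields G U) \<and>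
     (\<forall>x\<in>U. \<forall>v\<in>tangent_space G x.
        LC G x v Y \<in> tangent_space G x \<and>
        (\<forall>w\<in>tangent_space G x. LC G x (tadd v w) Y = tadd (LC G x v Y) (LC G x w Y)) \<and>
        (\<forall>a. LC G x (tscale a v) Y = tscale a (LC G x v Y)) \<and>
        (\<forall>Z\<in>vector_fields G U.
           LC G x v (\<lambda>y. tadd (Y y) (Z y)) = tadd (LC G x v Y) (LC G x v Z)) \<and>
        (\<forall>f. msmooth G U f \<longrightarrow>
           LC G x v (\<lambda>y. tscale (f y) (Y y)) = tadd (tscale (v f) (Y x)) (tscale (f x) (LC G x v Y))) \<and>
        (\<forall>Z. (\<forall>y\<in>U. Z y = Y y) \<longrightarrow> LC G x v Z = LC G x v Y))))"

definition levi_civita_connection :: "('a, 'z) riem_manifold_scheme \<Rightarrow> bool" where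
  "levi_civita_connection G \<longleftrightarrow> affine_connection G \<and>
     (\<forall>U. openin (mtop G) U \<longrightarrow> (\<forall>Y\<in>vector_fields G U. \<forall>Z\<in>vector_fields G U. \<forall>x\<in>U.
        (\<forall>v\<in>tangent_space G x. v (\<lambda>y. metric G y (Y y) (Z y)) =
           metric G x (LC G x v Y) (Z x) + metric G x (Y x) (LC G x v Z)) \<and>
        tsub (LC G x (Y x) Z) (LC G x (Z x) Y) = bracket G Y Z x))"

text \<open>\<open>R(X,Y)Z = \<nabla>\<^sub>X\<nabla>\<^sub>YZ - \<nabla>\<^sub>Y\<nabla>\<^sub>XZ - \<nabla>\<^bsub>[X,Y]\<^esub>Z\<close>\<close>
definition curvature ::
    "('a, 'z) riem_manifold_scheme \<Rightarrow> 'a vfield \<Rightarrow> 'a vfield \<Rightarrow> 'a vfield \<Rightarrow> 'a vfield" where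
  "curvature G X Y Z = (\<lambda>x. tsub (tsub
      (LC G x (X x) (\<lambda>y. LC G y (Y y) Z))
      (LC G x (Y x) (\<lambda>y. LC G y (X y) Z)))
      (LC G x (bracket G X Y x) Z))"

text \<open>Sectional curvature of the plane spanned by \<open>X x\<close> and \<open>Y x\<close>.\<close>
definition sectional_curvature ::
    "('a, 'z) riem_manifold_scheme \<Rightarrow> 'a vfield \<Rightarrow> 'a vfield \<Rightarrow> 'a \<Rightarrow> real" where
  "sectional_curvature G X Y x =
     metric G x (curvature G X Y Y x) (X x) /
     (metric G x (X x) (X x) * metric G x (Y x) (Y x) - (metric G x (X x) (Y x))\<^sup>2)"

definition constant_sectional_curvature :: "('a, 'z) riem_manifold_scheme \<Rightarrow> real \<Rightarrow> bool" where
  "constant_sectional_curvature G c \<longleftrightarrow>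
     (\<forall>U. openin (mtop G) U \<longrightarrow> (\<forall>X\<in>vector_fields G U. \<forall>Y\<in>vector_fields G U. \<forall>x\<in>U.
        (\<forall>a b. tadd (tscale a (X x)) (tscale b (Y x)) = (\<lambda>f. 0) \<longrightarrow> a = 0 \<and> b = 0) \<longrightarrow>
        sectional_curvature G X Y x = c))"

text \<open>In the determinant, \<open>E i\<close> is applied to the coordinate functions of an oriented chart,
  which yields its coordinate components.\<close>
definition oriented_onb :: "('a, 'z) riem_manifold_scheme \<Rightarrow> 'a \<Rightarrow> (3 \<Rightarrow> 'a tvec) \<Rightarrow> bool" where
  "oriented_onb G x E \<longleftrightarrow>
     (\<forall>i. E i \<in> tangent_space G x) \<and>
     (\<forall>i j. metric G x (E i) (E j) = (if i = j then 1 else 0)) \<and>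
     (\<forall>v\<in>tangent_space G x. \<exists>a. v = (\<lambda>f. \<Sum>i\<in>UNIV. a i * E i f)) \<and>
     (\<forall>(U, \<phi>)\<in>atlas G. x \<in> U \<longrightarrow> det (\<chi> i j. E i (\<lambda>y. \<phi> y $ j)) > 0)"

definition oriented_onframe ::
    "('a, 'z) riem_manifold_scheme \<Rightarrow> 'a set \<Rightarrow> (3 \<Rightarrow> 'a vfield) \<Rightarrow> bool" where
  "oriented_onframe G U E \<longleftrightarrow>
     (\<forall>i. E i \<in> vector_fields G U) \<and> (\<forall>x\<in>U. oriented_onb G x (\<lambda>i. E i x))"

text \<open>An arbitrary local positively oriented orthonormal frame around \<open>x\<close>.\<close>
definition local_frame :: "('a, 'z) riem_manifold_scheme \<Rightarrow> 'a \<Rightarrow> 3 \<Rightarrow> 'a vfield" where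
  "local_frame G x = (SOME E. \<exists>U. openin (mtop G) U \<and> x \<in> U \<and> oriented_onframe G U E)"


section \<open>\<open>SU(2)\<close> and its irreducible representations\<close>

definition hermitian_conj :: "complex^2^2 \<Rightarrow> complex^2^2" where
  "hermitian_conj h = (\<chi> i j. cnj (h $ j $ i))"

definition SU2 :: "(complex^2^2) set" where
  "SU2 = {h. h ** hermitian_conj h = mat 1 \<and> det h = 1}"

definition sigma :: "3 \<Rightarrow> complex^2^2" where
  "sigma i =
    (if i = 1 then vector [vector [\<i>, 0], vector [0, -\<i>]]
     else if i = 2 then vector [vector [0, 1], vector [-1, 0]]
     else vector [vector [0, \<i>], vector [\<i>, 0]])"

text \<open>The identification of \<open>\<real>\<^sup>3\<close> with the Lie algebra of \<open>SU(2)\<close>; it is injective, and \<open>inv su2\<close>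
  below is only applied to matrices in its range.\<close>
definition su2 :: "real^3 \<Rightarrow> complex^2^2" where
  "su2 X = (\<Sum>i\<in>UNIV. (X $ i) *\<^sub>R sigma i)"

definition Ad :: "complex^2^2 \<Rightarrow> real^3 \<Rightarrow> real^3" where
  "Ad h X = inv su2 (h ** su2 X ** hermitian_conj h)"

definition ad :: "real^3 \<Rightarrow> real^3 \<Rightarrow> real^3" where
  "ad W X = inv su2 (su2 W ** su2 X - su2 X ** su2 W)"

text \<open>The polynomials of degree at most \<open>m\<close>; for negative \<open>m\<close> this is the zero space.\<close>
definition Vpoly :: "int \<Rightarrow> complex poly set" where
  "Vpoly m = {p. p = 0 \<or> int (degree p) \<le> m}"

text \<open>With \<open>h = (a b; c d)\<close>, the monomial \<open>z\<^sup>k\<close> is mapped to \<open>(b z + d)\<^bsup>m-k\<^esup> (a z + c)\<^sup>k\<close>.\<close>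
definition rho :: "int \<Rightarrow> complex^2^2 \<Rightarrow> complex poly \<Rightarrow> complex poly" where
  "rho m h p = (\<Sum>k\<le>nat m. smult (coeff p k)
     ([:h $ 2 $ 2, h $ 1 $ 2:] ^ (nat m - k) * [:h $ 2 $ 1, h $ 1 $ 1:] ^ k))"

text \<open>The differential of \<open>rho m\<close> at the identity, coefficient by coefficient. Since \<open>rho m h p\<close> is
  polynomial in the entries of \<open>h\<close>, it can be computed along the line \<open>1 + t W\<close>, which is tangent to
  \<open>SU(2)\<close> at the identity.\<close>
definition drho :: "int \<Rightarrow> real^3 \<Rightarrow> complex poly \<Rightarrow> complex poly" where
  "drho m W p = (\<Sum>k\<le>nat m. monom
     (vector_derivative (\<lambda>t::real. coeff (rho m (mat 1 + t *\<^sub>R su2 W) p) k) (at 0)) k)"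


section \<open>Clifford homomorphisms\<close>

text \<open>The map determined by the images \<open>C k\<close>, \<open>A k\<close>, \<open>B k\<close> of \<open>z\<^sup>k\<close> under
  \<open>e\<^sub>1/2\<close>, \<open>e\<^sub>2/2 + \<i> e\<^sub>3/2\<close>, \<open>e\<^sub>2/2 - \<i> e\<^sub>3/2\<close>. The coefficients come from
  \<open>X = 2 X\<^sub>1 (e\<^sub>1/2) + (X\<^sub>2 - \<i> X\<^sub>3) (e\<^sub>2/2 + \<i> e\<^sub>3/2) + (X\<^sub>2 + \<i> X\<^sub>3) (e\<^sub>2/2 - \<i> e\<^sub>3/2)\<close>.\<close>
definition cliff_ext ::
    "(nat \<Rightarrow> complex poly) \<Rightarrow> (nat \<Rightarrow> complex poly) \<Rightarrow> (nat \<Rightarrow> complex poly) \<Rightarrow>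
     int \<Rightarrow> real^3 \<Rightarrow> complex poly \<Rightarrow> complex poly" where
  "cliff_ext C A B m X p = (\<Sum>k\<le>nat m. smult (coeff p k)
     (smult (of_real (2 * X $ 1)) (C k)
      + smult (of_real (X $ 2) - \<i> * of_real (X $ 3)) (A k)
      + smult (of_real (X $ 2) + \<i> * of_real (X $ 3)) (B k)))"

text \<open>Wherever an exponent below would leave the admissible range (and the subtraction on
  natural numbers truncates), the coefficient vanishes. In particular \<open>cliff_minus\<close> is zero on
  \<open>Vpoly 0\<close> and \<open>Vpoly 1\<close>.\<close>

definition cliff_zero :: "int \<Rightarrow> real^3 \<Rightarrow> complex poly \<Rightarrow> complex poly" where
  "cliff_zero m = cliff_ext
     (\<lambda>k. monom (\<i> * (of_nat k - of_int m / 2)) k)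
     (\<lambda>k. monom (- of_nat k) (k - 1))
     (\<lambda>k. monom (of_int (m - int k)) (k + 1)) m"

definition cliff_plus :: "int \<Rightarrow> real^3 \<Rightarrow> complex poly \<Rightarrow> complex poly" where
  "cliff_plus m = cliff_ext
     (\<lambda>k. monom \<i> (k + 1))
     (\<lambda>k. monom (-1) k)
     (\<lambda>k. monom (-1) (k + 2)) m"

definition cliff_minus :: "int \<Rightarrow> real^3 \<Rightarrow> complex poly \<Rightarrow> complex poly" where
  "cliff_minus m = cliff_ext
     (\<lambda>k. monom (\<i> * of_nat k * of_int (m - int k)) (k - 1))
     (\<lambda>k. monom (of_int (int k * (int k - 1))) (k - 2))
     (\<lambda>k. monom (of_int ((m - int k) * (m - int k - 1))) k) m"


section \<open>Spin structures and the bundles \<open>S\<^sub>m\<close>\<close>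

text \<open>The principal bundle has total space \<open>spin\<close>, projection \<open>proj\<close> and right action \<open>act\<close>; its smooth
  structure is given by a bundle atlas, i.e. by a family \<open>lsecs\<close> of local sections (equivalently,
  of local trivialisations) with smooth transition functions. The map \<open>frm p\<close> is the isometry
  \<open>X \<mapsto> [p, X]\<close> of \<open>\<real>\<^sup>3\<close> onto the tangent space: it is the equivariant bundle map from \<open>spin\<close> to
  the bundle of oriented orthonormal frames, and it realises
  \<open>T(M)\<close> as \<open>spin \<times>\<^bsub>Ad\<^esub> \<real>\<^sup>3\<close>.\<close>
record ('a, 'p) spin_manifold = "'a riem_manifold" +
  spin :: "'p set"
  proj :: "'p \<Rightarrow> 'a"
  act :: "'p \<Rightarrow> complex^2^2 \<Rightarrow> 'p"
  lsecs :: "('a set \<times> ('a \<Rightarrow> 'p)) set"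
  frm :: "'p \<Rightarrow> real^3 \<Rightarrow> 'a tvec"

definition principal_SU2_bundle :: "('a, 'p) spin_manifold \<Rightarrow> bool" where
  "principal_SU2_bundle G \<longleftrightarrow>
     proj G ` spin G = topspace (mtop G) \<and>
     (\<forall>p\<in>spin G. act G p (mat 1) = p \<and>
        (\<forall>h\<in>SU2. act G p h \<in> spin G \<and> proj G (act G p h) = proj G p \<and>
           (\<forall>k\<in>SU2. act G (act G p h) k = act G p (h ** k)))) \<and>
     (\<forall>p\<in>spin G. \<forall>q\<in>spin G. proj G p = proj G q \<longrightarrow> (\<exists>!h. h \<in> SU2 \<and> q = act G p h)) \<and>
     (\<Union>(U, s)\<in>lsecs G. U) = topspace (mtop G) \<and>
     (\<forall>(U, s)\<in>lsecs G. openin (mtop G) U \<and> (\<forall>x\<in>U. s x \<in> spin G \<and> proj G (s x) = x)) \<and>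
     (\<forall>(U, s)\<in>lsecs G. \<forall>(U', s')\<in>lsecs G. \<exists>h. msmooth G (U \<inter> U') h \<and>
        (\<forall>x\<in>U \<inter> U'. h x \<in> SU2 \<and> s' x = act G (s x) (h x)))"

definition spin_structure :: "('a, 'p) spin_manifold \<Rightarrow> bool" where
  "spin_structure G \<longleftrightarrow> principal_SU2_bundle G \<and>
     (\<forall>p\<in>spin G.
        (\<forall>X Y a b. frm G p (a *\<^sub>R X + b *\<^sub>R Y) = tadd (tscale a (frm G p X)) (tscale b (frm G p Y))) \<and>
        oriented_onb G (proj G p) (\<lambda>i. frm G p (axis i 1)) \<and>
        (\<forall>h\<in>SU2. \<forall>X. frm G (act G p h) X = frm G p (Ad h X))) \<and>
     (\<forall>(U, s)\<in>lsecs G. \<forall>X. (\<lambda>x. frm G (s x) X) \<in> vector_fields G U)"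

text \<open>An element of the associated bundle \<open>S\<^sub>m = spin \<times>\<^bsub>\<rho>\<^esub> V\<^sub>m\<close> is the class \<open>[p, v]\<close> generated by
  \<open>(p h, w) ~ (p, \<rho>(h) w)\<close>. Each class over \<open>x\<close> is the graph of a function from the fibre of
  \<open>spin\<close> over \<open>x\<close> to \<open>Vpoly m\<close>, so that \<open>val \<xi> p\<close> is the \<open>v\<close> with \<open>\<xi> = [p, v]\<close>.\<close>
type_synonym 'p spinor = "('p \<times> complex poly) set"

definition cls :: "('a, 'p) spin_manifold \<Rightarrow> int \<Rightarrow> 'p \<Rightarrow> complex poly \<Rightarrow> 'p spinor" where
  "cls G m p v = {(act G p h, w) | h w. h \<in> SU2 \<and> w \<in> Vpoly m \<and> rho m h w = v}"

definition fibre :: "('a, 'p) spin_manifold \<Rightarrow> int \<Rightarrow> 'a \<Rightarrow> 'p spinor set" where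
  "fibre G m x = {cls G m p v | p v. p \<in> spin G \<and> proj G p = x \<and> v \<in> Vpoly m}"

definition val :: "'p spinor \<Rightarrow> 'p \<Rightarrow> complex poly" where
  "val \<xi> p = (THE v. (p, v) \<in> \<xi>)"

text \<open>\<open>[p, v] + [p, w] = [p, v + w]\<close>, \<open>a [p, v] = [p, a v]\<close>, and \<open>\<rho>([p, Y]) [p, v] = [p, \<rho>(Y) v]\<close>.\<close>

definition fadd :: "'p spinor \<Rightarrow> 'p spinor \<Rightarrow> 'p spinor" where
  "fadd \<xi> \<eta> = {(p, v + w) | p v w. (p, v) \<in> \<xi> \<and> (p, w) \<in> \<eta>}"

definition fscale :: "complex \<Rightarrow> 'p spinor \<Rightarrow> 'p spinor" where
  "fscale a \<xi> = {(p, smult a v) | p v. (p, v) \<in> \<xi>}"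

definition fsub :: "'p spinor \<Rightarrow> 'p spinor \<Rightarrow> 'p spinor" where
  "fsub \<xi> \<eta> = fadd \<xi> (fscale (-1) \<eta>)"

definition fsum3 :: "(3 \<Rightarrow> 'p spinor) \<Rightarrow> 'p spinor" where
  "fsum3 F = fadd (fadd (F 1) (F 2)) (F 3)"

definition fzero :: "('a, 'p) spin_manifold \<Rightarrow> 'a \<Rightarrow> 'p spinor" where
  "fzero G x = {(p, 0) | p. p \<in> spin G \<and> proj G p = x}"

definition cliff_bundle ::
    "('a, 'p) spin_manifold \<Rightarrow> (real^3 \<Rightarrow> complex poly \<Rightarrow> complex poly) \<Rightarrow>
     'a tvec \<Rightarrow> 'p spinor \<Rightarrow> 'p spinor" where
  "cliff_bundle G \<rho> X \<xi> = {(p, \<rho> Y v) | p Y v. (p, v) \<in> \<xi> \<and> frm G p Y = X}"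

type_synonym ('a, 'p) section_S = "'a \<Rightarrow> 'p spinor"

text \<open>The space \<open>\<Gamma>(M, S\<^sub>m)\<close> of smooth sections; the values outside \<open>M\<close> are irrelevant.\<close>
definition sections :: "('a, 'p) spin_manifold \<Rightarrow> int \<Rightarrow> ('a, 'p) section_S set" where
  "sections G m = {s.
     (\<forall>x\<in>topspace (mtop G). s x \<in> fibre G m x) \<and>
     (\<forall>(U, \<sigma>)\<in>lsecs G. \<forall>k. msmooth G U (\<lambda>x. coeff (val (s x) (\<sigma> x)) k))}"


section \<open>The spin connection\<close>

text \<open>The value on \<open>v\<close> of the Levi-Civita connection form in the gauge \<open>\<sigma>\<close>, as an element of
  the Lie algebra of \<open>SU(2)\<close>, lifted along the isomorphism \<open>ad\<close> onto the skew-symmetric matrices.\<close>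
definition conn_form ::
    "('a, 'p) spin_manifold \<Rightarrow> ('a \<Rightarrow> 'p) \<Rightarrow> 'a \<Rightarrow> 'a tvec \<Rightarrow> real^3" where
  "conn_form G \<sigma> x v =
     (THE W. \<forall>X. LC G x v (\<lambda>y. frm G (\<sigma> y) X) = frm G (\<sigma> x) (ad W X))"

text \<open>The tangent vector \<open>v\<close> applied coefficientwise to a \<open>Vpoly m\<close>-valued function.\<close>
definition tderiv :: "int \<Rightarrow> 'a tvec \<Rightarrow> ('a \<Rightarrow> complex poly) \<Rightarrow> complex poly" where
  "tderiv m v f = (\<Sum>k\<le>nat m. monom
     (Complex (v (\<lambda>y. Re (coeff (f y) k))) (v (\<lambda>y. Im (coeff (f y) k)))) k)"

definition some_lsec :: "('a, 'p) spin_manifold \<Rightarrow> 'a \<Rightarrow> 'a \<Rightarrow> 'p" where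
  "some_lsec G x = snd (SOME c. c \<in> lsecs G \<and> x \<in> fst c)"

text \<open>\<open>\<nabla>\<^sub>v [\<sigma>, f] = [\<sigma>, v(f) + \<rho>\<^sub>*(\<omega>\<^sub>\<sigma>(v)) f]\<close>, which does not depend on the gauge \<open>\<sigma>\<close>.\<close>
definition covd ::
    "('a, 'p) spin_manifold \<Rightarrow> int \<Rightarrow> 'a \<Rightarrow> 'a tvec \<Rightarrow> ('a, 'p) section_S \<Rightarrow> 'p spinor" where
  "covd G m x v s = (let \<sigma> = some_lsec G x; f = (\<lambda>y. val (s y) (\<sigma> y)) in
     cls G m (\<sigma> x) (tderiv m v f + drho m (conn_form G \<sigma> x v) (f x)))"


section \<open>Higher spin Dirac operators and the connection Laplacian\<close>

definition D_zero :: "('a, 'p) spin_manifold \<Rightarrow> int \<Rightarrow> ('a, 'p) section_S \<Rightarrow> ('a, 'p) section_S" where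
  "D_zero G m s = (\<lambda>x. let E = local_frame G x in
     fsum3 (\<lambda>i. cliff_bundle G (cliff_zero m) (E i x) (covd G m x (E i x) s)))"

definition D_plus :: "('a, 'p) spin_manifold \<Rightarrow> int \<Rightarrow> ('a, 'p) section_S \<Rightarrow> ('a, 'p) section_S" where
  "D_plus G m s = (\<lambda>x. let E = local_frame G x in
     fsum3 (\<lambda>i. cliff_bundle G (cliff_plus m) (E i x) (covd G m x (E i x) s)))"

definition D_minus :: "('a, 'p) spin_manifold \<Rightarrow> int \<Rightarrow> ('a, 'p) section_S \<Rightarrow> ('a, 'p) section_S" where
  "D_minus G m s = (\<lambda>x. let E = local_frame G x in
     fsum3 (\<lambda>i. cliff_bundle G (cliff_minus m) (E i x) (covd G m x (E i x) s)))"

text \<open>\<open>\<nabla>\<^sup>*\<nabla> = - tr \<nabla>\<^sup>2 = - \<Sum>\<^sub>i (\<nabla>\<^bsub>E i\<^esub> \<nabla>\<^bsub>E i\<^esub> - \<nabla>\<^bsub>\<nabla>\<^bsub>E i\<^esub> (E i)\<^esub>)\<close>\<close>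
definition connection_laplacian ::
    "('a, 'p) spin_manifold \<Rightarrow> int \<Rightarrow> ('a, 'p) section_S \<Rightarrow> ('a, 'p) section_S" where
  "connection_laplacian G m s = (\<lambda>x. let E = local_frame G x in
     fscale (-1) (fsum3 (\<lambda>i. fsub
       (covd G m x (E i x) (\<lambda>y. covd G m y (E i y) s))
       (covd G m x (LC G x (E i x) (E i)) s))))"

definition sadd :: "('a, 'p) section_S \<Rightarrow> ('a, 'p) section_S \<Rightarrow> ('a, 'p) section_S"
    (infixl "\<oplus>" 65) where
  "s \<oplus> t = (\<lambda>x. fadd (s x) (t x))"

definition ssub :: "('a, 'p) section_S \<Rightarrow> ('a, 'p) section_S \<Rightarrow> ('a, 'p) section_S"
    (infixl "\<ominus>" 65) where
  "s \<ominus> t = (\<lambda>x. fsub (s x) (t x))"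

definition sscale :: "real \<Rightarrow> ('a, 'p) section_S \<Rightarrow> ('a, 'p) section_S" (infixr "\<odot>" 75) where
  "a \<odot> s = (\<lambda>x. fscale (of_real a) (s x))"

definition section_eq ::
    "('a, 'p) spin_manifold \<Rightarrow> ('a, 'p) section_S \<Rightarrow> ('a, 'p) section_S \<Rightarrow> bool" where
  "section_eq G s t \<longleftrightarrow> (\<forall>x\<in>topspace (mtop G). s x = t x)"

definition Delta :: "('a, 'p) spin_manifold \<Rightarrow> int \<Rightarrow> ('a, 'p) section_S \<Rightarrow> ('a, 'p) section_S" where
  "Delta G m s = D_zero G m (D_zero G m s) \<oplus> D_plus G (m - 2) (D_minus G m s)"

definition Delta_tilde ::
    "('a, 'p) spin_manifold \<Rightarrow> int \<Rightarrow> ('a, 'p) section_S \<Rightarrow> ('a, 'p) section_S" where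
  "Delta_tilde G m s = D_zero G m (D_zero G m s) \<oplus> D_minus G (m + 2) (D_plus G m s)"

end

theory Submission
  imports Defs
begin

text \<open>Over a local section of the spin bundle (a gauge) a section of \<open>S\<^sub>m\<close> is a polynomial-valued function \<open>F\<close>, and
\<open>\<nabla>\<^sub>v = v + \<rho>\<^sub>*(\<omega>(v))\<close> with the connection form \<open>\<omega>\<close> in the Lie algebra of \<open>SU(2)\<close>. Let \<open>e\<^sub>i\<close> be the frame that
belongs to the gauge and let \<open>H\<^sub>i\<^sub>j = \<nabla>\<^sub>i \<nabla>\<^sub>j F - \<nabla>\<^bsub>\<nabla>\<^sub>i e\<^sub>j\<^esub> F\<close> be the Hessian of \<open>F\<close>. The Clifford homomorphisms are
parallel because they are equivariant, so the composition of two first-order operators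
\<open>a = \<Sum>\<^sub>i a(e\<^sub>i) \<nabla>\<^sub>i\<close> and \<open>b = \<Sum>\<^sub>j b(e\<^sub>j) \<nabla>\<^sub>j\<close> is \<open>\<Sum>\<^sub>i\<^sub>j a(e\<^sub>i) b(e\<^sub>j) H\<^sub>i\<^sub>j\<close> (\<open>dirac_dirac_val\<close>), and
\<open>\<nabla>\<^sup>*\<nabla> F = - \<Sum>\<^sub>j H\<^sub>j\<^sub>j\<close> (\<open>laplacian_val\<close>).

Everything is thereby reduced to the products of Clifford homomorphisms. On polynomials these are differential
operators in the variable \<open>z\<close>, and identities in the Weyl algebra (\<open>weyl_relations\<close>) show, with \<open>Z\<close>, \<open>P\<close>, \<open>N\<close>
for \<open>\<rho>\<^sup>0\<close>, \<open>\<rho>\<^sup>+\<close>, \<open>\<rho>\<^sup>-\<close>, that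
\<open>Z\<^sub>i Z\<^sub>j + P\<^sub>i N\<^sub>j = - m\<^sup>2 \<delta>\<^sub>i\<^sub>j + m \<epsilon>\<^sub>i\<^sub>j\<^sub>k Z\<^sub>k\<close>, that
\<open>Z\<^sub>i Z\<^sub>j + N\<^sub>i P\<^sub>j = - (m + 2)\<^sup>2 \<delta>\<^sub>i\<^sub>j - (m + 2) \<epsilon>\<^sub>i\<^sub>j\<^sub>k Z\<^sub>k\<close>, and that \<open>Z\<^sub>i P\<^sub>j - P\<^sub>i Z\<^sub>j\<close> and \<open>Z\<^sub>i N\<^sub>j - N\<^sub>i Z\<^sub>j\<close> are
multiples of \<open>\<epsilon>\<^sub>i\<^sub>j\<^sub>k P\<^sub>k\<close> and \<open>\<epsilon>\<^sub>i\<^sub>j\<^sub>k N\<^sub>k\<close>. The symmetric parts give the connection Laplacian. The skew parts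
only see \<open>H\<^sub>i\<^sub>j - H\<^sub>j\<^sub>i\<close>, which is \<open>\<rho>\<^sub>*\<close> of the curvature (\<open>hess_commutator\<close>). For constant sectional curvature
\<open>c\<close> the curvature is \<open>- (c/2) \<epsilon>\<^sub>i\<^sub>j\<^sub>k e\<^sub>k\<close> (\<open>curv_constant\<close>): sectional curvatures determine the quadratic form of the
curvature operator on the Lie algebra, and the first Bianchi identity makes that operator symmetric. So the skew
parts contract to \<open>\<Sum>\<^sub>k Z\<^sub>k Z\<^sub>k = - m (m + 2)\<close> in the first two formulas and to
\<open>\<Sum>\<^sub>k P\<^sub>k Z\<^sub>k = \<Sum>\<^sub>k N\<^sub>k Z\<^sub>k = 0\<close> in the other two (\<open>casimir\<close>). The statements about commuting operators then follow
formally (\<open>commute_sum\<close>).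

The operators are defined pointwise with a gauge and a frame that are chosen anew at each point. The choice of
the frame does not matter because a sum over an orthonormal basis is invariant (\<open>orthonormal_sum\<close>), and the choice
of the gauge does not matter because \<open>\<omega>\<close> transforms by \<open>h\<^sup>-\<^sup>1 dh + Ad(h\<^sup>-\<^sup>1) \<omega>\<close>, which cancels the derivative of the
transition function \<open>h\<close> (\<open>covd_val\<close>). That derivative and the differential \<open>\<rho>\<^sub>*\<close> are both obtained from the same
computation with an abstract Leibniz rule (\<open>rho_jet\<close>).\<close>


section \<open>Smooth functions\<close>

lemma frechet_derivative_mult_at:
  fixes f g :: "'a::real_normed_vector \<Rightarrow> 'b::real_normed_algebra"
  assumes "f differentiable at x" "g differentiable at x"
  shows "frechet_derivative (\<lambda>y. f y * g y) (at x) v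
    = f x * frechet_derivative g (at x) v + frechet_derivative f (at x) v * g x"
  using fun_cong[OF frechet_derivative_at[OF has_derivative_mult[OF
      assms[unfolded frechet_derivative_works]]], of v] by simp

lemma frechet_derivative_add_at:
  assumes "f differentiable at x" "g differentiable at x"
  shows "frechet_derivative (\<lambda>y. f y + g y) (at x) v
    = frechet_derivative f (at x) v + frechet_derivative g (at x) v"
  using fun_cong[OF frechet_derivative_at[OF has_derivative_add[OF
      assms[unfolded frechet_derivative_works]]], of v] by simp

lemma frechet_derivative_bounded_linear_at:
  assumes "bounded_linear L" "f differentiable at x"
  shows "frechet_derivative (\<lambda>y. L (f y)) (at x) v = L (frechet_derivative f (at x) v)"
  using fun_cong[OF frechet_derivative_at[OF bounded_linear.has_derivative[OF assms(1)
      assms(2)[unfolded frechet_derivative_works]]], of v] by simp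

lemma Ck_on_cong:
  assumes "open S" "\<And>x. x \<in> S \<Longrightarrow> f x = g x" "Ck_on k S f"
  shows "Ck_on k S g"
  using assms(2,3)
proof (induction k arbitrary: f g)
  case 0
  then show ?case using continuous_on_cong by force
next
  case (Suc k)
  have d: "f differentiable at x" if "x \<in> S" for x
    using Suc.prems(2) that assms(1) by (simp add: differentiable_on_eq_differentiable_at)
  have "g differentiable at x" if "x \<in> S" for x
    using has_derivative_transform_within_open[OF d[OF that, unfolded frechet_derivative_works]
        assms(1) that] Suc.prems(1) by (auto simp: differentiable_def)
  moreover have "frechet_derivative f (at x) v = frechet_derivative g (at x) v" if "x \<in> S" for x v
    using frechet_derivative_transform_within_open[OF d[OF that] assms(1) that] Suc.prems(1) by simp
  ultimately show ?case
    using Suc.IH[of "\<lambda>x. frechet_derivative f (at x) _"] Suc.prems(2) assms(1)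
    by (auto simp: differentiable_on_eq_differentiable_at)
qed

lemma Ck_on_subset:
  assumes "Ck_on k S f" "T \<subseteq> S"
  shows "Ck_on k T f"
  using assms(1)
  by (induction k arbitrary: f)
    (use assms(2) in \<open>auto intro: continuous_on_subset differentiable_on_subset\<close>)

lemma Ck_on_Suc_imp: "Ck_on (Suc k) S f \<Longrightarrow> Ck_on k S f"
proof (induction k arbitrary: f)
  case 0
  then show ?case by (simp add: differentiable_imp_continuous_on)
next
  case (Suc k)
  then show ?case by (metis Ck_on.simps(2))
qed

lemma Ck_on_add:
  assumes "open S" "Ck_on k S f" "Ck_on k S g"
  shows "Ck_on k S (\<lambda>x. f x + g x)"
  using assms(2,3)
proof (induction k arbitrary: f g)
  case 0
  then show ?case by (simp add: continuous_on_add)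
next
  case (Suc k)
  have "Ck_on k S (\<lambda>x. frechet_derivative (\<lambda>x. f x + g x) (at x) v)" for v
    by (rule Ck_on_cong[OF assms(1) _ Suc.IH[of "\<lambda>x. frechet_derivative f (at x) v"
            "\<lambda>x. frechet_derivative g (at x) v"]])
      (use Suc.prems assms(1) in \<open>auto simp: frechet_derivative_add_at
          differentiable_on_eq_differentiable_at\<close>)
  with Suc.prems show ?case by simp
qed

lemma Ck_on_mult:
  fixes f g :: "'a::real_normed_vector \<Rightarrow> 'b::real_normed_algebra"
  assumes "open S" "Ck_on k S f" "Ck_on k S g"
  shows "Ck_on k S (\<lambda>x. f x * g x)"
  using assms(2,3)
proof (induction k arbitrary: f g)
  case 0
  then show ?case by (simp add: continuous_on_mult)
next
  case (Suc k)
  have fg: "Ck_on k S f" "Ck_on k S g" using Suc.prems Ck_on_Suc_imp by blast+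
  have "Ck_on k S (\<lambda>x. frechet_derivative (\<lambda>x. f x * g x) (at x) v)" for v
    by (rule Ck_on_cong[OF assms(1) _ Ck_on_add[OF assms(1)
            Suc.IH[of f "\<lambda>x. frechet_derivative g (at x) v"]
            Suc.IH[of "\<lambda>x. frechet_derivative f (at x) v" g]]])
      (use Suc.prems assms(1) fg in \<open>auto simp: frechet_derivative_mult_at
          differentiable_on_eq_differentiable_at\<close>)
  with Suc.prems show ?case by simp
qed

lemma Ck_on_bounded_linear:
  assumes "open S" "bounded_linear L" "Ck_on k S f"
  shows "Ck_on k S (\<lambda>x. L (f x))"
  using assms(3)
proof (induction k arbitrary: f)
  case 0
  then show ?case by (simp add: bounded_linear.continuous_on[OF assms(2)])
next
  case (Suc k)
  have "Ck_on k S (\<lambda>x. frechet_derivative (\<lambda>x. L (f x)) (at x) v)" for v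
    by (rule Ck_on_cong[OF assms(1) _ Suc.IH[of "\<lambda>x. frechet_derivative f (at x) v"]])
      (use Suc.prems assms(1,2) in \<open>auto simp: frechet_derivative_bounded_linear_at
          differentiable_on_eq_differentiable_at\<close>)
  moreover have "(\<lambda>x. L (f x)) differentiable_on S"
    using Suc.prems assms(1,2) bounded_linear.has_derivative[OF assms(2)]
    by (fastforce simp: differentiable_on_eq_differentiable_at differentiable_def)
  ultimately show ?case by simp
qed

lemma Ck_on_const: "Ck_on k S (\<lambda>x. c)"
  by (induction k arbitrary: c) auto

locale smooth3 =
  fixes G :: "('a, 'z) riem_manifold_scheme"
  assumes mfd: "oriented_smooth_3manifold G"
begin

lemma chart_inv:
  assumes "(V, \<phi>) \<in> atlas G" "y \<in> V"
  shows "inv_into V \<phi> (\<phi> y) = y"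
proof -
  have "homeomorphic_map (subtopology (mtop G) V) (top_of_set (\<phi> ` V)) \<phi>" "openin (mtop G) V"
    using mfd assms(1) unfolding oriented_smooth_3manifold_def by auto
  then have "inj_on \<phi> V"
    by (metis homeomorphic_imp_injective_map openin_subset topspace_subtopology_subset)
  then show ?thesis using assms(2) by simp
qed

lemma open_chart_image:
  assumes "(V, \<phi>) \<in> atlas G" "openin (mtop G) U"
  shows "open (\<phi> ` (U \<inter> V))"
proof -
  have h: "homeomorphic_map (subtopology (mtop G) V) (top_of_set (\<phi> ` V)) \<phi>" "openin (mtop G) V"
      and o: "open (\<phi> ` V)"
    using mfd assms(1) unfolding oriented_smooth_3manifold_def by auto
  have "openin (subtopology (mtop G) V) (U \<inter> V)"
    using assms(2) by (meson openin_subtopology_Int)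
  moreover have "U \<inter> V \<subseteq> topspace (subtopology (mtop G) V)"
    using openin_subset[OF h(2)] by auto
  ultimately have "openin (top_of_set (\<phi> ` V)) (\<phi> ` (U \<inter> V))"
    using homeomorphic_map_openness[OF h(1)] by blast
  then show ?thesis using o openin_open_eq by blast
qed

lemma msmooth_cong:
  assumes "openin (mtop G) U" "\<And>x. x \<in> U \<Longrightarrow> f x = g x" "msmooth G U f"
  shows "msmooth G U g"
  unfolding msmooth_def smooth_on_def
proof safe
  fix V \<phi> k assume c: "(V, \<phi>) \<in> atlas G"
  show "Ck_on k (\<phi> ` (U \<inter> V)) (g \<circ> inv_into V \<phi>)"
    by (rule Ck_on_cong[OF open_chart_image[OF c assms(1)], of "f \<circ> inv_into V \<phi>"])
      (use assms c in \<open>auto simp: chart_inv[OF c] msmooth_def smooth_on_def\<close>)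
qed

lemma msmooth_subset: "msmooth G U f \<Longrightarrow> W \<subseteq> U \<Longrightarrow> msmooth G W f"
  unfolding msmooth_def smooth_on_def
  by (force intro: Ck_on_subset)

lemma msmooth_add:
  assumes "openin (mtop G) U" "msmooth G U f" "msmooth G U g"
  shows "msmooth G U (\<lambda>x. f x + g x)"
  using assms Ck_on_add[OF open_chart_image] unfolding msmooth_def smooth_on_def o_def by fast

lemma msmooth_mult:
  fixes f g :: "'a \<Rightarrow> 'b::real_normed_algebra"
  assumes "openin (mtop G) U" "msmooth G U f" "msmooth G U g"
  shows "msmooth G U (\<lambda>x. f x * g x)"
  using assms Ck_on_mult[OF open_chart_image] unfolding msmooth_def smooth_on_def o_def by fast

lemma msmooth_linear:
  assumes "openin (mtop G) U" "bounded_linear L" "msmooth G U f"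
  shows "msmooth G U (\<lambda>x. L (f x))"
  using assms Ck_on_bounded_linear[OF open_chart_image] unfolding msmooth_def smooth_on_def o_def
  by fast

lemma msmooth_const: "msmooth G U (\<lambda>x. c)"
  by (auto simp: msmooth_def smooth_on_def o_def Ck_on_const)

lemma msmooth_sum:
  assumes "openin (mtop G) U" "\<And>i. i \<in> I \<Longrightarrow> msmooth G U (f i)"
  shows "msmooth G U (\<lambda>x. \<Sum>i\<in>I. f i x)"
  using assms(2)
  by (induction I rule: infinite_finite_induct) (auto intro: msmooth_const msmooth_add[OF assms(1)])

text \<open>Tangent vectors act on real functions only, so complex coefficients are differentiated through their parts.\<close>
lemma msmooth_Re_Im_iff:
  fixes f :: "'a \<Rightarrow> complex"
  assumes "openin (mtop G) U"
  shows "msmooth G U f \<longleftrightarrow> msmooth G U (\<lambda>x. Re (f x)) \<and> msmooth G U (\<lambda>x. Im (f x))"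
proof (intro iffI conjI)
  assume r: "msmooth G U (\<lambda>x. Re (f x)) \<and> msmooth G U (\<lambda>x. Im (f x))"
  have "msmooth G U (\<lambda>x. complex_of_real (Re (f x)) + \<i> * complex_of_real (Im (f x)))"
    using r by (intro msmooth_add msmooth_mult msmooth_const assms
        msmooth_linear[OF _ bounded_linear_of_real]) auto
  then show "msmooth G U f" by (simp flip: complex_eq)
qed (auto intro: msmooth_linear[OF assms bounded_linear_Re] msmooth_linear[OF assms bounded_linear_Im])

end


section \<open>Tangent vectors and vector fields\<close>

context smooth3 begin

abbreviation "M \<equiv> topspace (mtop G)"
abbreviation "opn \<equiv> openin (mtop G)"
abbreviation "T \<equiv> tangent_space G"
abbreviation "VF \<equiv> vector_fields G"

lemma msmooth_nearI: "opn U \<Longrightarrow> x \<in> U \<Longrightarrow> msmooth G U f \<Longrightarrow> msmooth_near G x f"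
  unfolding msmooth_near_def by blast

lemma msmooth_near_common:
  assumes "msmooth_near G x f" "msmooth_near G x h" "opn U" "x \<in> U"
  obtains W where "opn W" "x \<in> W" "W \<subseteq> U" "msmooth G W f" "msmooth G W h"
proof -
  obtain A B where "opn A" "x \<in> A" "msmooth G A f" "opn B" "x \<in> B" "msmooth G B h"
    using assms unfolding msmooth_near_def by blast
  then show thesis using assms(3,4)
    by (intro that[of "A \<inter> B \<inter> U"]) (auto intro: msmooth_subset)
qed

lemma msmooth_near_add:
  assumes "msmooth_near G x f" "msmooth_near G x h"
  shows "msmooth_near G x (\<lambda>y. f y + h y)"
proof -
  obtain U where "opn U" "x \<in> U" using assms(1) unfolding msmooth_near_def by blast
  from msmooth_near_common[OF assms this]
  obtain W where "opn W" "x \<in> W" "msmooth G W f" "msmooth G W h" by metis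
  then show ?thesis using msmooth_nearI[OF _ _ msmooth_add] by blast
qed

lemma msmooth_near_mult:
  fixes f h :: "'a \<Rightarrow> 'b::real_normed_algebra"
  assumes "msmooth_near G x f" "msmooth_near G x h"
  shows "msmooth_near G x (\<lambda>y. f y * h y)"
proof -
  obtain U where "opn U" "x \<in> U" using assms(1) unfolding msmooth_near_def by blast
  from msmooth_near_common[OF assms this]
  obtain W where "opn W" "x \<in> W" "msmooth G W f" "msmooth G W h" by metis
  then show ?thesis using msmooth_nearI[OF _ _ msmooth_mult] by blast
qed

lemma msmooth_near_cong:
  assumes "opn U" "x \<in> U" "\<And>y. y \<in> U \<Longrightarrow> f y = h y" "msmooth_near G x f"
  shows "msmooth_near G x h"
proof -
  obtain W where "opn W" "x \<in> W" "W \<subseteq> U" "msmooth G W f"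
    using msmooth_near_common[OF assms(4,4,1,2)] .
  then show ?thesis using msmooth_cong[of W f h] assms(3) by (auto simp: msmooth_near_def)
qed

lemma msmooth_near_const: "x \<in> M \<Longrightarrow> msmooth_near G x (\<lambda>y. c)"
  using msmooth_const unfolding msmooth_near_def by blast

lemma msmooth_near_Re_Im:
  fixes f :: "'a \<Rightarrow> complex"
  assumes "msmooth_near G x f"
  shows "msmooth_near G x (\<lambda>y. Re (f y))" "msmooth_near G x (\<lambda>y. Im (f y))"
  using assms msmooth_Re_Im_iff unfolding msmooth_near_def by blast+

lemma tangent_cong:
  assumes "v \<in> T x" "opn U" "x \<in> U" "\<And>y. y \<in> U \<Longrightarrow> f y = h y"
  shows "v f = v h"
proof -
  have "\<forall>f h U. opn U \<longrightarrow> x \<in> U \<longrightarrow> (\<forall>y\<in>U. f y = h y) \<longrightarrow> v f = v h"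
    using assms(1) unfolding tangent_space_def mem_Collect_eq by (elim conjE)
  from this[rule_format, of U f h] show ?thesis using assms(2-4) by simp
qed

lemma tangent_add_mult:
  assumes "v \<in> T x" "msmooth_near G x f" "msmooth_near G x h"
  shows tangent_add: "v (\<lambda>y. f y + h y) = v f + v h"
    and tangent_mult: "v (\<lambda>y. f y * h y) = v f * h x + f x * v h"
proof -
  have "\<forall>f h. msmooth_near G x f \<longrightarrow> msmooth_near G x h \<longrightarrow>
        v (\<lambda>y. f y + h y) = v f + v h \<and> v (\<lambda>y. f y * h y) = v f * h x + f x * v h"
    using assms(1) unfolding tangent_space_def mem_Collect_eq by (elim conjE)
  from this[rule_format, of f h] assms(2,3)
  show "v (\<lambda>y. f y + h y) = v f + v h" "v (\<lambda>y. f y * h y) = v f * h x + f x * v h"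
    by simp_all
qed

lemma tangent_scale:
  assumes "v \<in> T x" "msmooth_near G x f"
  shows "v (\<lambda>y. a * f y) = a * v f"
proof -
  have "\<forall>f a. msmooth_near G x f \<longrightarrow> v (\<lambda>y. a * f y) = a * v f"
    using assms(1) unfolding tangent_space_def mem_Collect_eq by (elim conjE)
  from this[rule_format, of f a] show ?thesis using assms(2) by simp
qed

lemma tangent_zero:
  assumes "v \<in> T x" "\<not> msmooth_near G x f"
  shows "v f = 0"
proof -
  have "\<forall>f. \<not> msmooth_near G x f \<longrightarrow> v f = 0"
    using assms(1) unfolding tangent_space_def mem_Collect_eq by (elim conjE)
  from this[rule_format, of f] show ?thesis using assms(2) by simp
qed

lemma tangent_uminus: "v \<in> T x \<Longrightarrow> msmooth_near G x f \<Longrightarrow> v (\<lambda>y. - f y) = - v f"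
  using tangent_scale[of v x f "-1"] by simp

lemma msmooth_near_uminus:
  fixes f :: "'a \<Rightarrow> real"
  assumes "msmooth_near G x f"
  shows "msmooth_near G x (\<lambda>y. - f y)"
proof -
  obtain U where "opn U" "x \<in> U" "msmooth G U f" using assms unfolding msmooth_near_def by blast
  then show ?thesis
    using msmooth_linear[OF _ bounded_linear_minus[OF bounded_linear_ident]] msmooth_nearI by blast
qed

lemma tangent_diff:
  "v \<in> T x \<Longrightarrow> msmooth_near G x f \<Longrightarrow> msmooth_near G x h \<Longrightarrow> v (\<lambda>y. f y - h y) = v f - v h"
  using tangent_add[of v x f "\<lambda>y. - h y"] tangent_uminus[of v x h] msmooth_near_uminus[of x h] by simp

lemma tangent_const:
  assumes "v \<in> T x" "x \<in> M"
  shows "v (\<lambda>y. c) = 0"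
proof -
  have "v (\<lambda>y. 1 * 1) = 0"
    using tangent_mult[OF assms(1) msmooth_near_const[OF assms(2)] msmooth_near_const[OF assms(2)], of 1 1]
    by simp
  then show ?thesis
    using tangent_scale[OF assms(1) msmooth_near_const[OF assms(2)], of c 1] by simp
qed

lemma tangentI:
  assumes "\<And>f h. msmooth_near G x f \<Longrightarrow> msmooth_near G x h \<Longrightarrow> v (\<lambda>y. f y + h y) = v f + v h"
    and "\<And>f h. msmooth_near G x f \<Longrightarrow> msmooth_near G x h \<Longrightarrow> v (\<lambda>y. f y * h y) = v f * h x + f x * v h"
    and "\<And>f a. msmooth_near G x f \<Longrightarrow> v (\<lambda>y. a * f y) = a * v f"
    and "\<And>f h U. opn U \<Longrightarrow> x \<in> U \<Longrightarrow> (\<And>y. y \<in> U \<Longrightarrow> f y = h y) \<Longrightarrow> v f = v h"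
    and "\<And>f. \<not> msmooth_near G x f \<Longrightarrow> v f = 0"
  shows "v \<in> T x"
  unfolding tangent_space_def mem_Collect_eq
proof (intro conjI allI impI)
  fix f h :: "'a \<Rightarrow> real" and U
  assume "opn U" "x \<in> U" "\<forall>y\<in>U. f y = h y"
  then show "v f = v h" using assms(4)[of U f h] by simp
qed (simp_all add: assms(1,2,3,5))

lemma tadd_tangent:
  assumes "v \<in> T x" "w \<in> T x"
  shows "tadd v w \<in> T x"
proof (rule tangentI)
  fix f h :: "'a \<Rightarrow> real" and U
  assume "opn U" "x \<in> U" "\<And>y. y \<in> U \<Longrightarrow> f y = h y"
  then show "tadd v w f = tadd v w h"
    using tangent_cong[OF assms(1), of U f h] tangent_cong[OF assms(2), of U f h] by (simp add: tadd_def)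
next
  fix f h :: "'a \<Rightarrow> real"
  assume fh: "msmooth_near G x f" "msmooth_near G x h"
  show "tadd v w (\<lambda>y. f y + h y) = tadd v w f + tadd v w h"
    unfolding tadd_def tangent_add[OF assms(1) fh] tangent_add[OF assms(2) fh] by simp
  show "tadd v w (\<lambda>y. f y * h y) = tadd v w f * h x + f x * tadd v w h"
    unfolding tadd_def tangent_mult[OF assms(1) fh] tangent_mult[OF assms(2) fh]
    by (simp add: algebra_simps)
next
  fix f :: "'a \<Rightarrow> real" and a assume f: "msmooth_near G x f"
  show "tadd v w (\<lambda>y. a * f y) = a * tadd v w f"
    unfolding tadd_def tangent_scale[OF assms(1) f] tangent_scale[OF assms(2) f]
    by (simp add: algebra_simps)
next
  fix f :: "'a \<Rightarrow> real" assume f: "\<not> msmooth_near G x f"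
  show "tadd v w f = 0"
    unfolding tadd_def tangent_zero[OF assms(1) f] tangent_zero[OF assms(2) f] by simp
qed

lemma tscale_tangent:
  assumes "v \<in> T x"
  shows "tscale a v \<in> T x"
proof (rule tangentI)
  fix f h :: "'a \<Rightarrow> real" and U
  assume "opn U" "x \<in> U" "\<And>y. y \<in> U \<Longrightarrow> f y = h y"
  then show "tscale a v f = tscale a v h"
    using tangent_cong[OF assms(1), of U f h] by (simp add: tscale_def)
next
  fix f h :: "'a \<Rightarrow> real"
  assume fh: "msmooth_near G x f" "msmooth_near G x h"
  show "tscale a v (\<lambda>y. f y + h y) = tscale a v f + tscale a v h"
    unfolding tscale_def tangent_add[OF assms(1) fh] by (simp add: algebra_simps)
  show "tscale a v (\<lambda>y. f y * h y) = tscale a v f * h x + f x * tscale a v h"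
    unfolding tscale_def tangent_mult[OF assms(1) fh] by (simp add: algebra_simps)
next
  fix f :: "'a \<Rightarrow> real" and b assume f: "msmooth_near G x f"
  show "tscale a v (\<lambda>y. b * f y) = b * tscale a v f"
    unfolding tscale_def tangent_scale[OF assms(1) f] by simp
next
  fix f :: "'a \<Rightarrow> real" assume f: "\<not> msmooth_near G x f"
  show "tscale a v f = 0"
    unfolding tscale_def tangent_zero[OF assms(1) f] by simp
qed

lemma VF_tangent: "X \<in> VF U \<Longrightarrow> x \<in> U \<Longrightarrow> X x \<in> T x"
  unfolding vector_fields_def by blast

lemma VF_smooth: "X \<in> VF U \<Longrightarrow> opn V \<Longrightarrow> V \<subseteq> U \<Longrightarrow> msmooth G V f \<Longrightarrow> msmooth G V (\<lambda>x. X x f)"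
  unfolding vector_fields_def mem_Collect_eq by (elim conjE allE[of _ V] allE[of _ f] impE)

lemma VF_subset: "X \<in> VF U \<Longrightarrow> W \<subseteq> U \<Longrightarrow> X \<in> VF W"
  unfolding vector_fields_def mem_Collect_eq by (meson order_trans subsetD)

lemma VF_smooth_near:
  assumes "X \<in> VF U" "opn U" "x \<in> U" "msmooth_near G x f"
  shows "msmooth_near G x (\<lambda>y. X y f)"
proof -
  obtain W where "opn W" "x \<in> W" "W \<subseteq> U" "msmooth G W f"
    using msmooth_near_common[OF assms(4,4,2,3)] .
  then show ?thesis by (intro msmooth_nearI[OF _ _ VF_smooth[OF assms(1)]])
qed

lemma VF_tadd:
  assumes "X \<in> VF U" "Y \<in> VF U"
  shows "(\<lambda>x. tadd (X x) (Y x)) \<in> VF U"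
proof -
  have "msmooth G V (\<lambda>x. tadd (X x) (Y x) f)" if "opn V" "V \<subseteq> U" "msmooth G V f" for V f
    unfolding tadd_def
    by (rule msmooth_add[OF that(1) VF_smooth[OF assms(1) that] VF_smooth[OF assms(2) that]])
  then show ?thesis
    unfolding vector_fields_def mem_Collect_eq
    by (intro conjI ballI allI impI tadd_tangent VF_tangent[OF assms(1)] VF_tangent[OF assms(2)])
qed

lemma VF_tscale:
  assumes "X \<in> VF U" "msmooth G U a"
  shows "(\<lambda>x. tscale (a x) (X x)) \<in> VF U"
proof -
  have "msmooth G V (\<lambda>x. tscale (a x) (X x) f)" if "opn V" "V \<subseteq> U" "msmooth G V f" for V f
    unfolding tscale_def
    by (rule msmooth_mult[OF that(1) msmooth_subset[OF assms(2) that(2)] VF_smooth[OF assms(1) that]])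
  then show ?thesis
    unfolding vector_fields_def mem_Collect_eq
    by (intro conjI ballI allI impI tscale_tangent VF_tangent[OF assms(1)])
qed

lemma near_all:
  assumes "msmooth_near G x f" "opn U" "x \<in> U"
  obtains W where "opn W" "x \<in> W" "W \<subseteq> U" "\<And>y. y \<in> W \<Longrightarrow> msmooth_near G y f"
proof -
  obtain W where W: "opn W" "x \<in> W" "W \<subseteq> U" "msmooth G W f"
    using msmooth_near_common[OF assms(1,1,2,3)] .
  then show thesis using msmooth_nearI[OF W(1) _ W(4)] by (intro that[of W]) auto
qed

lemma VF_VF_add:
  assumes "X \<in> VF U" "Y \<in> VF U" "opn U" "x \<in> U" "msmooth_near G x f" "msmooth_near G x h"
  shows "X x (\<lambda>y. Y y (\<lambda>z. f z + h z)) = X x (\<lambda>y. Y y f) + X x (\<lambda>y. Y y h)"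
proof -
  obtain W where W: "opn W" "x \<in> W" "W \<subseteq> U" "msmooth G W f" "msmooth G W h"
    using msmooth_near_common[OF assms(5,6,3,4)] .
  have "X x (\<lambda>y. Y y (\<lambda>z. f z + h z)) = X x (\<lambda>y. Y y f + Y y h)"
    by (rule tangent_cong[OF VF_tangent[OF assms(1,4)] W(1,2)])
      (use W in \<open>auto intro!: tangent_add VF_tangent[OF assms(2)] msmooth_nearI\<close>)
  also have "\<dots> = X x (\<lambda>y. Y y f) + X x (\<lambda>y. Y y h)"
    by (rule tangent_add[OF VF_tangent[OF assms(1,4)] VF_smooth_near[OF assms(2,3,4,5)]
          VF_smooth_near[OF assms(2,3,4,6)]])
  finally show ?thesis .
qed

lemma VF_VF_mult:
  assumes "X \<in> VF U" "Y \<in> VF U" "opn U" "x \<in> U" "msmooth_near G x f" "msmooth_near G x h"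
  shows "X x (\<lambda>y. Y y (\<lambda>z. f z * h z)) = X x (\<lambda>y. Y y f) * h x + Y x f * X x h
     + X x f * Y x h + f x * X x (\<lambda>y. Y y h)"
proof -
  obtain W where W: "opn W" "x \<in> W" "W \<subseteq> U" "msmooth G W f" "msmooth G W h"
    using msmooth_near_common[OF assms(5,6,3,4)] .
  have X: "X x \<in> T x" using VF_tangent[OF assms(1,4)] .
  have s: "msmooth_near G x (\<lambda>y. Y y f)" "msmooth_near G x (\<lambda>y. Y y h)"
    by (rule VF_smooth_near[OF assms(2,3,4,5)], rule VF_smooth_near[OF assms(2,3,4,6)])
  have "X x (\<lambda>y. Y y (\<lambda>z. f z * h z)) = X x (\<lambda>y. Y y f * h y + f y * Y y h)"
    by (rule tangent_cong[OF X W(1,2)])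
      (use W in \<open>auto intro!: tangent_mult VF_tangent[OF assms(2)] msmooth_nearI\<close>)
  also have "\<dots> = X x (\<lambda>y. Y y f * h y) + X x (\<lambda>y. f y * Y y h)"
    by (rule tangent_add[OF X msmooth_near_mult[OF s(1) assms(6)] msmooth_near_mult[OF assms(5) s(2)]])
  finally show ?thesis
    using tangent_mult[OF X s(1) assms(6)] tangent_mult[OF X assms(5) s(2)] by simp
qed

lemma VF_VF_scale:
  assumes "X \<in> VF U" "Y \<in> VF U" "opn U" "x \<in> U" "msmooth_near G x f"
  shows "X x (\<lambda>y. Y y (\<lambda>z. a * f z)) = a * X x (\<lambda>y. Y y f)"
proof -
  obtain W where W: "opn W" "x \<in> W" "W \<subseteq> U" "msmooth G W f" "msmooth G W f"
    using msmooth_near_common[OF assms(5,5,3,4)] .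
  have "X x (\<lambda>y. Y y (\<lambda>z. a * f z)) = X x (\<lambda>y. a * Y y f)"
    by (rule tangent_cong[OF VF_tangent[OF assms(1,4)] W(1,2)])
      (use W in \<open>auto intro!: tangent_scale VF_tangent[OF assms(2)] msmooth_nearI\<close>)
  then show ?thesis
    using tangent_scale[OF VF_tangent[OF assms(1,4)] VF_smooth_near[OF assms(2,3,4,5)], of a] by simp
qed

text \<open>The second-order terms of \<open>X Y\<close> and \<open>Y X\<close> in \<open>VF_VF_mult\<close> agree up to exchanging \<open>X\<close> and \<open>Y\<close>, so the difference is a
derivation again.\<close>
lemma bracket_VF:
  assumes X: "X \<in> VF U" and Y: "Y \<in> VF U" and U: "opn U"
  shows "bracket G X Y \<in> VF U"
proof -
  have M: "U \<subseteq> M" using openin_subset[OF U] .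
  have T: "bracket G X Y x \<in> T x" if x: "x \<in> U" for x
  proof -
    have "bracket G X Y x (\<lambda>y. f y + h y) = bracket G X Y x f + bracket G X Y x h"
      "bracket G X Y x (\<lambda>y. f y * h y) = bracket G X Y x f * h x + f x * bracket G X Y x h"
      if f: "msmooth_near G x f" and h: "msmooth_near G x h" for f h
      using VF_VF_add[OF X Y U x f h] VF_VF_add[OF Y X U x f h]
        VF_VF_mult[OF X Y U x f h] VF_VF_mult[OF Y X U x f h] f h
        msmooth_near_add[OF f h] msmooth_near_mult[OF f h]
      by (auto simp: bracket_def algebra_simps)
    moreover have "bracket G X Y x (\<lambda>y. a * f y) = a * bracket G X Y x f"
      if f: "msmooth_near G x f" for f a
      using VF_VF_scale[OF X Y U x f, of a] VF_VF_scale[OF Y X U x f, of a] f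
        msmooth_near_mult[OF msmooth_near_const f] M x
      by (auto simp: bracket_def algebra_simps)
    moreover have "bracket G X Y x f = bracket G X Y x h"
      if V: "opn V" "x \<in> V" and e: "\<forall>y\<in>V. f y = h y" for f h V
    proof -
      have n: "msmooth_near G x f \<longleftrightarrow> msmooth_near G x h"
        using msmooth_near_cong[OF V, of f h] msmooth_near_cong[OF V, of h f] e by auto
      have "Z x (\<lambda>y. Z' y f) = Z x (\<lambda>y. Z' y h)" if "Z \<in> VF U" "Z' \<in> VF U" for Z Z'
      proof (rule tangent_cong[of "Z x" x "U \<inter> V"])
        show "Z' y f = Z' y h" if y: "y \<in> U \<inter> V" for y
          using tangent_cong[of "Z' y" y V f h] e y V VF_tangent[OF \<open>Z' \<in> VF U\<close>] by auto
      qed (use that x V U VF_tangent in auto)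
      from this[OF X Y] this[OF Y X] show ?thesis using n by (simp add: bracket_def)
    qed
    moreover have "bracket G X Y x f = 0" if "\<not> msmooth_near G x f" for f
      using that by (simp add: bracket_def)
    ultimately show ?thesis by (intro tangentI) blast+
  qed
  have "msmooth G V (\<lambda>x. bracket G X Y x f)" if V: "opn V" "V \<subseteq> U" "msmooth G V f" for V f
  proof (rule msmooth_cong[OF V(1)])
    show "msmooth G V (\<lambda>x. X x (\<lambda>y. Y y f) + (-1) * Y x (\<lambda>y. X y f))"
      by (rule msmooth_add[OF V(1) VF_smooth[OF X V(1,2) VF_smooth[OF Y V]]
            msmooth_mult[OF V(1) msmooth_const VF_smooth[OF Y V(1,2) VF_smooth[OF X V]]]])
    show "X x (\<lambda>y. Y y f) + (-1) * Y x (\<lambda>y. X y f) = bracket G X Y x f" if "x \<in> V" for x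
      using msmooth_nearI[OF V(1) that V(3)] by (simp add: bracket_def)
  qed
  with T show ?thesis unfolding vector_fields_def mem_Collect_eq by (intro conjI ballI allI impI)
qed

text \<open>In this form the Jacobi identity is a cancellation of third-order terms.\<close>
lemma bracket_bracket:
  assumes X: "X \<in> VF U" and Y: "Y \<in> VF U" and Z: "Z \<in> VF U" and U: "opn U" and x: "x \<in> U"
    and f: "msmooth_near G x f"
  shows "bracket G X (bracket G Y Z) x f = X x (\<lambda>y. Y y (\<lambda>z. Z z f)) - X x (\<lambda>y. Z y (\<lambda>z. Y z f))
     - Y x (\<lambda>y. Z y (\<lambda>z. X z f)) + Z x (\<lambda>y. Y y (\<lambda>z. X z f))"
proof -
  obtain W where W: "opn W" "x \<in> W" "W \<subseteq> U" "\<And>y. y \<in> W \<Longrightarrow> msmooth_near G y f"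
    using near_all[OF f U x] by metis
  have sm: "msmooth_near G x (\<lambda>y. A y (\<lambda>z. B z f))" if "A \<in> VF U" "B \<in> VF U" for A B
    using VF_smooth_near[OF that(1) U x VF_smooth_near[OF that(2) U x f]] .
  have "X x (\<lambda>y. bracket G Y Z y f) = X x (\<lambda>y. Y y (\<lambda>z. Z z f) - Z y (\<lambda>z. Y z f))"
    by (rule tangent_cong[OF VF_tangent[OF X x] W(1,2)]) (use W in \<open>auto simp: bracket_def\<close>)
  also have "\<dots> = X x (\<lambda>y. Y y (\<lambda>z. Z z f)) - X x (\<lambda>y. Z y (\<lambda>z. Y z f))"
    by (rule tangent_diff[OF VF_tangent[OF X x] sm[OF Y Z] sm[OF Z Y]])
  moreover have "bracket G Y Z x (\<lambda>y. X y f) = Y x (\<lambda>y. Z y (\<lambda>z. X z f)) - Z x (\<lambda>y. Y y (\<lambda>z. X z f))"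
    using VF_smooth_near[OF X U x f] by (simp add: bracket_def)
  ultimately show ?thesis
    using f by (simp add: bracket_def)
qed

end


section \<open>First-order jets\<close>

text \<open>The relation \<open>R f a b\<close> stands for ``\<open>f\<close> has value \<open>a\<close> and derivative \<open>b\<close> at the base point''. Only the Leibniz rule is
assumed, since two instances are needed: the derivative at \<open>0\<close> of functions of a real variable, which defines
\<open>\<rho>\<^sub>*\<close>, and the derivative along a tangent vector.\<close>
locale jet_calculus =
  fixes R :: "('x \<Rightarrow> complex) \<Rightarrow> complex \<Rightarrow> complex \<Rightarrow> bool"
  assumes jet_const: "R (\<lambda>x. c) c 0"
    and jet_add: "R f a b \<Longrightarrow> R g a' b' \<Longrightarrow> R (\<lambda>x. f x + g x) (a + a') (b + b')"
    and jet_mult: "R f a b \<Longrightarrow> R g a' b' \<Longrightarrow> R (\<lambda>x. f x * g x) (a * a') (a * b' + b * a')"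
begin

definition pjet :: "('x \<Rightarrow> complex poly) \<Rightarrow> complex poly \<Rightarrow> complex poly \<Rightarrow> bool" where
  "pjet F p q \<longleftrightarrow> (\<forall>k. R (\<lambda>x. coeff (F x) k) (coeff p k) (coeff q k))"

lemma jet_sum:
  assumes "\<And>i. i \<in> I \<Longrightarrow> R (f i) (a i) (b i)"
  shows "R (\<lambda>x. \<Sum>i\<in>I. f i x) (\<Sum>i\<in>I. a i) (\<Sum>i\<in>I. b i)"
  using assms
  by (induction I rule: infinite_finite_induct) (auto intro!: jet_const jet_add)

lemma jet_cmult: "R f a b \<Longrightarrow> R (\<lambda>x. c * f x) (c * a) (c * b)"
  using jet_mult[OF jet_const[of c], of f a b] by simp

lemma pjet_coeff: "pjet F p q \<Longrightarrow> R (\<lambda>x. coeff (F x) k) (coeff p k) (coeff q k)"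
  by (simp add: pjet_def)

lemma pjet_const: "pjet (\<lambda>x. p) p 0"
  by (simp add: pjet_def jet_const)

lemma pjet_add: "pjet F p q \<Longrightarrow> pjet F' p' q' \<Longrightarrow> pjet (\<lambda>x. F x + F' x) (p + p') (q + q')"
  by (simp add: pjet_def jet_add)

lemma pjet_sum:
  assumes "\<And>i. i \<in> I \<Longrightarrow> pjet (F i) (p i) (q i)"
  shows "pjet (\<lambda>x. \<Sum>i\<in>I. F i x) (\<Sum>i\<in>I. p i) (\<Sum>i\<in>I. q i)"
  using assms
  by (induction I rule: infinite_finite_induct) (auto intro!: pjet_const pjet_add)

lemma pjet_mult:
  assumes "pjet F p q" "pjet F' p' q'"
  shows "pjet (\<lambda>x. F x * F' x) (p * p') (p * q' + q * p')"
  unfolding pjet_def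
proof
  fix k
  have "R (\<lambda>x. \<Sum>i\<le>k. coeff (F x) i * coeff (F' x) (k - i)) (\<Sum>i\<le>k. coeff p i * coeff p' (k - i))
     (\<Sum>i\<le>k. coeff p i * coeff q' (k - i) + coeff q i * coeff p' (k - i))"
    by (intro jet_sum jet_mult pjet_coeff assms)
  then show "R (\<lambda>x. coeff (F x * F' x) k) (coeff (p * p') k) (coeff (p * q' + q * p') k)"
    by (simp add: coeff_mult sum.distrib)
qed

lemma pjet_smult:
  assumes "R c a b" "pjet F p q"
  shows "pjet (\<lambda>x. smult (c x) (F x)) (smult a p) (smult a q + smult b p)"
  using jet_mult[OF assms(1) pjet_coeff[OF assms(2)]] by (simp add: pjet_def)

lemma pjet_power:
  assumes "pjet F p q"
  shows "pjet (\<lambda>x. F x ^ n) (p ^ n) (of_nat n * (p ^ (n - 1) * q))"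
proof (induction n)
  case 0
  then show ?case using pjet_const by simp
next
  case (Suc n)
  have "p * (of_nat n * (p ^ (n - 1) * q)) + q * p ^ n = of_nat (Suc n) * (p ^ n * q)"
    by (cases n) (simp_all add: algebra_simps)
  then show ?case using pjet_mult[OF assms Suc.IH] by simp
qed

lemma pjet_pCons:
  assumes "R f a b" "pjet F p q"
  shows "pjet (\<lambda>x. pCons (f x) (F x)) (pCons a p) (pCons b q)"
  unfolding pjet_def
proof
  fix k show "R (\<lambda>x. coeff (pCons (f x) (F x)) k) (coeff (pCons a p) k) (coeff (pCons b q) k)"
    using assms by (cases k) (auto simp: pjet_def)
qed

end


section \<open>Linear operators on polynomials\<close>

definition linop :: "(complex poly \<Rightarrow> complex poly) \<Rightarrow> bool" where
  "linop L \<longleftrightarrow> (\<forall>p q. L (p + q) = L p + L q) \<and> (\<forall>c p. L (smult c p) = smult c (L p))"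

lemma linopI: "(\<And>p q. L (p + q) = L p + L q) \<Longrightarrow> (\<And>c p. L (smult c p) = smult c (L p)) \<Longrightarrow> linop L"
  by (simp add: linop_def)

lemma linop_add: "linop L \<Longrightarrow> L (p + q) = L p + L q"
  and linop_smult: "linop L \<Longrightarrow> L (smult c p) = smult c (L p)"
  by (simp_all add: linop_def)

lemma linop_0: "linop L \<Longrightarrow> L 0 = 0"
  using linop_smult[of L 0 0] by simp

lemma linop_uminus: "linop L \<Longrightarrow> L (- p) = - L p"
  using linop_smult[of L "-1" p] by simp

lemma linop_diff: "linop L \<Longrightarrow> L (p - q) = L p - L q"
  using linop_add[of L p "- q"] linop_uminus[of L q] by simp

lemma linop_sum: "linop L \<Longrightarrow> L (\<Sum>i\<in>I. f i) = (\<Sum>i\<in>I. L (f i))"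
  by (induction I rule: infinite_finite_induct) (simp_all add: linop_0 linop_add)

lemma linop_comp: "linop A \<Longrightarrow> linop B \<Longrightarrow> linop (\<lambda>p. A (B p))"
  by (simp add: linop_def)

lemma Vpoly_neg: "m < 0 \<Longrightarrow> p \<in> Vpoly m \<longleftrightarrow> p = 0"
  by (auto simp: Vpoly_def)

lemma Vpoly_nonneg: "m \<ge> 0 \<Longrightarrow> p \<in> Vpoly m \<longleftrightarrow> degree p \<le> nat m"
  by (auto simp: Vpoly_def)

lemma Vpoly_int: "p \<in> Vpoly (int n) \<longleftrightarrow> degree p \<le> n"
  by (auto simp: Vpoly_def)

lemma Vpoly_0 [simp]: "0 \<in> Vpoly m"
  by (simp add: Vpoly_def)

lemma Vpoly_add: "p \<in> Vpoly m \<Longrightarrow> q \<in> Vpoly m \<Longrightarrow> p + q \<in> Vpoly m"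
  by (cases "m \<ge> 0") (auto simp: Vpoly_nonneg Vpoly_neg degree_add_le)

lemma Vpoly_smult: "p \<in> Vpoly m \<Longrightarrow> smult c p \<in> Vpoly m"
  by (cases "m \<ge> 0") (auto simp: Vpoly_nonneg Vpoly_neg intro: order_trans[OF degree_smult_le])

lemma Vpoly_sum: "(\<And>i. i \<in> I \<Longrightarrow> f i \<in> Vpoly m) \<Longrightarrow> (\<Sum>i\<in>I. f i) \<in> Vpoly m"
  by (induction I rule: infinite_finite_induct) (auto intro: Vpoly_add)

lemma Vpoly_coeff: "p \<in> Vpoly m \<Longrightarrow> nat m < k \<Longrightarrow> coeff p k = 0"
  by (auto simp: Vpoly_def coeff_eq_0)

lemma Vpoly_monom: "k \<le> n \<Longrightarrow> monom c k \<in> Vpoly (int n)"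
  by (simp add: Vpoly_int order_trans[OF degree_monom_le])

lemma Vpoly_monoms: "(\<Sum>k\<le>nat m. monom (c k) k) \<in> Vpoly m" if "m \<ge> 0"
  using that by (intro Vpoly_sum) (metis Vpoly_monom atMost_iff nat_0_le)

lemma Vpoly_expand: "p \<in> Vpoly m \<Longrightarrow> (\<Sum>k\<le>nat m. monom (coeff p k) k) = p"
  by (auto simp: Vpoly_def intro!: poly_as_sum_of_monoms')

lemma Vpoly_expand': "p \<in> Vpoly m \<Longrightarrow> p = (\<Sum>k\<le>nat m. smult (coeff p k) (monom 1 k))"
  using Vpoly_expand[of p m] by (simp add: smult_monom)

lemma linop_ext_monom:
  assumes "linop A" "linop B" "p \<in> Vpoly m"
    and "\<And>k. m \<ge> 0 \<Longrightarrow> k \<le> nat m \<Longrightarrow> A (monom 1 k) = B (monom 1 k)"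
  shows "A p = B p"
proof (cases "m \<ge> 0")
  case True
  show ?thesis
    by (subst (1 2) Vpoly_expand'[OF assms(3)])
      (simp add: linop_sum[OF assms(1)] linop_sum[OF assms(2)] linop_smult[OF assms(1)]
        linop_smult[OF assms(2)] assms(4)[OF True])
next
  case False
  then show ?thesis using assms(1-3) by (simp add: Vpoly_neg linop_0)
qed

text \<open>The linear form \<open>u\<^sub>1 z + u\<^sub>2\<close>. Its powers (coherent states) span \<open>V\<^sub>m\<close>, and \<open>\<rho>\<^sub>m(h)\<close> maps \<open>lin u ^ m\<close> to
\<open>lin (h u) ^ m\<close>. Homomorphism and equivariance properties become one-line identities on them.\<close>
definition lin :: "complex^2 \<Rightarrow> complex poly" where
  "lin u = [:u $ 2, u $ 1:]"

lemma smult_binomial: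
  "(smult a p + smult b q) ^ n =
    (\<Sum>k\<le>n. smult (of_nat (n choose k) * a ^ k * b ^ (n - k)) (q ^ (n - k) * p ^ k))"
  for p q :: "complex poly"
  unfolding binomial_ring
  by (intro sum.cong refl)
    (simp add: smult_power of_nat_poly mult_ac)

lemma lin_power_expand:
  "lin u ^ n = (\<Sum>k\<le>n. smult (of_nat (n choose k) * (u $ 1) ^ k * (u $ 2) ^ (n - k)) (monom 1 k))"
proof -
  have "lin u = smult (u $ 1) [:0, 1:] + smult (u $ 2) 1"
    by (simp add: lin_def one_pCons)
  show ?thesis
    unfolding \<open>lin u = _\<close> smult_binomial by (simp add: monom_altdef)
qed

lemma lin_Vpoly: "lin u ^ n \<in> Vpoly (int n)"
  unfolding lin_power_expand by (intro Vpoly_sum Vpoly_smult Vpoly_monom) auto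

text \<open>The power \<open>(u z + 1)\<^sup>m\<close> is a polynomial in \<open>u\<close> whose coefficient at \<open>u\<^sup>k\<close> is a nonzero multiple of \<open>z\<^sup>k\<close>.
A linear operator that vanishes on these powers for all \<open>u\<close> therefore vanishes on each \<open>z\<^sup>k\<close>.\<close>
lemma linop_ext_lin:
  assumes "linop A" "linop B" "p \<in> Vpoly m"
    and "\<And>u. m \<ge> 0 \<Longrightarrow> A (lin u ^ nat m) = B (lin u ^ nat m)"
  shows "A p = B p"
proof (rule linop_ext_monom[OF assms(1-3)])
  fix k assume m: "m \<ge> 0" and k: "k \<le> nat m"
  define n where "n = nat m"
  define L where "L p = A p - B p" for p
  have L: "linop L"
    using assms(1,2) by (auto simp: L_def linop_def smult_diff_right)
  have "coeff (L (monom 1 k)) j = 0" for j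
  proof -
    \<comment> \<open>One coefficient of \<open>L (lin (z, 1) ^ n)\<close>, as a polynomial in \<open>z\<close>.\<close>
    define P where "P = (\<Sum>k\<le>n. monom (of_nat (n choose k) * coeff (L (monom 1 k)) j) k)"
    have "poly P z = 0" for z
    proof -
      have "L (lin (vector [z, 1]) ^ n) = 0"
        using assms(4)[OF m] by (simp add: L_def n_def)
      then have "coeff (\<Sum>k\<le>n. smult (of_nat (n choose k) * z ^ k) (L (monom 1 k))) j = 0"
        by (simp add: lin_power_expand linop_sum[OF L] linop_smult[OF L])
      then show ?thesis
        by (simp add: P_def poly_sum poly_monom coeff_sum mult_ac)
    qed
    then have "P = 0" using poly_all_0_iff_0 by blast
    moreover have "coeff P k = of_nat (n choose k) * coeff (L (monom 1 k)) j"
      using k unfolding P_def n_def[symmetric] by (simp add: coeff_sum if_distrib cong: if_cong)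
    ultimately show ?thesis using k by (simp add: n_def)
  qed
  then show "A (monom 1 k) = B (monom 1 k)"
    by (simp add: L_def poly_eq_iff)
qed


section \<open>The representations\<close>

lemma linop_rho: "linop (rho m h)"
proof (rule linopI)
  have "smult c (sum f A) = (\<Sum>i\<in>A. smult c (f i))" for c and f :: "nat \<Rightarrow> complex poly" and A
    by (induction A rule: infinite_finite_induct) (simp_all add: smult_add_right)
  then show "rho m h (smult c p) = smult c (rho m h p)" for c p
    by (simp add: rho_def)
qed (simp add: rho_def smult_add_left sum.distrib)

text \<open>In homogeneous terms \<open>\<rho>\<^sub>m(h)\<close> substitutes the linear forms of the two columns of \<open>h\<close>.\<close>
lemma rho_alt: "rho m h p = (\<Sum>k\<le>nat m. smult (coeff p k)
     (lin (h *v axis 2 1) ^ (nat m - k) * lin (h *v axis 1 1) ^ k))"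
proof -
  have "lin (h *v axis 2 1) = [:h $ 2 $ 2, h $ 1 $ 2:]" "lin (h *v axis 1 1) = [:h $ 2 $ 1, h $ 1 $ 1:]"
    by (simp_all add: lin_def matrix_vector_mult_def sum_2 axis_def)
  then show ?thesis by (simp add: rho_def)
qed

lemma rho_monom:
  assumes "k \<le> nat m"
  shows "rho m h (monom 1 k) = lin (h *v axis 2 1) ^ (nat m - k) * lin (h *v axis 1 1) ^ k"
  unfolding rho_alt using assms by (simp add: if_distrib[of "\<lambda>c. smult c _"] cong: if_cong)

lemma lin_mv: "lin (h *v u) = smult (u $ 1) (lin (h *v axis 1 1)) + smult (u $ 2) (lin (h *v axis 2 1))"
  for h :: "complex^2^2"
  by (simp add: lin_def matrix_vector_mult_def sum_2 axis_def mult.commute)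

lemma rho_lin:
  "rho m h (lin u ^ nat m) = lin (h *v u) ^ nat m"
  unfolding lin_power_expand[of u] linop_sum[OF linop_rho] linop_smult[OF linop_rho] lin_mv[of h u] smult_binomial
  by (intro sum.cong refl) (simp add: rho_monom)

lemma rho_Vpoly: "p \<in> Vpoly m \<Longrightarrow> rho m h p \<in> Vpoly m"
proof (cases "m \<ge> 0")
  case True
  have "lin u ^ a * lin v ^ b \<in> Vpoly m" if "a + b = nat m" for u v a b
    using degree_mult_le[of "lin u ^ a" "lin v ^ b"] lin_Vpoly[of u a] lin_Vpoly[of v b] that
    by (simp add: Vpoly_nonneg[OF True] Vpoly_int)
  then show ?thesis
    unfolding rho_alt by (intro Vpoly_sum Vpoly_smult) simp
qed (simp add: Vpoly_neg linop_0[OF linop_rho])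

lemma rho_compose:
  assumes "p \<in> Vpoly m"
  shows "rho m h (rho m k p) = rho m (h ** k) p"
proof (rule linop_ext_lin[OF linop_comp[OF linop_rho linop_rho] linop_rho assms])
  show "rho m h (rho m k (lin u ^ nat m)) = rho m (h ** k) (lin u ^ nat m)" for u
    by (simp only: rho_lin matrix_vector_mul_assoc)
qed

lemma rho_one:
  assumes "p \<in> Vpoly m"
  shows "rho m (mat 1) p = p"
proof (rule linop_ext_lin[OF linop_rho _ assms])
  show "linop (\<lambda>p. p)" by (simp add: linop_def)
  show "rho m (mat 1) (lin u ^ nat m) = lin u ^ nat m" for u
    by (simp only: rho_lin matrix_vector_mul_lid)
qed

text \<open>Substitution of linear forms is multiplicative on homogeneous polynomials, and degrees add.\<close>
lemma rho_times:
  assumes "p \<in> Vpoly m" "q \<in> Vpoly n" "m \<ge> 0" "n \<ge> 0"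
  shows "rho (m + n) h (p * q) = rho m h p * rho n h q"
proof -
  have "rho (m + n) h (monom 1 k * q) = rho m h (monom 1 k) * rho n h q" if k: "k \<le> nat m" for k
  proof (rule linop_ext_monom[of "\<lambda>q. rho (m + n) h (monom 1 k * q)" _ q n])
    fix l assume "l \<le> nat n"
    then show "rho (m + n) h (monom 1 k * monom 1 l) = rho m h (monom 1 k) * rho n h (monom 1 l)"
      using k assms(3,4)
      by (simp add: mult_monom rho_monom nat_add_distrib power_add algebra_simps
          flip: power_add[of _ "nat m - k" "nat n - l"])
  qed (use assms in \<open>auto intro!: linopI simp: linop_add[OF linop_rho] linop_smult[OF linop_rho] algebra_simps\<close>)
  then show ?thesis
    by (intro linop_ext_monom[of "\<lambda>p. rho (m + n) h (p * q)" "\<lambda>p. rho m h p * rho n h q" p m])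
      (use assms in \<open>auto intro!: linopI simp: linop_add[OF linop_rho] linop_smult[OF linop_rho] algebra_simps\<close>)
qed


section \<open>Relations in the Weyl algebra\<close>

text \<open>For \<open>K = su2 X\<close> and \<open>\<mu> = m\<close> the operators \<open>dL\<close>, \<open>dP\<close>, \<open>dN\<close> restrict to \<open>\<rho>\<^sup>0(X)\<close>, \<open>\<rho>\<^sup>+(X)\<close>, \<open>\<rho>\<^sup>-(X)\<close> on \<open>V\<^sub>m\<close>.
The first is the vector field of \<open>K\<close> acting on forms of weight \<open>\<mu>\<close>, the second is multiplication by the quadratic
polynomial of \<open>K\<close>, and the third is the contraction with it. They are defined on all polynomials and for complex
\<open>\<mu>\<close>, so that their relations are identities in the Weyl algebra without conditions on exponents.\<close>
definition dL :: "complex \<Rightarrow> complex^2^2 \<Rightarrow> complex poly \<Rightarrow> complex poly" where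
  "dL \<mu> K p = [:K $ 2 $ 1, K $ 1 $ 1:] * pderiv p
     + [:K $ 2 $ 2, K $ 1 $ 2:] * (smult \<mu> p - [:0, 1:] * pderiv p)"

definition dP :: "complex^2^2 \<Rightarrow> complex poly \<Rightarrow> complex poly" where
  "dP K p = [:K $ 2 $ 1, K $ 1 $ 1 - K $ 2 $ 2, - K $ 1 $ 2:] * p"

definition dN :: "complex \<Rightarrow> complex^2^2 \<Rightarrow> complex poly \<Rightarrow> complex poly" where
  "dN \<mu> K p = smult (K $ 1 $ 1 - K $ 2 $ 2) (smult (\<mu> - 1) (pderiv p) - [:0, 1:] * pderiv (pderiv p))
     - smult (K $ 2 $ 1) (pderiv (pderiv p))
     + smult (K $ 1 $ 2) (smult (\<mu> * (\<mu> - 1)) p - smult (2 * (\<mu> - 1)) ([:0, 1:] * pderiv p)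
        + [:0, 0, 1:] * pderiv (pderiv p))"

lemmas poly_ext = poly_eq_poly_eq_iff[THEN iffD1, OF ext]

lemma linop_dL: "linop (dL \<mu> K)"
  by (intro linopI; rule poly_ext) (simp_all add: dL_def pderiv_add pderiv_smult algebra_simps)

lemma linop_dP: "linop (dP K)"
  by (intro linopI) (simp_all only: dP_def distrib_left mult_smult_right)

lemma linop_dN: "linop (dN \<mu> K)"
  by (intro linopI; rule poly_ext) (simp_all add: dN_def pderiv_add pderiv_smult algebra_simps)

definition tr2 :: "complex^2^2 \<Rightarrow> complex" where
  "tr2 K = K $ 1 $ 1 + K $ 2 $ 2"

lemma mm2: "(A ** B) $ i $ j = A $ i $ 1 * B $ 1 $ j + A $ i $ 2 * B $ 2 $ j"
  for A B :: "complex^2^2"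
  by (simp add: matrix_matrix_mult_def sum_2)

text \<open>All seven are checked by evaluation at a point, where they are polynomial identities in the entries of the
matrices and the derivatives of \<open>p\<close>. The trace \<open>tr2 (K ** L)\<close> is the invariant form, and the commutator plays the
role of the cross product. The last three say that the operators are infinitesimally equivariant.\<close>
lemma weyl_relations:
  assumes "tr2 K = 0" "tr2 L = 0"
  shows "dL \<mu> K (dL \<mu> L p) + dP K (dN \<mu> L p)
      = smult (\<mu>\<^sup>2 * tr2 (K ** L) / 2) p + smult (\<mu> / 2) (dL \<mu> (K ** L - L ** K) p)"
    and "dL \<mu> K (dL \<mu> L p) + dN (\<mu> + 2) K (dP L p)
      = smult ((\<mu> + 2)\<^sup>2 * tr2 (K ** L) / 2) p - smult ((\<mu> + 2) / 2) (dL \<mu> (K ** L - L ** K) p)"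
    and "dL (\<mu> + 2) K (dP L p) - dP K (dL \<mu> L p) = smult ((\<mu> + 2) / 2) (dP (K ** L - L ** K) p)"
    and "dL (\<mu> - 2) K (dN \<mu> L p) - dN \<mu> K (dL \<mu> L p) = smult (- \<mu> / 2) (dN \<mu> (K ** L - L ** K) p)"
    and "dL \<mu> K (dL \<mu> L p) - dL \<mu> L (dL \<mu> K p) = dL \<mu> (K ** L - L ** K) p"
    and "dL (\<mu> + 2) K (dP L p) - dP L (dL \<mu> K p) = dP (K ** L - L ** K) p"
    and "dL (\<mu> - 2) K (dN \<mu> L p) - dN \<mu> L (dL \<mu> K p) = dN \<mu> (K ** L - L ** K) p"
proof -
  have e: "K $ 2 $ 2 = - K $ 1 $ 1" "L $ 2 $ 2 = - L $ 1 $ 1"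
    using assms by (simp_all add: tr2_def add_eq_0_iff)
  note s = dL_def dP_def dN_def mm2 e tr2_def pderiv_add pderiv_diff pderiv_smult pderiv_mult
    pderiv_pCons pderiv_minus power2_eq_square
  show "dL \<mu> K (dL \<mu> L p) + dP K (dN \<mu> L p)
      = smult (\<mu>\<^sup>2 * tr2 (K ** L) / 2) p + smult (\<mu> / 2) (dL \<mu> (K ** L - L ** K) p)"
    by (rule poly_ext) (simp add: s field_simps)
  show "dL \<mu> K (dL \<mu> L p) + dN (\<mu> + 2) K (dP L p)
      = smult ((\<mu> + 2)\<^sup>2 * tr2 (K ** L) / 2) p - smult ((\<mu> + 2) / 2) (dL \<mu> (K ** L - L ** K) p)"
    by (rule poly_ext) (simp add: s field_simps)
  show "dL (\<mu> + 2) K (dP L p) - dP K (dL \<mu> L p) = smult ((\<mu> + 2) / 2) (dP (K ** L - L ** K) p)"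
    by (rule poly_ext) (simp add: s field_simps)
  show "dL (\<mu> - 2) K (dN \<mu> L p) - dN \<mu> K (dL \<mu> L p) = smult (- \<mu> / 2) (dN \<mu> (K ** L - L ** K) p)"
    by (rule poly_ext) (simp add: s field_simps)
  show "dL \<mu> K (dL \<mu> L p) - dL \<mu> L (dL \<mu> K p) = dL \<mu> (K ** L - L ** K) p"
    by (rule poly_ext) (simp add: s field_simps)
  show "dL (\<mu> + 2) K (dP L p) - dP L (dL \<mu> K p) = dP (K ** L - L ** K) p"
    by (rule poly_ext) (simp add: s field_simps)
  show "dL (\<mu> - 2) K (dN \<mu> L p) - dN \<mu> L (dL \<mu> K p) = dN \<mu> (K ** L - L ** K) p"
    by (rule poly_ext) (simp add: s field_simps)
qed


section \<open>The group SU(2) and its Lie algebra\<close>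

lemma sigma_entries:
  "sigma 1 $ 1 $ 1 = \<i>" "sigma 1 $ 1 $ 2 = 0" "sigma 1 $ 2 $ 1 = 0" "sigma 1 $ 2 $ 2 = - \<i>"
  "sigma 2 $ 1 $ 1 = 0" "sigma 2 $ 1 $ 2 = 1" "sigma 2 $ 2 $ 1 = -1" "sigma 2 $ 2 $ 2 = 0"
  "sigma 3 $ 1 $ 1 = 0" "sigma 3 $ 1 $ 2 = \<i>" "sigma 3 $ 2 $ 1 = \<i>" "sigma 3 $ 2 $ 2 = 0"
  by (simp_all add: sigma_def vector_def)

lemma su2_entries:
  "su2 X $ 1 $ 1 = \<i> * of_real (X $ 1)" "su2 X $ 1 $ 2 = of_real (X $ 2) + \<i> * of_real (X $ 3)"
  "su2 X $ 2 $ 1 = - of_real (X $ 2) + \<i> * of_real (X $ 3)" "su2 X $ 2 $ 2 = - \<i> * of_real (X $ 1)"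
  by (simp_all add: su2_def sum_3 sigma_entries scaleR_conv_of_real[where 'a=complex] mult.commute)

lemma su2_add: "su2 (X + Y) = su2 X + su2 Y"
  and su2_scaleR: "su2 (a *\<^sub>R X) = a *\<^sub>R su2 X"
  by (simp_all add: su2_def scaleR_add_left sum.distrib scaleR_sum_right)

lemma mat2_eqI:
  "A $ 1 $ 1 = B $ 1 $ 1 \<Longrightarrow> A $ 1 $ 2 = B $ 1 $ 2 \<Longrightarrow> A $ 2 $ 1 = B $ 2 $ 1 \<Longrightarrow> A $ 2 $ 2 = B $ 2 $ 2 \<Longrightarrow> A = B"
  for A B :: "complex^2^2"
  by (simp add: vec_eq_iff forall_2)

lemma inj_su2: "inj su2"
proof (rule injI)
  fix X Y :: "real^3" assume e: "su2 X = su2 Y"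
  have "su2 X $ 1 $ 1 = su2 Y $ 1 $ 1" "su2 X $ 1 $ 2 = su2 Y $ 1 $ 2" using e by auto
  then show "X = Y" by (simp add: su2_entries complex_eq_iff vec_eq_iff forall_3)
qed

lemma inv_su2 [simp]: "inv su2 (su2 X) = X"
  using inj_su2 by simp

lemma tr2_su2 [simp]: "tr2 (su2 X) = 0"
  by (simp add: tr2_def su2_entries)

lemma su2_range:
  assumes "hermitian_conj A = - A" "tr2 A = 0"
  obtains X where "su2 X = A"
proof
  have "cnj (A $ j $ i) = - A $ i $ j" for i j
    using arg_cong[OF assms(1), of "\<lambda>A. A $ i $ j"] by (simp add: hermitian_conj_def)
  from this[of 1 1] this[of 1 2] have "Re (A $ 1 $ 1) = 0"
    "Re (A $ 2 $ 1) = - Re (A $ 1 $ 2)" "Im (A $ 2 $ 1) = Im (A $ 1 $ 2)"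
    by (auto simp: complex_eq_iff)
  moreover have "A $ 2 $ 2 = - A $ 1 $ 1" using assms(2) by (simp add: tr2_def add_eq_0_iff)
  ultimately show "su2 (vector [Im (A $ 1 $ 1), Re (A $ 1 $ 2), Im (A $ 1 $ 2)]) = A"
    by (intro mat2_eqI) (simp_all add: su2_entries complex_eq_iff)
qed

lemma ad_eq: "ad W X = 2 *\<^sub>R cross3 W X"
proof -
  have "su2 W ** su2 X - su2 X ** su2 W = su2 (2 *\<^sub>R cross3 W X)"
    by (rule mat2_eqI)
      (simp_all add: mm2 su2_entries cross3_def vector_def complex_eq_iff algebra_simps)
  then show ?thesis by (simp add: ad_def)
qed

lemma su2_ad: "su2 (ad W X) = su2 W ** su2 X - su2 X ** su2 W"
  unfolding ad_eq
  by (rule mat2_eqI)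
    (simp_all add: mm2 su2_entries cross3_def vector_def complex_eq_iff algebra_simps)

lemma tr2_su2_su2: "tr2 (su2 X ** su2 Y) = - 2 * of_real (X \<bullet> Y)"
  by (simp add: tr2_def mm2 su2_entries inner_vec_def sum_3 complex_eq_iff algebra_simps)

lemma hermitian_conj_mult: "hermitian_conj (A ** B) = hermitian_conj B ** hermitian_conj A"
  by (rule mat2_eqI) (simp_all add: hermitian_conj_def mm2 mult.commute)

lemma hermitian_conj_idem [simp]: "hermitian_conj (hermitian_conj A) = A"
  by (simp add: hermitian_conj_def vec_eq_iff)

lemma hermitian_conj_su2: "hermitian_conj (su2 X) = - su2 X"
  by (rule mat2_eqI) (simp_all add: hermitian_conj_def su2_entries)

lemma hermitian_conj_one [simp]: "hermitian_conj (mat 1) = mat 1"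
  by (rule mat2_eqI) (simp_all add: hermitian_conj_def mat_def)

lemma SU2_D:
  assumes "h \<in> SU2"
  shows "h ** hermitian_conj h = mat 1" "hermitian_conj h ** h = mat 1" "det h = 1"
proof -
  show "h ** hermitian_conj h = mat 1" "det h = 1" using assms by (auto simp: SU2_def)
  then show "hermitian_conj h ** h = mat 1" using matrix_left_right_inverse by blast
qed

lemma det_hermitian_conj: "det (hermitian_conj h) = cnj (det h)"
  by (simp add: det_2 hermitian_conj_def mult.commute)

lemma SU2_conj: "h \<in> SU2 \<Longrightarrow> hermitian_conj h \<in> SU2"
  unfolding SU2_def[THEN arg_cong[where f="\<lambda>S. hermitian_conj h \<in> S"], unfolded mem_Collect_eq]
  by (simp only: SU2_D det_hermitian_conj hermitian_conj_idem complex_cnj_one simp_thms)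

lemma SU2_one [simp]: "mat 1 \<in> SU2"
  by (simp add: SU2_def)

lemma SU2_mult:
  assumes "h \<in> SU2" "k \<in> SU2"
  shows "h ** k \<in> SU2"
proof -
  have "h ** k ** (hermitian_conj k ** hermitian_conj h) = h ** (k ** hermitian_conj k) ** hermitian_conj h"
    by (simp add: matrix_mul_assoc)
  then show ?thesis
    using SU2_D[OF assms(1)] SU2_D[OF assms(2)] by (simp add: SU2_def hermitian_conj_mult det_mul)
qed

lemma tr2_comm: "tr2 (A ** B) = tr2 (B ** A)"
  by (simp add: tr2_def mm2)

text \<open>The inverse of a matrix of determinant 1 is its adjugate.\<close>
lemma hermitian_conj_SU2:
  assumes "h \<in> SU2"
  shows "hermitian_conj h $ 1 $ 1 = h $ 2 $ 2" "hermitian_conj h $ 1 $ 2 = - h $ 1 $ 2"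
    "hermitian_conj h $ 2 $ 1 = - h $ 2 $ 1" "hermitian_conj h $ 2 $ 2 = h $ 1 $ 1"
proof -
  define B :: "complex^2^2" where "B = vector [vector [h $ 2 $ 2, - h $ 1 $ 2], vector [- h $ 2 $ 1, h $ 1 $ 1]]"
  have "B ** h = mat 1"
    using SU2_D(3)[OF assms]
    by (intro mat2_eqI) (simp_all add: B_def mm2 mat_def det_2 algebra_simps)
  then have "B = B ** (h ** hermitian_conj h)" using SU2_D(1)[OF assms] by simp
  also have "\<dots> = hermitian_conj h" unfolding matrix_mul_assoc \<open>B ** h = mat 1\<close> by simp
  finally have "B = hermitian_conj h" .
  then show "hermitian_conj h $ 1 $ 1 = h $ 2 $ 2" "hermitian_conj h $ 1 $ 2 = - h $ 1 $ 2"
    "hermitian_conj h $ 2 $ 1 = - h $ 2 $ 1" "hermitian_conj h $ 2 $ 2 = h $ 1 $ 1"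
    by (simp_all flip: \<open>B = hermitian_conj h\<close>) (simp_all add: B_def)
qed

lemma mat2_ring:
  fixes A B C :: "complex^2^2"
  shows "A ** (B - C) = A ** B - A ** C" "(A - B) ** C = A ** C - B ** C"
    "A ** (- B) = - (A ** B)" "(- A) ** B = - (A ** B)"
    "A ** (B + C) = A ** B + A ** C" "(A + B) ** C = A ** C + B ** C"
  by (rule mat2_eqI; simp add: mm2 algebra_simps)+

text \<open>Conjugation by \<open>h\<close> preserves trace and skew-Hermitian matrices, so \<open>inv su2\<close> is applied within the range of
\<open>su2\<close>.\<close>
lemma su2_Ad:
  assumes "h \<in> SU2"
  shows "su2 (Ad h X) = h ** su2 X ** hermitian_conj h"
proof -
  have "hermitian_conj (h ** su2 X ** hermitian_conj h) = - (h ** su2 X ** hermitian_conj h)"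
    by (simp add: hermitian_conj_mult hermitian_conj_su2 mat2_ring matrix_mul_assoc)
  moreover have "tr2 (h ** su2 X ** hermitian_conj h) = tr2 (hermitian_conj h ** h ** su2 X)"
    using tr2_comm[of "h ** su2 X" "hermitian_conj h"] by (simp add: matrix_mul_assoc)
  ultimately obtain Y where "su2 Y = h ** su2 X ** hermitian_conj h"
    using su2_range SU2_D(2)[OF assms] by (metis matrix_mul_lid tr2_su2)
  then show ?thesis unfolding Ad_def by (metis inv_su2)
qed

lemma su2_eqI: "su2 X = su2 Y \<Longrightarrow> X = Y"
  using inj_su2 by (simp add: inj_eq)

lemma Ad_conj_Ad: "h \<in> SU2 \<Longrightarrow> Ad (hermitian_conj h) (Ad h X) = X"
proof (rule su2_eqI)
  assume h: "h \<in> SU2"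
  have "hermitian_conj h ** (h ** su2 X ** hermitian_conj h) ** h
      = (hermitian_conj h ** h) ** su2 X ** (hermitian_conj h ** h)"
    by (simp add: matrix_mul_assoc)
  then show "su2 (Ad (hermitian_conj h) (Ad h X)) = su2 X"
    using SU2_D[OF h] by (simp add: su2_Ad h SU2_conj)
qed

lemma Ad_ad:
  assumes "h \<in> SU2"
  shows "Ad h (ad W X) = ad (Ad h W) (Ad h X)"
proof (rule su2_eqI)
  let ?g = "hermitian_conj h"
  have "h ** su2 A ** ?g ** (h ** su2 B ** ?g) = h ** su2 A ** su2 B ** ?g" for A B
  proof -
    have "h ** su2 A ** ?g ** (h ** su2 B ** ?g) = h ** su2 A ** (?g ** h) ** su2 B ** ?g"
      by (simp add: matrix_mul_assoc)
    then show ?thesis using SU2_D(2)[OF assms] by simp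
  qed
  then show "su2 (Ad h (ad W X)) = su2 (ad (Ad h W) (Ad h X))"
    by (simp add: su2_Ad[OF assms] su2_ad mat2_ring matrix_mul_assoc)
qed

lemma Ad_add: "h \<in> SU2 \<Longrightarrow> Ad h (X + Y) = Ad h X + Ad h Y"
  by (rule su2_eqI) (simp add: su2_Ad su2_add mat2_ring)

lemma ad_linear:
  "ad (W + W') X = ad W X + ad W' X" "ad W (X + Y) = ad W X + ad W Y"
  "ad (a *\<^sub>R W) X = a *\<^sub>R ad W X" "ad W (a *\<^sub>R X) = a *\<^sub>R ad W X"
  by (simp_all add: ad_eq cross_add_left cross_add_right cross_mult_left cross_mult_right scaleR_add_right)

text \<open>A vector is determined by its cross products with two independent vectors.\<close>
lemma ad_inj:
  assumes "\<And>X. ad W X = ad W' X"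
  shows "W = W'"
proof -
  have "cross3 W X = cross3 W' X" for X using assms[of X] by (simp add: ad_eq)
  from this[of "axis 1 1"] this[of "axis 2 1"] show ?thesis
    by (simp add: cross3_def vector_def vec_eq_iff forall_3 axis_def)
qed


section \<open>The Clifford homomorphisms as differential operators\<close>

lemma dL_monom: "dL \<mu> K (monom 1 k) = monom (K $ 1 $ 1 * of_nat k) k + monom (K $ 2 $ 1 * of_nat k) (k - 1)
    + monom (K $ 1 $ 2 * (\<mu> - of_nat k)) (k + 1) + monom (K $ 2 $ 2 * (\<mu> - of_nat k)) k"
  by (rule poly_ext, cases k) (simp_all add: dL_def pderiv_monom poly_monom algebra_simps)

lemma dP_monom: "dP K (monom 1 k) = monom (K $ 2 $ 1) k + monom (K $ 1 $ 1 - K $ 2 $ 2) (k + 1)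
    + monom (- K $ 1 $ 2) (k + 2)"
  by (rule poly_ext) (simp add: dP_def poly_monom algebra_simps power2_eq_square)

lemma dN_monom: "dN \<mu> K (monom 1 k) = monom ((K $ 1 $ 1 - K $ 2 $ 2) * of_nat k * (\<mu> - of_nat k)) (k - 1)
    + monom (- (K $ 2 $ 1 * of_nat k * (of_nat k - 1))) (k - 2)
    + monom (K $ 1 $ 2 * (\<mu> - of_nat k) * (\<mu> - of_nat k - 1)) k"
proof -
  consider "k = 0" | "k = 1" | j where "k = Suc (Suc j)" by (metis One_nat_def nat.exhaust)
  then show ?thesis
    by (cases; intro poly_ext)
      (simp_all add: dN_def pderiv_monom poly_monom algebra_simps power2_eq_square)
qed

text \<open>Membership only has to be checked on the monomials of \<open>V\<^sub>m\<close>; each time an exponent would leave the range, the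
coefficient in \<open>dL_monom\<close>, \<open>dP_monom\<close> or \<open>dN_monom\<close> vanishes.\<close>
lemma linop_Vpoly:
  assumes "linop A" "p \<in> Vpoly m" "\<And>k. m \<ge> 0 \<Longrightarrow> k \<le> nat m \<Longrightarrow> A (monom 1 k) \<in> Vpoly m'"
  shows "A p \<in> Vpoly m'"
proof (cases "m \<ge> 0")
  case True
  have "A (\<Sum>k\<le>nat m. smult (coeff p k) (monom 1 k)) \<in> Vpoly m'"
    unfolding linop_sum[OF assms(1)] linop_smult[OF assms(1)]
    by (intro Vpoly_sum Vpoly_smult assms(3) True) simp
  then show ?thesis using Vpoly_expand'[OF assms(2)] by simp
qed (use assms in \<open>simp add: Vpoly_neg linop_0\<close>)

lemma Vpoly_monom_int: "c = 0 \<or> int k \<le> m \<Longrightarrow> monom c k \<in> Vpoly m"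
  by (metis Vpoly_0 Vpoly_monom monom_eq_0_iff nat_0_le nat_le_iff order_trans of_nat_0_le_iff le_nat_iff)

lemma dL_Vpoly: "p \<in> Vpoly m \<Longrightarrow> dL (of_int m) K p \<in> Vpoly m"
proof (rule linop_Vpoly[OF linop_dL])
  fix k assume m: "m \<ge> 0" "k \<le> nat m"
  then show "dL (of_int m) K (monom 1 k) \<in> Vpoly m"
    unfolding dL_monom by (cases "k = nat m") (intro Vpoly_add Vpoly_monom_int; force)+
qed

lemma dP_Vpoly: "p \<in> Vpoly m \<Longrightarrow> dP K p \<in> Vpoly (m + 2)"
proof (rule linop_Vpoly[OF linop_dP])
  fix k assume "m \<ge> 0" "k \<le> nat m"
  then show "dP K (monom 1 k) \<in> Vpoly (m + 2)"
    unfolding dP_monom by (intro Vpoly_add Vpoly_monom_int) auto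
qed

lemma dN_Vpoly: "p \<in> Vpoly m \<Longrightarrow> dN (of_int m) K p \<in> Vpoly (m - 2)"
proof (rule linop_Vpoly[OF linop_dN])
  fix k assume m: "m \<ge> 0" "k \<le> nat m"
  then obtain j where j: "m = int k + int j" by (metis le_nat_iff zle_iff_zadd)
  have 1: "monom ((K $ 1 $ 1 - K $ 2 $ 2) * of_nat k * (of_int m - of_nat k)) (k - 1) \<in> Vpoly (m - 2)"
    by (rule Vpoly_monom_int) (use j in \<open>auto simp: of_nat_diff\<close>)
  have 2: "monom (- (K $ 2 $ 1 * of_nat k * (of_nat k - 1))) (k - 2) \<in> Vpoly (m - 2)"
    by (rule Vpoly_monom_int) (use j in \<open>cases "k = 0 \<or> k = 1"; auto\<close>)
  have 3: "monom (K $ 1 $ 2 * (of_int m - of_nat k) * (of_int m - of_nat k - 1)) k \<in> Vpoly (m - 2)"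
    by (rule Vpoly_monom_int) (use j in \<open>cases "j = 0 \<or> j = 1"; auto\<close>)
  show "dN (of_int m) K (monom 1 k) \<in> Vpoly (m - 2)"
    using Vpoly_add[OF Vpoly_add[OF 1 2] 3] unfolding dN_monom .
qed

lemma linop_cliff_ext: "linop (cliff_ext C A B m X)"
proof (rule linopI)
  have "smult c (sum f I) = (\<Sum>i\<in>I. smult c (f i))" for c and f :: "nat \<Rightarrow> complex poly" and I
    by (induction I rule: infinite_finite_induct) (simp_all add: smult_add_right)
  then show "cliff_ext C A B m X (smult c p) = smult c (cliff_ext C A B m X p)" for c p
    by (simp add: cliff_ext_def)
qed (simp add: cliff_ext_def smult_add_left sum.distrib)

lemma cliff_ext_monom:
  assumes "k \<le> nat m"
  shows "cliff_ext C A B m X (monom 1 k) = smult (of_real (2 * X $ 1)) (C k)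
      + smult (of_real (X $ 2) - \<i> * of_real (X $ 3)) (A k)
      + smult (of_real (X $ 2) + \<i> * of_real (X $ 3)) (B k)"
  unfolding cliff_ext_def using assms by (simp add: if_distrib[of "\<lambda>c. smult c _"] cong: if_cong)

lemma cliff_zero_eq:
  assumes "p \<in> Vpoly m"
  shows "cliff_zero m X p = dL (of_int m) (su2 X) p"
  unfolding cliff_zero_def
  by (rule linop_ext_monom[OF linop_cliff_ext linop_dL assms])
    (simp add: cliff_ext_monom dL_monom su2_entries poly_eq_iff smult_monom field_simps)

lemma cliff_plus_eq:
  assumes "p \<in> Vpoly m"
  shows "cliff_plus m X p = dP (su2 X) p"
  unfolding cliff_plus_def
  by (rule linop_ext_monom[OF linop_cliff_ext linop_dP assms])
    (simp add: cliff_ext_monom dP_monom su2_entries poly_eq_iff smult_monom field_simps)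

lemma cliff_minus_eq:
  assumes "p \<in> Vpoly m"
  shows "cliff_minus m X p = dN (of_int m) (su2 X) p"
  unfolding cliff_minus_def
  by (rule linop_ext_monom[OF linop_cliff_ext linop_dN assms])
    (simp add: cliff_ext_monom dN_monom su2_entries poly_eq_iff smult_monom field_simps)

subsection \<open>Equivariance\<close>

lemma pderiv_lin_power: "pderiv (lin u ^ n) = smult (of_nat n * u $ 1) (lin u ^ (n - 1))"
proof (cases n)
  case (Suc k)
  have "pderiv (lin u) = [:u $ 1:]" by (simp add: lin_def pderiv_pCons)
  then show ?thesis unfolding Suc pderiv_power_Suc by (simp add: mult.commute del: of_nat_Suc)
qed simp

lemma poly_lin: "poly (lin u) x = u $ 1 * x + u $ 2"
  by (simp add: lin_def mult.commute)

lemma dL_lin: "dL (of_nat n) K (lin u ^ n) = smult (of_nat n) (lin u ^ (n - 1) * lin (K *v u))"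
  unfolding dL_def pderiv_lin_power
  by (rule poly_ext, cases n)
    (simp_all add: poly_lin matrix_vector_mult_def sum_2 algebra_simps del: of_nat_Suc)

text \<open>The area form, which is invariant under matrices of determinant 1. It expresses the quadratic form of \<open>K\<close> that
occurs when \<open>dN\<close> is applied to a coherent state.\<close>
definition wedge :: "complex^2 \<Rightarrow> complex^2 \<Rightarrow> complex" where
  "wedge u w = u $ 1 * w $ 2 - u $ 2 * w $ 1"

lemma wedge_mv: "wedge (h *v u) (h *v w) = det h * wedge u w"
  by (simp add: wedge_def matrix_vector_mult_def sum_2 det_2 algebra_simps)

lemma dN_lin: "dN (of_nat n) K (lin u ^ n)
    = smult (of_nat n * of_nat (n - 1) * wedge (K *v u) u) (lin u ^ (n - 2))"
proof -
  consider "n = 0" | "n = 1" | j where "n = Suc (Suc j)" by (metis One_nat_def nat.exhaust)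
  then show ?thesis
    unfolding dN_def pderiv_lin_power pderiv_smult
    by (cases; intro poly_ext)
      (simp_all add: poly_lin wedge_def matrix_vector_mult_def sum_2 algebra_simps power2_eq_square)
qed

text \<open>On coherent states both sides are multiples of \<open>lin (h u) ^ (m - 1) * lin (h (K u))\<close>.\<close>
lemma rho_dL:
  assumes h: "h \<in> SU2" and p: "p \<in> Vpoly m"
  shows "rho m h (dL (of_int m) K p) = dL (of_int m) (h ** K ** hermitian_conj h) (rho m h p)"
proof (rule linop_ext_lin[OF linop_comp[OF linop_rho linop_dL] linop_comp[OF linop_dL linop_rho] p])
  fix u assume m: "m \<ge> 0"
  define n where "n = nat m"
  have n: "m = int n" "nat m = n" using m by (simp_all add: n_def)
  have rl: "rho m h (lin u ^ n) = lin (h *v u) ^ n" using rho_lin[of m h u] n(2) by simp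
  have hu: "(h ** K ** hermitian_conj h) *v (h *v u) = h *v (K *v u)"
    using SU2_D(2)[OF h] by (simp add: matrix_vector_mul_assoc flip: matrix_mul_assoc)
  show "rho m h (dL (of_int m) K (lin u ^ nat m))
     = dL (of_int m) (h ** K ** hermitian_conj h) (rho m h (lin u ^ nat m))"
  proof (cases n)
    case 0
    then show ?thesis using dL_lin[of 0] rho_lin[of 0 h u] by (simp add: n linop_0[OF linop_rho])
  next
    case (Suc k)
    have "rho (int k + 1) h (lin u ^ k * lin (K *v u)) = lin (h *v u) ^ k * lin (h *v (K *v u))"
      using rho_times[of "lin u ^ k" "int k" "lin (K *v u)" 1 h] lin_Vpoly[of u k] lin_Vpoly[of "K *v u" 1]
        rho_lin[of "int k" h u] rho_lin[of 1 h "K *v u"] by simp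
    moreover have "m = int k + 1" using Suc n by simp
    moreover have "of_int m = (of_nat n :: complex)" using n by simp
    ultimately show ?thesis
      unfolding n(2) rl by (simp only: dL_lin hu linop_smult[OF linop_rho] Suc diff_Suc_1)
  qed
qed

text \<open>Multiplicativity of \<open>\<rho>\<close> reduces this to the equivariance of the quadratic polynomial of \<open>K\<close>.\<close>
lemma rho_dP:
  assumes h: "h \<in> SU2" and p: "p \<in> Vpoly m"
  shows "rho (m + 2) h (dP K p) = dP (h ** K ** hermitian_conj h) (rho m h p)"
proof (cases "m \<ge> 0")
  case True
  let ?q = "\<lambda>K::complex^2^2. [:K $ 2 $ 1, K $ 1 $ 1 - K $ 2 $ 2, - K $ 1 $ 2:]"
  have "rho (m + 2) h (?q K * p) = rho m h p * rho 2 h (?q K)"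
    using rho_times[OF p, of "?q K" 2 h] True by (simp add: Vpoly_def mult.commute)
  moreover have "rho 2 h (?q K) = ?q (h ** K ** hermitian_conj h)"
    by (simp add: rho_def eval_nat_numeral mm2 hermitian_conj_SU2[OF h] algebra_simps)
  ultimately show ?thesis by (simp only: dP_def mult.commute)
qed (use p in \<open>simp add: Vpoly_neg linop_0[OF linop_dP] linop_0[OF linop_rho]\<close>)

lemma rho_dN:
  assumes h: "h \<in> SU2" and p: "p \<in> Vpoly m"
  shows "rho (m - 2) h (dN (of_int m) K p) = dN (of_int m) (h ** K ** hermitian_conj h) (rho m h p)"
proof (rule linop_ext_lin[OF linop_comp[OF linop_rho linop_dN] linop_comp[OF linop_dN linop_rho] p])
  fix u assume m: "m \<ge> 0"
  define n where "n = nat m"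
  have n: "m = int n" "nat m = n" using m by (simp_all add: n_def)
  have rl: "rho m h (lin u ^ n) = lin (h *v u) ^ n" using rho_lin[of m h u] n(2) by simp
  have hu: "(h ** K ** hermitian_conj h) *v (h *v u) = h *v (K *v u)"
    using SU2_D(2)[OF h] by (simp add: matrix_vector_mul_assoc flip: matrix_mul_assoc)
  have w: "wedge ((h ** K ** hermitian_conj h) *v (h *v u)) (h *v u) = wedge (K *v u) u"
    unfolding hu wedge_mv using SU2_D(3)[OF h] by simp
  show "rho (m - 2) h (dN (of_int m) K (lin u ^ nat m))
     = dN (of_int m) (h ** K ** hermitian_conj h) (rho m h (lin u ^ nat m))"
  proof -
    have 1: "of_int m = (of_nat n :: complex)" using n by simp
    have 2: "rho (m - 2) h (lin u ^ (n - 2)) = lin (h *v u) ^ (n - 2)" if "n \<ge> 2"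
      using rho_lin[of "m - 2" h u] that n by (simp add: nat_diff_distrib)
    have 3: "of_nat n * of_nat (n - 1) = (0 :: complex)" if "\<not> n \<ge> 2"
      using that by (cases "n = 0") auto
    show ?thesis
      unfolding n(2) rl 1 dN_lin w linop_smult[OF linop_rho]
      using 2 3 by (cases "n \<ge> 2") simp_all
  qed
qed

subsection \<open>The derivative of the representation\<close>

context jet_calculus begin

lemma pjet_lin:
  assumes "\<And>i. R (\<lambda>x. u x $ i) (u0 $ i) (u1 $ i)"
  shows "pjet (\<lambda>x. lin (u x)) (lin u0) (lin u1)"
  unfolding lin_def using pjet_pCons[OF assms pjet_pCons[OF assms pjet_const[of 0]]] by simp

text \<open>If \<open>h\<close> has the logarithmic derivative \<open>K\<close>, that is \<open>h' = h K\<close>, then the derivative of \<open>\<rho>\<^sub>m(h) F\<close> is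
\<open>\<rho>\<^sub>m(h) (F' + dL K F)\<close>. With \<open>h = 1 + t W\<close> this computes \<open>\<rho>\<^sub>*\<close>; with a transition function it is the
inhomogeneous term of a change of gauge.\<close>
lemma rho_jet:
  assumes h: "\<And>i j. R (\<lambda>x. h x $ i $ j) (h0 $ i $ j) ((h0 ** K) $ i $ j)"
    and F: "pjet F p q" and p: "p \<in> Vpoly m" and m: "m \<ge> 0"
  shows "pjet (\<lambda>x. rho m (h x) (F x)) (rho m h0 p) (rho m h0 (q + dL (of_int m) K p))"
proof -
  define n where "n = nat m"
  have mn: "m = int n" "nat m = n" using m by (simp_all add: n_def)
  let ?e1 = "axis 1 1 :: complex^2" and ?e2 = "axis 2 1 :: complex^2"
  have col: "pjet (\<lambda>x. lin (h x *v u)) (lin (h0 *v u)) (lin (h0 *v (K *v u)))"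
    if "u = ?e1 \<or> u = ?e2" for u
  proof (rule pjet_lin)
    fix i
    show "R (\<lambda>x. (h x *v u) $ i) ((h0 *v u) $ i) ((h0 *v (K *v u)) $ i)"
      using that h[of i 1] h[of i 2] unfolding mm2
      by (auto simp: matrix_vector_mul_assoc matrix_vector_mult_def sum_2 axis_def)
  qed
  define X Y where "X = lin (h0 *v ?e1)" and "Y = lin (h0 *v ?e2)"
  define X' Y' where "X' = lin (h0 *v (K *v ?e1))" and "Y' = lin (h0 *v (K *v ?e2))"
  have X': "X' = smult (K $ 1 $ 1) X + smult (K $ 2 $ 1) Y"
    and Y': "Y' = smult (K $ 1 $ 2) X + smult (K $ 2 $ 2) Y"
    unfolding X'_def Y'_def X_def Y_def by (subst lin_mv; simp add: matrix_vector_mult_def sum_2 axis_def)+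
  \<comment> \<open>The derivative of the image of the monomial of degree \<open>k\<close>, by the product rule.\<close>
  define D where "D k = Y ^ (n - k) * (of_nat k * (X ^ (k - 1) * X'))
      + (of_nat (n - k) * (Y ^ (n - k - 1) * Y')) * X ^ k" for k
  have mon: "pjet (\<lambda>x. lin (h x *v ?e2) ^ (n - k) * lin (h x *v ?e1) ^ k) (Y ^ (n - k) * X ^ k) (D k)" for k
    unfolding D_def X_def Y_def X'_def Y'_def by (intro pjet_mult pjet_power col) auto
  have D: "rho m h0 (dL (of_int m) K (monom 1 k)) = D k" if k: "k \<le> n" for k
  proof -
    have rc: "rho m h0 (monom c j) = smult c (Y ^ (n - j) * X ^ j)" if "j \<le> n \<or> c = 0" for c j
      using that rho_monom[of j m h0] linop_smult[OF linop_rho, of m h0 c "monom 1 j"] linop_0[OF linop_rho]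
      by (auto simp: mn(2) X_def Y_def smult_monom)
    have "rho m h0 (dL (of_int m) K (monom 1 k)) =
        smult (K $ 1 $ 1 * of_nat k) (Y ^ (n - k) * X ^ k)
      + smult (K $ 2 $ 1 * of_nat k) (Y ^ (n - (k - 1)) * X ^ (k - 1))
      + smult (K $ 1 $ 2 * (of_nat n - of_nat k)) (Y ^ (n - (k + 1)) * X ^ (k + 1))
      + smult (K $ 2 $ 2 * (of_nat n - of_nat k)) (Y ^ (n - k) * X ^ k)"
      unfolding dL_monom linop_add[OF linop_rho]
      by (subst (1 2 3 4) rc) (use k in \<open>auto simp: mn(1) le_Suc_eq\<close>)
    moreover consider "k = 0" "n = 0" | j where "k = 0" "n = Suc j" | i where "k = Suc i" "n = Suc i"
      | i j where "k = Suc i" "n = Suc (Suc (i + j))"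
      using k by (metis Suc_le_D add_Suc_right le_Suc_ex nat.exhaust add.commute add_0)
    then have "smult (K $ 1 $ 1 * of_nat k) (Y ^ (n - k) * X ^ k)
      + smult (K $ 2 $ 1 * of_nat k) (Y ^ (n - (k - 1)) * X ^ (k - 1))
      + smult (K $ 1 $ 2 * (of_nat n - of_nat k)) (Y ^ (n - (k + 1)) * X ^ (k + 1))
      + smult (K $ 2 $ 2 * (of_nat n - of_nat k)) (Y ^ (n - k) * X ^ k) = D k"
      unfolding D_def X' Y'
      by (cases; intro poly_ext) (simp_all add: algebra_simps Suc_diff_le)
    ultimately show ?thesis by simp
  qed
  have "pjet (\<lambda>x. rho m (h x) (F x)) (\<Sum>k\<le>n. smult (coeff p k) (Y ^ (n - k) * X ^ k))
      (\<Sum>k\<le>n. smult (coeff p k) (D k) + smult (coeff q k) (Y ^ (n - k) * X ^ k))"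
    unfolding rho_alt mn(2) by (intro pjet_sum pjet_smult mon pjet_coeff[OF F])
  moreover have "(\<Sum>k\<le>n. smult (coeff p k) (Y ^ (n - k) * X ^ k)) = rho m h0 p"
    by (simp add: rho_alt mn(2) X_def Y_def)
  moreover have "(\<Sum>k\<le>n. smult (coeff q k) (Y ^ (n - k) * X ^ k)) = rho m h0 q"
    by (simp add: rho_alt mn(2) X_def Y_def)
  moreover have "(\<Sum>k\<le>n. smult (coeff p k) (D k)) = rho m h0 (dL (of_int m) K p)"
    by (subst (2) Vpoly_expand'[OF p])
      (simp add: linop_sum[OF linop_rho] linop_smult[OF linop_rho] linop_sum[OF linop_dL]
        linop_smult[OF linop_dL] D mn(2))
  ultimately show ?thesis
    by (simp add: sum.distrib linop_add[OF linop_rho] add.commute)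
qed

end

lemma jet_calculus_line:
  "jet_calculus (\<lambda>f a b. f (0::real) = a \<and> (f has_vector_derivative b) (at 0))"
proof
  fix f g :: "real \<Rightarrow> complex" and a b a' b'
  assume "f 0 = a \<and> (f has_vector_derivative b) (at 0)" "g 0 = a' \<and> (g has_vector_derivative b') (at 0)"
  then show "f 0 + g 0 = a + a' \<and> ((\<lambda>x. f x + g x) has_vector_derivative b + b') (at 0)"
    and "f 0 * g 0 = a * a' \<and> ((\<lambda>x. f x * g x) has_vector_derivative a * b' + b * a') (at 0)"
    by (auto intro: has_vector_derivative_add has_vector_derivative_mult)
qed simp

text \<open>The line \<open>1 + t W\<close> has logarithmic derivative \<open>W\<close> at \<open>t = 0\<close>.\<close>
lemma drho_eq:
  assumes p: "p \<in> Vpoly m"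
  shows "drho m W p = dL (of_int m) (su2 W) p"
proof (cases "m \<ge> 0")
  case True
  interpret jet_calculus "\<lambda>f a b. f (0::real) = a \<and> (f has_vector_derivative b) (at 0)"
    by (rule jet_calculus_line)
  have "pjet (\<lambda>t. rho m (mat 1 + t *\<^sub>R su2 W) p) (rho m (mat 1) p)
      (rho m (mat 1) (0 + dL (of_int m) (su2 W) p))"
  proof (rule rho_jet[OF _ pjet_const p True])
    fix i j
    have "((\<lambda>t::real. (mat 1 + t *\<^sub>R su2 W :: complex^2^2) $ i $ j) has_vector_derivative su2 W $ i $ j) (at 0)"
      by (auto intro!: derivative_eq_intros)
    then show "(mat 1 + 0 *\<^sub>R su2 W :: complex^2^2) $ i $ j = mat 1 $ i $ j \<and>
      ((\<lambda>t::real. (mat 1 + t *\<^sub>R su2 W :: complex^2^2) $ i $ j)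
        has_vector_derivative (mat 1 ** su2 W) $ i $ j) (at 0)"
      by simp
  qed
  then have "vector_derivative (\<lambda>t::real. coeff (rho m (mat 1 + t *\<^sub>R su2 W) p) k) (at 0)
      = coeff (dL (of_int m) (su2 W) p) k" for k
    using p by (auto simp: pjet_def rho_one dL_Vpoly intro: vector_derivative_at)
  then show ?thesis
    using Vpoly_expand[OF dL_Vpoly[OF p]] by (simp add: drho_def)
qed (use p in \<open>simp add: Vpoly_neg drho_def linop_0[OF linop_dL] linop_0[OF linop_rho]\<close>)


section \<open>Jets along a tangent vector\<close>

definition cderiv :: "'a tvec \<Rightarrow> ('a \<Rightarrow> complex) \<Rightarrow> complex" where
  "cderiv v f = Complex (v (\<lambda>y. Re (f y))) (v (\<lambda>y. Im (f y)))"

context smooth3 begin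

definition tjet :: "'a \<Rightarrow> 'a tvec \<Rightarrow> ('a \<Rightarrow> complex) \<Rightarrow> complex \<Rightarrow> complex \<Rightarrow> bool" where
  "tjet x v f a b \<longleftrightarrow> msmooth_near G x f \<and> f x = a \<and> cderiv v f = b"

lemma jet_calculus_tangent:
  assumes v: "v \<in> T x" and x: "x \<in> M"
  shows "jet_calculus (tjet x v)"
proof
  show "tjet x v (\<lambda>y. c) c 0" for c
    using msmooth_near_const[OF x, of c] tangent_const[OF v x]
    by (simp add: tjet_def cderiv_def complex_eq_iff)
next
  fix f g a b a' b'
  assume f: "tjet x v f a b" and g: "tjet x v g a' b'"
  then have n: "msmooth_near G x f" "msmooth_near G x g" by (auto simp: tjet_def)
  note r = msmooth_near_Re_Im[OF n(1)] msmooth_near_Re_Im[OF n(2)]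
  show "tjet x v (\<lambda>x. f x + g x) (a + a') (b + b')"
    using f g msmooth_near_add[OF n] tangent_add[OF v r(1,3)] tangent_add[OF v r(2,4)]
    by (auto simp: tjet_def cderiv_def complex_eq_iff)
  have "v (\<lambda>y. Re (f y) * Re (g y) - Im (f y) * Im (g y))
      = (v (\<lambda>y. Re (f y)) * Re (g x) + Re (f x) * v (\<lambda>y. Re (g y)))
      - (v (\<lambda>y. Im (f y)) * Im (g x) + Im (f x) * v (\<lambda>y. Im (g y)))"
    using tangent_diff[OF v msmooth_near_mult[OF r(1,3)] msmooth_near_mult[OF r(2,4)]]
      tangent_mult[OF v r(1,3)] tangent_mult[OF v r(2,4)] by simp
  moreover have "v (\<lambda>y. Re (f y) * Im (g y) + Im (f y) * Re (g y))
      = (v (\<lambda>y. Re (f y)) * Im (g x) + Re (f x) * v (\<lambda>y. Im (g y)))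
      + (v (\<lambda>y. Im (f y)) * Re (g x) + Im (f x) * v (\<lambda>y. Re (g y)))"
    using tangent_add[OF v msmooth_near_mult[OF r(1,4)] msmooth_near_mult[OF r(2,3)]]
      tangent_mult[OF v r(1,4)] tangent_mult[OF v r(2,3)] by simp
  ultimately show "tjet x v (\<lambda>x. f x * g x) (a * a') (a * b' + b * a')"
    using f g msmooth_near_mult[OF n] by (auto simp: tjet_def cderiv_def complex_eq_iff)
qed

lemma tjet_cnj:
  assumes v: "v \<in> T x" and f: "tjet x v f a b"
  shows "tjet x v (\<lambda>y. cnj (f y)) (cnj a) (cnj b)"
proof -
  have n: "msmooth_near G x f" using f by (simp add: tjet_def)
  then have "msmooth_near G x (\<lambda>y. cnj (f y))"
    using msmooth_linear[OF _ bounded_linear_cnj] unfolding msmooth_near_def by blast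
  then show ?thesis
    using f tangent_uminus[OF v msmooth_near_Re_Im(2)[OF n]]
    by (auto simp: tjet_def cderiv_def complex_eq_iff)
qed

lemma tjet_cong:
  assumes v: "v \<in> T x" and U: "opn U" "x \<in> U" and e: "\<And>y. y \<in> U \<Longrightarrow> f y = g y" and f: "tjet x v f a b"
  shows "tjet x v g a b"
  using f e[OF U(2)] msmooth_near_cong[OF U e] tangent_cong[OF v U, of "\<lambda>y. Re (f y)" "\<lambda>y. Re (g y)"]
    tangent_cong[OF v U, of "\<lambda>y. Im (f y)" "\<lambda>y. Im (g y)"] e
  by (simp add: tjet_def cderiv_def)

lemma tjet_of_real:
  assumes v: "v \<in> T x" "x \<in> M" and f: "msmooth_near G x f"
  shows "tjet x v (\<lambda>y. of_real (f y)) (of_real (f x)) (of_real (v f))"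
proof -
  have "msmooth_near G x (\<lambda>y. complex_of_real (f y))"
    using f msmooth_linear[OF _ bounded_linear_of_real] unfolding msmooth_near_def by blast
  then show ?thesis
    using tangent_const[OF v] by (simp add: tjet_def cderiv_def complex_eq_iff)
qed

abbreviation "tpjet x v \<equiv> jet_calculus.pjet (tjet x v)"

lemma pjet_unique:
  assumes "v \<in> T x" "x \<in> M" "tpjet x v F p q" "tpjet x v F p' q'"
  shows "q = q'" "p = p'"
proof -
  interpret jet_calculus "tjet x v" by (rule jet_calculus_tangent[OF assms(1,2)])
  show "q = q'" "p = p'" using assms(3,4) by (auto simp: pjet_def tjet_def intro!: poly_eqI)
qed

lemma pjet_cong:
  assumes v: "v \<in> T x" "x \<in> M" and U: "opn U" "x \<in> U" and e: "\<And>y. y \<in> U \<Longrightarrow> F y = F' y" and F: "tpjet x v F p q"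
  shows "tpjet x v F' p q"
proof -
  interpret jet_calculus "tjet x v" by (rule jet_calculus_tangent[OF v])
  show ?thesis
    using F tjet_cong[OF v(1) U, of "\<lambda>y. coeff (F y) _" "\<lambda>y. coeff (F' y) _"] e
    unfolding pjet_def by metis
qed

text \<open>The definition of \<open>tderiv\<close> stops at the exponent \<open>m\<close>. The coefficients beyond vanish near \<open>x\<close>, so their derivatives are
zero as well.\<close>
lemma pjet_tderiv:
  assumes v: "v \<in> T x" and U: "opn U" "x \<in> U" and F: "\<And>y. y \<in> U \<Longrightarrow> F y \<in> Vpoly m"
    and s: "\<And>k. msmooth G U (\<lambda>y. coeff (F y) k)"
  shows "tpjet x v F (F x) (tderiv m v F)"
proof -
  have x: "x \<in> M" using openin_subset[OF U(1)] U(2) by blast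
  interpret jet_calculus "tjet x v" by (rule jet_calculus_tangent[OF v x])
  have "coeff (tderiv m v F) k = cderiv v (\<lambda>y. coeff (F y) k)" for k
  proof (cases "k \<le> nat m")
    case True
    then show ?thesis by (simp add: tderiv_def cderiv_def coeff_sum)
  next
    case False
    then have "coeff (F y) k = 0" if "y \<in> U" for y using Vpoly_coeff[OF F[OF that], of k] by simp
    then have "tjet x v (\<lambda>y. coeff (F y) k) 0 0"
      by (intro tjet_cong[OF v U _ jet_const[of 0]]) simp
    then show ?thesis using False by (simp add: tderiv_def coeff_sum tjet_def)
  qed
  then show ?thesis
    using msmooth_nearI[OF U s] by (simp add: pjet_def tjet_def)
qed

lemma tderiv_Vpoly:
  assumes v: "v \<in> T x" and U: "opn U" "x \<in> U" and F: "\<And>y. y \<in> U \<Longrightarrow> F y \<in> Vpoly m"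
  shows "tderiv m v F \<in> Vpoly m"
proof (cases "m \<ge> 0")
  case False
  have x: "x \<in> M" using openin_subset[OF U(1)] U(2) by blast
  have "F y = 0" if "y \<in> U" for y using F[OF that] False by (simp add: Vpoly_neg)
  then have "v (\<lambda>y. Re (coeff (F y) k)) = 0" "v (\<lambda>y. Im (coeff (F y) k)) = 0" for k
    using tangent_cong[OF v U, of "\<lambda>y. Re (coeff (F y) k)" "\<lambda>y. 0"]
      tangent_cong[OF v U, of "\<lambda>y. Im (coeff (F y) k)" "\<lambda>y. 0"] tangent_const[OF v x] by auto
  then show ?thesis by (simp add: tderiv_def flip: zero_complex.code)
qed (auto simp: tderiv_def intro: Vpoly_monoms)

end


section \<open>Clifford maps and the fibres of the spinor bundles\<close>

text \<open>What the geometric part uses of the three Clifford homomorphisms: they are bilinear maps from \<open>V\<^sub>m\<close> to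
\<open>V\<^bsub>m'\<^esub>\<close>, equivariant under the group (so that they act on the bundles) and under the Lie algebra (so that they
are parallel).\<close>
definition clifford :: "int \<Rightarrow> int \<Rightarrow> (real^3 \<Rightarrow> complex poly \<Rightarrow> complex poly) \<Rightarrow> bool" where
  "clifford m m' \<rho> \<longleftrightarrow> (\<forall>Y. linop (\<rho> Y)) \<and> (\<forall>v\<in>Vpoly m. \<forall>Y.
     \<rho> Y v \<in> Vpoly m' \<and>
     (\<forall>Z. \<rho> (Y + Z) v = \<rho> Y v + \<rho> Z v) \<and> (\<forall>a. \<rho> (a *\<^sub>R Y) v = smult (of_real a) (\<rho> Y v)) \<and>
     (\<forall>h\<in>SU2. rho m' h (\<rho> Y v) = \<rho> (Ad h Y) (rho m h v)) \<and>
     (\<forall>W. dL (of_int m') (su2 W) (\<rho> Y v) = \<rho> (ad W Y) v + \<rho> Y (dL (of_int m) (su2 W) v)))"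

lemma op_matrix_linear:
  "dL \<mu> (K + L) p = dL \<mu> K p + dL \<mu> L p" "dL \<mu> (a *\<^sub>R K) p = smult (of_real a) (dL \<mu> K p)"
  "dP (K + L) p = dP K p + dP L p" "dP (a *\<^sub>R K) p = smult (of_real a) (dP K p)"
  "dN \<mu> (K + L) p = dN \<mu> K p + dN \<mu> L p" "dN \<mu> (a *\<^sub>R K) p = smult (of_real a) (dN \<mu> K p)"
  by (rule poly_ext; simp add: dL_def dP_def dN_def scaleR_conv_of_real[where 'a=complex] algebra_simps)+

lemma clifford_zero: "clifford m m (cliff_zero m)"
  unfolding clifford_def
proof (intro conjI ballI allI)
  show "linop (cliff_zero m Y)" for Y unfolding cliff_zero_def by (rule linop_cliff_ext)
qed (simp_all add: cliff_zero_eq dL_Vpoly rho_Vpoly su2_add su2_scaleR op_matrix_linear rho_dL su2_Ad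
    su2_ad weyl_relations(5)[symmetric])

lemma clifford_plus: "clifford m (m + 2) (cliff_plus m)"
  unfolding clifford_def
proof (intro conjI ballI allI)
  show "linop (cliff_plus m Y)" for Y unfolding cliff_plus_def by (rule linop_cliff_ext)
qed (simp_all add: cliff_plus_eq dL_Vpoly dP_Vpoly rho_Vpoly su2_add su2_scaleR op_matrix_linear rho_dP su2_Ad
    su2_ad weyl_relations(6)[of _ _ "of_int m", symmetric])

lemma clifford_minus: "clifford m (m - 2) (cliff_minus m)"
  unfolding clifford_def
proof (intro conjI ballI allI)
  show "linop (cliff_minus m Y)" for Y unfolding cliff_minus_def by (rule linop_cliff_ext)
qed (simp_all add: cliff_minus_eq dL_Vpoly dN_Vpoly rho_Vpoly su2_add su2_scaleR op_matrix_linear rho_dN su2_Ad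
    su2_ad weyl_relations(7)[of _ _ "of_int m", symmetric])

lemma cliffordD:
  assumes "clifford m m' \<rho>"
  shows "linop (\<rho> Y)" "v \<in> Vpoly m \<Longrightarrow> \<rho> Y v \<in> Vpoly m'"
    "v \<in> Vpoly m \<Longrightarrow> \<rho> (Y + Z) v = \<rho> Y v + \<rho> Z v"
    "v \<in> Vpoly m \<Longrightarrow> \<rho> (a *\<^sub>R Y) v = smult (of_real a) (\<rho> Y v)"
    "v \<in> Vpoly m \<Longrightarrow> h \<in> SU2 \<Longrightarrow> rho m' h (\<rho> Y v) = \<rho> (Ad h Y) (rho m h v)"
    "v \<in> Vpoly m \<Longrightarrow> dL (of_int m') (su2 W) (\<rho> Y v) = \<rho> (ad W Y) v + \<rho> Y (dL (of_int m) (su2 W) v)"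
  using assms unfolding clifford_def by blast+

locale spin3 = smooth3 G for G :: "('a, 'p) spin_manifold" +
  assumes riem: "riemannian_metric G" and lc: "levi_civita_connection G" and spinstr: "spin_structure G"
begin

lemma principal: "principal_SU2_bundle G"
  using spinstr by (simp add: spin_structure_def)

lemmas principal_unfolded = principal[unfolded principal_SU2_bundle_def]
lemmas spin_unfolded = spinstr[unfolded spin_structure_def]
lemmas riem_unfolded = riem[unfolded riemannian_metric_def]

lemma act_facts:
  assumes "p \<in> spin G"
  shows act_one: "act G p (mat 1) = p"
    and act_spin: "h \<in> SU2 \<Longrightarrow> act G p h \<in> spin G"
    and proj_act: "h \<in> SU2 \<Longrightarrow> proj G (act G p h) = proj G p"
    and act_act: "h \<in> SU2 \<Longrightarrow> k \<in> SU2 \<Longrightarrow> act G (act G p h) k = act G p (h ** k)"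
    and act_unique: "q \<in> spin G \<Longrightarrow> proj G p = proj G q \<Longrightarrow> \<exists>!h. h \<in> SU2 \<and> q = act G p h"
proof -
  have "\<forall>p\<in>spin G. act G p (mat 1) = p \<and>
        (\<forall>h\<in>SU2. act G p h \<in> spin G \<and> proj G (act G p h) = proj G p \<and>
           (\<forall>k\<in>SU2. act G (act G p h) k = act G p (h ** k)))"
    and u: "\<forall>p\<in>spin G. \<forall>q\<in>spin G. proj G p = proj G q \<longrightarrow> (\<exists>!h. h \<in> SU2 \<and> q = act G p h)"
    by (rule principal_unfolded[THEN conjunct2, THEN conjunct1],
        rule principal_unfolded[THEN conjunct2, THEN conjunct2, THEN conjunct1])
  from bspec[OF this(1) assms] show "act G p (mat 1) = p"
    "h \<in> SU2 \<Longrightarrow> act G p h \<in> spin G" "h \<in> SU2 \<Longrightarrow> proj G (act G p h) = proj G p"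
    "h \<in> SU2 \<Longrightarrow> k \<in> SU2 \<Longrightarrow> act G (act G p h) k = act G p (h ** k)" by simp_all
  from bspec[OF u assms] show "q \<in> spin G \<Longrightarrow> proj G p = proj G q \<Longrightarrow> \<exists>!h. h \<in> SU2 \<and> q = act G p h"
    by blast
qed

lemma proj_surj:
  assumes "x \<in> M"
  obtains p where "p \<in> spin G" "proj G p = x"
proof -
  have "x \<in> proj G ` spin G" using principal_unfolded[THEN conjunct1] assms by simp
  then show thesis using that by (elim imageE) simp
qed

lemma act_inj:
  assumes p: "p \<in> spin G" and h: "h \<in> SU2" and k: "k \<in> SU2" and e: "act G p h = act G p k"
  shows "h = k"
proof -
  have "\<exists>!l. l \<in> SU2 \<and> act G p h = act G p l"
    using act_unique[OF p act_spin[OF p h]] proj_act[OF p h] by simp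
  then obtain l where l: "\<forall>y. y \<in> SU2 \<and> act G p h = act G p y \<longrightarrow> y = l" by (elim ex1E)
  show ?thesis using l[rule_format, of h] l[rule_format, of k] h k e by simp
qed

lemma act_obtain:
  assumes "p \<in> spin G" "q \<in> spin G" "proj G p = proj G q"
  obtains h where "h \<in> SU2" "q = act G p h"
  using act_unique[OF assms] by blast

lemma lsec:
  assumes "(U, \<sigma>) \<in> lsecs G"
  shows lsec_open: "opn U" and lsec_spin: "x \<in> U \<Longrightarrow> \<sigma> x \<in> spin G"
    and lsec_proj: "x \<in> U \<Longrightarrow> proj G (\<sigma> x) = x"
  using principal_unfolded[THEN conjunct2, THEN conjunct2, THEN conjunct2, THEN conjunct2, THEN conjunct1] assms
  by auto

lemma lsec_cover:
  assumes "x \<in> M"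
  obtains U \<sigma> where "(U, \<sigma>) \<in> lsecs G" "x \<in> U"
proof -
  have "(\<Union>(U, s)\<in>lsecs G. U) = M" using principal_unfolded[THEN conjunct2, THEN conjunct2, THEN conjunct2, THEN conjunct1] .
  then show thesis using assms that by blast
qed

lemma lsec_transition:
  assumes "(U, \<sigma>) \<in> lsecs G" "(U', \<sigma>') \<in> lsecs G"
  obtains h where "msmooth G (U \<inter> U') h"
    "\<And>x. x \<in> U \<inter> U' \<Longrightarrow> h x \<in> SU2" "\<And>x. x \<in> U \<inter> U' \<Longrightarrow> \<sigma>' x = act G (\<sigma> x) (h x)"
proof -
  have "\<forall>(U, s)\<in>lsecs G. \<forall>(U', s')\<in>lsecs G. \<exists>h. msmooth G (U \<inter> U') h \<and>
        (\<forall>x\<in>U \<inter> U'. h x \<in> SU2 \<and> s' x = act G (s x) (h x))"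
    using principal_unfolded[THEN conjunct2, THEN conjunct2, THEN conjunct2, THEN conjunct2, THEN conjunct2] .
  from bspec[OF this assms(1)] have "\<forall>(U', s')\<in>lsecs G. \<exists>h. msmooth G (U \<inter> U') h \<and>
        (\<forall>x\<in>U \<inter> U'. h x \<in> SU2 \<and> s' x = act G (\<sigma> x) (h x))" by simp
  from bspec[OF this assms(2)] show thesis using that by auto
qed

lemma frm_facts:
  assumes "p \<in> spin G"
  shows frm_linear: "frm G p (a *\<^sub>R X + b *\<^sub>R Y) = tadd (tscale a (frm G p X)) (tscale b (frm G p Y))"
    and frm_onb: "oriented_onb G (proj G p) (\<lambda>i. frm G p (axis i 1))"
    and frm_act: "h \<in> SU2 \<Longrightarrow> frm G (act G p h) X = frm G p (Ad h X)"
  using bspec[OF spin_unfolded[THEN conjunct2, THEN conjunct1] assms] by simp_all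

lemma frm_VF:
  assumes "(U, \<sigma>) \<in> lsecs G"
  shows "(\<lambda>x. frm G (\<sigma> x) X) \<in> VF U"
proof -
  have "\<forall>(U, s)\<in>lsecs G. \<forall>X. (\<lambda>x. frm G (s x) X) \<in> VF U"
    using spin_unfolded[THEN conjunct2, THEN conjunct2] .
  from bspec[OF this assms] show ?thesis by simp
qed

lemma frm_add: "p \<in> spin G \<Longrightarrow> frm G p (X + Y) = tadd (frm G p X) (frm G p Y)"
  using frm_linear[of p 1 X 1 Y] by (simp add: tscale_def tadd_def)

lemma frm_scale: "p \<in> spin G \<Longrightarrow> frm G p (a *\<^sub>R X) = tscale a (frm G p X)"
  using frm_linear[of p a X 0 X] by (simp add: tscale_def tadd_def)

lemma frm_tangent:
  assumes p: "p \<in> spin G"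
  shows "frm G p X \<in> T (proj G p)"
proof -
  have a: "frm G p (axis i 1) \<in> T (proj G p)" for i
    using frm_onb[OF p] by (simp add: oriented_onb_def)
  have "X = X $ 1 *\<^sub>R axis 1 1 + X $ 2 *\<^sub>R axis 2 1 + X $ 3 *\<^sub>R axis 3 1"
    by (simp add: vec_eq_iff forall_3 axis_def)
  then show ?thesis
    using frm_add[OF p] frm_scale[OF p] tadd_tangent tscale_tangent a by metis
qed

lemma metric_facts:
  assumes "x \<in> M" "u \<in> T x" "v \<in> T x"
  shows metric_add: "w \<in> T x \<Longrightarrow> metric G x (tadd u v) w = metric G x u w + metric G x v w"
    and metric_scale: "metric G x (tscale a u) v = a * metric G x u v"
    and metric_sym: "metric G x u v = metric G x v u"
  using bspec[OF bspec[OF bspec[OF riem_unfolded[THEN conjunct1] assms(1)] assms(2)] assms(3)] by simp_all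

lemma metric_smooth:
  assumes "opn U" "X \<in> VF U" "Y \<in> VF U"
  shows "msmooth G U (\<lambda>x. metric G x (X x) (Y x))"
  using riem_unfolded[THEN conjunct2, rule_format, OF assms] .

lemma proj_M: "p \<in> spin G \<Longrightarrow> proj G p \<in> M"
  using imageI[of p "spin G" "proj G"] principal_unfolded[THEN conjunct1] by simp

lemma axis_expand3: "X = X $ 1 *\<^sub>R axis 1 1 + X $ 2 *\<^sub>R axis 2 1 + X $ 3 *\<^sub>R axis 3 1" for X :: "real^3"
  by (simp add: vec_eq_iff forall_3 axis_def)

text \<open>The frame map is an isometry because it maps the standard basis to an orthonormal basis.\<close>
lemma frm_metric:
  assumes p: "p \<in> spin G"
  shows "metric G (proj G p) (frm G p X) (frm G p Y) = X \<bullet> Y"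
proof -
  let ?g = "metric G (proj G p)" and ?f = "frm G p"
  note x = proj_M[OF p]
  note t = frm_tangent[OF p]
  have on: "?g (?f (axis i 1)) (?f (axis j 1)) = (if i = j then 1 else 0)" for i j
    using frm_onb[OF p] by (simp add: oriented_onb_def)
  have l: "?g (?f (A + B)) (?f C) = ?g (?f A) (?f C) + ?g (?f B) (?f C)"
    "?g (?f (a *\<^sub>R A)) (?f C) = a * ?g (?f A) (?f C)" for A B C a
    using metric_add[OF x t t t] metric_scale[OF x t t] frm_add[OF p] frm_scale[OF p] by simp_all
  have s: "?g (?f A) (?f C) = ?g (?f C) (?f A)" for A C using metric_sym[OF x t t] .
  have e: "?g (?f X) (?f C) = (\<Sum>i\<in>UNIV. X $ i * ?g (?f (axis i 1)) (?f C))" for X C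
    by (subst axis_expand3[of X]) (simp add: l sum_3)
  have "?g (?f (axis i 1)) (?f Y) = Y $ i" for i
    using e[of Y "axis i 1"] by (subst s) (simp add: on if_distrib[of "\<lambda>t. _ * t"] cong: if_cong)
  then show ?thesis using e[of X Y] by (simp add: inner_vec_def)
qed

lemma frm_inj: "p \<in> spin G \<Longrightarrow> frm G p X = frm G p Y \<Longrightarrow> X = Y"
  using frm_metric[of p X "X - Y"] frm_metric[of p Y "X - Y"]
  by (metis eq_iff_diff_eq_0 inner_diff_left inner_eq_zero_iff)

lemma frm_surj:
  assumes p: "p \<in> spin G" and v: "v \<in> T (proj G p)"
  obtains Y where "frm G p Y = v"
proof -
  obtain a where a: "v = (\<lambda>f. \<Sum>i\<in>UNIV. a i * frm G p (axis i 1) f)"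
    using frm_onb[OF p] v unfolding oriented_onb_def by blast
  have "frm G p (a 1 *\<^sub>R axis 1 1 + a 2 *\<^sub>R axis 2 1 + a 3 *\<^sub>R axis 3 1) = v"
    unfolding frm_add[OF p] frm_scale[OF p] a by (simp add: tadd_def tscale_def sum_3)
  then show thesis using that by blast
qed

subsection \<open>Fibres\<close>

text \<open>A class in the fibre over \<open>x\<close> is the graph of an equivariant function on the fibre of the spin bundle. The following
lemmas translate all operations on classes to such functions, so that equality of classes can be tested at one point
of the spin bundle (\<open>fibre_eqI\<close>).\<close>
definition equivariant :: "int \<Rightarrow> 'a \<Rightarrow> ('p \<Rightarrow> complex poly) \<Rightarrow> bool" where
  "equivariant m x F \<longleftrightarrow> (\<forall>p\<in>spin G. proj G p = x \<longrightarrow>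
     F p \<in> Vpoly m \<and> (\<forall>h\<in>SU2. rho m h (F (act G p h)) = F p))"

definition graph_at :: "'a \<Rightarrow> ('p \<Rightarrow> complex poly) \<Rightarrow> 'p spinor" where
  "graph_at x F = {(p, F p) | p. p \<in> spin G \<and> proj G p = x}"

lemma equivariantD:
  assumes "equivariant m x F" "p \<in> spin G" "proj G p = x"
  shows "F p \<in> Vpoly m" "h \<in> SU2 \<Longrightarrow> rho m h (F (act G p h)) = F p"
    "h \<in> SU2 \<Longrightarrow> F (act G p h) = rho m (hermitian_conj h) (F p)"
proof -
  show 1: "F p \<in> Vpoly m" and 2: "h \<in> SU2 \<Longrightarrow> rho m h (F (act G p h)) = F p"
    using assms unfolding equivariant_def by blast+
  assume h: "h \<in> SU2"
  have "F (act G p h) \<in> Vpoly m"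
    using assms act_spin[OF assms(2) h] proj_act[OF assms(2) h] unfolding equivariant_def by simp
  then show "F (act G p h) = rho m (hermitian_conj h) (F p)"
    unfolding 2[OF h, symmetric] by (simp add: rho_compose SU2_D(2)[OF h] rho_one)
qed

lemma cls_graph:
  assumes p: "p \<in> spin G" and v: "v \<in> Vpoly m"
  obtains F where "equivariant m (proj G p) F" "cls G m p v = graph_at (proj G p) F" "F p = v"
proof -
  define F where "F q = rho m (hermitian_conj (THE h. h \<in> SU2 \<and> q = act G p h)) v" for q
  have F: "F (act G p h) = rho m (hermitian_conj h) v" if h: "h \<in> SU2" for h
  proof -
    have "(THE k. k \<in> SU2 \<and> act G p h = act G p k) = h"
      using h act_inj[OF p] by (intro the_equality) auto
    then show ?thesis by (simp add: F_def)
  qed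
  have Fp: "F p = v" using F[of "mat 1"] v p by (simp add: act_one rho_one)
  have eq: "equivariant m (proj G p) F"
    unfolding equivariant_def
  proof (intro ballI impI conjI)
    fix q assume q: "q \<in> spin G" "proj G q = proj G p"
    then obtain k where k: "k \<in> SU2" "q = act G p k" using act_obtain[OF p q(1)] by metis
    show "F q \<in> Vpoly m" unfolding k(2) F[OF k(1)] by (rule rho_Vpoly[OF v])
    fix h assume h: "h \<in> SU2"
    have "rho m h (F (act G q h)) = rho m h (rho m (hermitian_conj (k ** h)) v)"
      using F[OF SU2_mult[OF k(1) h]] act_act[OF p k(1) h] k(2) by simp
    also have "\<dots> = rho m (h ** hermitian_conj h ** hermitian_conj k) v"
      by (simp add: rho_compose v hermitian_conj_mult matrix_mul_assoc)
    also have "\<dots> = F q" using F[OF k(1)] k(2) SU2_D(1)[OF h] by simp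
    finally show "rho m h (F (act G q h)) = F q" .
  qed
  have "w = rho m (hermitian_conj h) v \<longleftrightarrow> w \<in> Vpoly m \<and> rho m h w = v" if h: "h \<in> SU2" for h w
  proof
    assume "w = rho m (hermitian_conj h) v"
    then show "w \<in> Vpoly m \<and> rho m h w = v"
      by (simp add: rho_Vpoly v rho_compose SU2_D(1)[OF h] rho_one)
  next
    assume "w \<in> Vpoly m \<and> rho m h w = v"
    then show "w = rho m (hermitian_conj h) v"
      by (auto simp add: rho_compose SU2_D(2)[OF h] rho_one)
  qed
  then have w: "w \<in> Vpoly m \<and> rho m h w = v \<longleftrightarrow> w = F (act G p h)" if "h \<in> SU2" for h w
    using that F by metis
  have "cls G m p v = {(act G p h, w) | h w. h \<in> SU2 \<and> w = F (act G p h)}"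
    unfolding cls_def by (rule Collect_cong) (use w in metis)
  also have "\<dots> = {(act G p h, F (act G p h)) | h. h \<in> SU2}" by blast
  also have "\<dots> = graph_at (proj G p) F"
    unfolding graph_at_def
  proof (rule Collect_cong)
    fix z
    show "(\<exists>h. z = (act G p h, F (act G p h)) \<and> h \<in> SU2)
      \<longleftrightarrow> (\<exists>q. z = (q, F q) \<and> q \<in> spin G \<and> proj G q = proj G p)"
      using act_spin[OF p] proj_act[OF p] act_obtain[OF p] by metis
  qed
  finally show thesis using that[OF eq _ Fp] by simp
qed

lemma val_graph: "p \<in> spin G \<Longrightarrow> proj G p = x \<Longrightarrow> val (graph_at x F) p = F p"
  unfolding val_def graph_at_def by (rule the_equality) auto

lemma equivariant_eq:
  assumes "equivariant m x F" "equivariant m x F'" "p \<in> spin G" "proj G p = x" "F p = F' p"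
    "q \<in> spin G" "proj G q = x"
  shows "F q = F' q"
proof -
  obtain h where h: "h \<in> SU2" "q = act G p h" using act_obtain[of p q] assms by metis
  show ?thesis
    using equivariantD(3)[OF assms(1,3,4) h(1)] equivariantD(3)[OF assms(2,3,4) h(1)] assms(5) h(2) by simp
qed

lemma fibre_graph:
  assumes "\<xi> \<in> fibre G m x"
  obtains F where "equivariant m x F" "\<xi> = graph_at x F"
proof -
  obtain p v where p: "\<xi> = cls G m p v" "p \<in> spin G" "proj G p = x" "v \<in> Vpoly m"
    using assms unfolding fibre_def by blast
  obtain F where "equivariant m (proj G p) F" "cls G m p v = graph_at (proj G p) F"
    using cls_graph[OF p(2,4)] .
  then show thesis using p that by blast
qed

lemma graph_fibre:
  assumes F: "equivariant m x F" and x: "x \<in> M"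
  shows "graph_at x F \<in> fibre G m x"
proof -
  obtain p where p: "p \<in> spin G" "proj G p = x" using proj_surj[OF x] .
  have v: "F p \<in> Vpoly m" using equivariantD(1)[OF F p] .
  obtain F' where F': "equivariant m (proj G p) F'" "cls G m p (F p) = graph_at (proj G p) F'" "F' p = F p"
    using cls_graph[OF p(1) v] .
  have "F' q = F q" if "q \<in> spin G" "proj G q = x" for q
    using equivariant_eq[of m x F' F p q] F F'(1,3) p that by simp
  then have "graph_at x F' = graph_at x F" unfolding graph_at_def by force
  then have "graph_at x F = cls G m p (F p)" using F'(2) p(2) by simp
  then show ?thesis unfolding fibre_def using p v by blast
qed

context
  fixes \<xi> m x p
  assumes \<xi>: "\<xi> \<in> fibre G m x" and p: "p \<in> spin G" "proj G p = x"
begin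

lemma val_Vpoly: "val \<xi> p \<in> Vpoly m"
  using fibre_graph[OF \<xi>] val_graph[OF p] equivariantD(1)[OF _ p] by metis

lemma val_act: "h \<in> SU2 \<Longrightarrow> rho m h (val \<xi> (act G p h)) = val \<xi> p"
  using fibre_graph[OF \<xi>] val_graph[OF p] val_graph[of "act G p h" x] act_spin[OF p(1)] proj_act[OF p(1)]
    equivariantD(2)[OF _ p] p(2) by metis

lemma fibre_mem_iff: "(p, v) \<in> \<xi> \<longleftrightarrow> v = val \<xi> p"
proof -
  obtain F where "equivariant m x F" "\<xi> = graph_at x F" using fibre_graph[OF \<xi>] .
  then show ?thesis using val_graph[OF p, of F] p unfolding graph_at_def by auto
qed

end

lemma fibre_base: "\<xi> \<in> fibre G m x \<Longrightarrow> x \<in> M"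
  using proj_M unfolding fibre_def by blast

lemma fibre_mem: "\<xi> \<in> fibre G m x \<Longrightarrow> (p, v) \<in> \<xi> \<longleftrightarrow> p \<in> spin G \<and> proj G p = x \<and> v = val \<xi> p"
proof -
  assume \<xi>: "\<xi> \<in> fibre G m x"
  obtain F where "\<xi> = graph_at x F" using fibre_graph[OF \<xi>] .
  then have "(p, v) \<in> \<xi> \<Longrightarrow> p \<in> spin G \<and> proj G p = x" unfolding graph_at_def by auto
  then show ?thesis using fibre_mem_iff[OF \<xi>] by blast
qed

lemma val_equivariant: "\<xi> \<in> fibre G m x \<Longrightarrow> equivariant m x (val \<xi>)"
  unfolding equivariant_def using val_Vpoly val_act by blast

lemma fibre_eqI:
  assumes "\<xi> \<in> fibre G m x" "\<eta> \<in> fibre G m x" "p \<in> spin G" "proj G p = x" "val \<xi> p = val \<eta> p"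
  shows "\<xi> = \<eta>"
proof -
  have "val \<xi> q = val \<eta> q" if "q \<in> spin G" "proj G q = x" for q
    using equivariant_eq[OF val_equivariant[OF assms(1)] val_equivariant[OF assms(2)] assms(3-5) that] .
  then have "(q, w) \<in> \<xi> \<longleftrightarrow> (q, w) \<in> \<eta>" for q w
    unfolding fibre_mem[OF assms(1)] fibre_mem[OF assms(2)] by auto
  then show ?thesis by auto
qed

lemma cls_fibre:
  assumes "p \<in> spin G" "proj G p = x" "v \<in> Vpoly m"
  shows "cls G m p v \<in> fibre G m x" "val (cls G m p v) p = v"
proof -
  show "cls G m p v \<in> fibre G m x" using assms unfolding fibre_def by blast
  obtain F where "cls G m p v = graph_at (proj G p) F" "F p = v"
    using cls_graph[OF assms(1,3)] .
  then show "val (cls G m p v) p = v" using val_graph[OF assms(1,2), of F] assms(2) by simp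
qed

lemma fadd_fibre:
  assumes "\<xi> \<in> fibre G m x" "\<eta> \<in> fibre G m x"
  shows "fadd \<xi> \<eta> \<in> fibre G m x"
    and "p \<in> spin G \<Longrightarrow> proj G p = x \<Longrightarrow> val (fadd \<xi> \<eta>) p = val \<xi> p + val \<eta> p"
proof -
  have e: "fadd \<xi> \<eta> = graph_at x (\<lambda>p. val \<xi> p + val \<eta> p)"
    unfolding fadd_def graph_at_def fibre_mem[OF assms(1)] fibre_mem[OF assms(2)] by auto
  have "equivariant m x (\<lambda>p. val \<xi> p + val \<eta> p)"
    using assms[THEN val_equivariant] unfolding equivariant_def
    by (auto simp: Vpoly_add linop_add[OF linop_rho])
  then show "fadd \<xi> \<eta> \<in> fibre G m x" unfolding e using graph_fibre fibre_base[OF assms(1)] by blast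
  show "p \<in> spin G \<Longrightarrow> proj G p = x \<Longrightarrow> val (fadd \<xi> \<eta>) p = val \<xi> p + val \<eta> p"
    unfolding e by (rule val_graph)
qed

lemma fscale_fibre:
  assumes "\<xi> \<in> fibre G m x"
  shows "fscale a \<xi> \<in> fibre G m x"
    and "p \<in> spin G \<Longrightarrow> proj G p = x \<Longrightarrow> val (fscale a \<xi>) p = smult a (val \<xi> p)"
proof -
  have e: "fscale a \<xi> = graph_at x (\<lambda>p. smult a (val \<xi> p))"
    unfolding fscale_def graph_at_def fibre_mem[OF assms(1)] by auto
  have "equivariant m x (\<lambda>p. smult a (val \<xi> p))"
    using val_equivariant[OF assms] unfolding equivariant_def
    by (auto simp: Vpoly_smult linop_smult[OF linop_rho])
  then show "fscale a \<xi> \<in> fibre G m x" unfolding e using graph_fibre fibre_base[OF assms(1)] by blast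
  show "p \<in> spin G \<Longrightarrow> proj G p = x \<Longrightarrow> val (fscale a \<xi>) p = smult a (val \<xi> p)"
    unfolding e by (rule val_graph)
qed

lemma fsub_fibre:
  assumes "\<xi> \<in> fibre G m x" "\<eta> \<in> fibre G m x"
  shows "fsub \<xi> \<eta> \<in> fibre G m x"
    and "p \<in> spin G \<Longrightarrow> proj G p = x \<Longrightarrow> val (fsub \<xi> \<eta>) p = val \<xi> p - val \<eta> p"
  unfolding fsub_def
  by (simp_all add: fadd_fibre[OF assms(1) fscale_fibre(1)[OF assms(2)]] fscale_fibre(2)[OF assms(2)])

lemma fsum3_fibre:
  assumes "\<And>i. F i \<in> fibre G m x"
  shows "fsum3 F \<in> fibre G m x"
    and "p \<in> spin G \<Longrightarrow> proj G p = x \<Longrightarrow> val (fsum3 F) p = (\<Sum>i\<in>UNIV. val (F i) p)"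
  unfolding fsum3_def
  by (simp_all add: fadd_fibre[OF fadd_fibre(1)[OF assms assms] assms] fadd_fibre(2)[OF assms assms] sum_3)

lemma fzero_fibre:
  assumes "x \<in> M"
  shows "fzero G x \<in> fibre G m x" "p \<in> spin G \<Longrightarrow> proj G p = x \<Longrightarrow> val (fzero G x) p = 0"
proof -
  have e: "fzero G x = graph_at x (\<lambda>p. 0)" unfolding fzero_def graph_at_def by auto
  show "fzero G x \<in> fibre G m x"
    unfolding e by (rule graph_fibre) (simp_all add: equivariant_def linop_0[OF linop_rho] assms)
  show "p \<in> spin G \<Longrightarrow> proj G p = x \<Longrightarrow> val (fzero G x) p = 0" unfolding e by (rule val_graph)
qed

text \<open>Over each point \<open>p\<close> of the spin bundle, \<open>X\<close> is represented by a unique vector \<open>Y p\<close>; equivariance of \<open>\<rho>\<close> matches the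
change of \<open>Y p\<close> along the fibre.\<close>
lemma cliff_bundle_fibre:
  assumes c: "clifford m m' \<rho>" and \<xi>: "\<xi> \<in> fibre G m x" and X: "X \<in> T x"
  shows "cliff_bundle G \<rho> X \<xi> \<in> fibre G m' x"
    and "p \<in> spin G \<Longrightarrow> proj G p = x \<Longrightarrow> frm G p Y = X \<Longrightarrow> val (cliff_bundle G \<rho> X \<xi>) p = \<rho> Y (val \<xi> p)"
proof -
  define Y where "Y p = (THE Y. frm G p Y = X)" for p
  have Yu: "Y p = Z" if "p \<in> spin G" "frm G p Z = X" for p Z
    unfolding Y_def using that frm_inj[OF that(1)] by (intro the_equality) auto
  have Y: "frm G p (Y p) = X" if p: "p \<in> spin G" "proj G p = x" for p
    using frm_surj[OF p(1), of X] Yu[OF p(1)] X p(2) by metis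
  have e: "cliff_bundle G \<rho> X \<xi> = graph_at x (\<lambda>p. \<rho> (Y p) (val \<xi> p))"
    unfolding cliff_bundle_def graph_at_def fibre_mem[OF \<xi>]
  proof (rule Collect_cong, rule iffI)
    fix z
    assume "\<exists>p Y v. z = (p, \<rho> Y v) \<and> (p \<in> spin G \<and> proj G p = x \<and> v = val \<xi> p) \<and> frm G p Y = X"
    then obtain p Z where "z = (p, \<rho> Z (val \<xi> p))" "p \<in> spin G" "proj G p = x" "frm G p Z = X"
      by (elim exE conjE) simp
    then show "\<exists>p. z = (p, \<rho> (Y p) (val \<xi> p)) \<and> p \<in> spin G \<and> proj G p = x"
      using Yu[of p Z] by (intro exI[of _ p]) simp
  next
    fix z
    assume "\<exists>p. z = (p, \<rho> (Y p) (val \<xi> p)) \<and> p \<in> spin G \<and> proj G p = x"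
    then obtain p where "z = (p, \<rho> (Y p) (val \<xi> p))" "p \<in> spin G" "proj G p = x" by (elim exE conjE)
    then show "\<exists>p Y v. z = (p, \<rho> Y v) \<and> (p \<in> spin G \<and> proj G p = x \<and> v = val \<xi> p) \<and> frm G p Y = X"
      using Y[of p] by (intro exI[of _ p] exI[of _ "Y p"] exI[of _ "val \<xi> p"]) simp
  qed
  have "equivariant m' x (\<lambda>p. \<rho> (Y p) (val \<xi> p))"
    unfolding equivariant_def
  proof (intro ballI impI conjI)
    fix p assume p: "p \<in> spin G" "proj G p = x"
    show "\<rho> (Y p) (val \<xi> p) \<in> Vpoly m'" by (rule cliffordD(2)[OF c val_Vpoly[OF \<xi> p]])
    fix h assume h: "h \<in> SU2"
    have ph: "act G p h \<in> spin G" "proj G (act G p h) = x" using act_spin[OF p(1) h] proj_act[OF p(1) h] p by auto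
    have "frm G p (Ad h (Y (act G p h))) = X" using Y[OF ph] frm_act[OF p(1) h] by simp
    then have "Ad h (Y (act G p h)) = Y p" using Yu[OF p(1)] by simp
    then show "rho m' h (\<rho> (Y (act G p h)) (val \<xi> (act G p h))) = \<rho> (Y p) (val \<xi> p)"
      by (simp add: cliffordD(5)[OF c val_Vpoly[OF \<xi> ph] h] val_act[OF \<xi> p h])
  qed
  then show "cliff_bundle G \<rho> X \<xi> \<in> fibre G m' x"
    unfolding e using graph_fibre fibre_base[OF \<xi>] by blast
  show "val (cliff_bundle G \<rho> X \<xi>) p = \<rho> Z (val \<xi> p)" if "p \<in> spin G" "proj G p = x" "frm G p Z = X" for p Z
    using that Yu unfolding e by (simp add: val_graph)
qed

end


section \<open>The spin connection\<close>

context spin3 begin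

lemma
  assumes U: "opn U" and Y: "Y \<in> VF U"
  shows LC_VF: "X \<in> VF U \<Longrightarrow> (\<lambda>x. LC G x (X x) Y) \<in> VF U"
    and LC_point: "x \<in> U \<Longrightarrow> v \<in> T x \<Longrightarrow> LC G x v Y \<in> T x \<and>
        (\<forall>w\<in>T x. LC G x (tadd v w) Y = tadd (LC G x v Y) (LC G x w Y)) \<and>
        (\<forall>a. LC G x (tscale a v) Y = tscale a (LC G x v Y)) \<and>
        (\<forall>Z\<in>VF U. LC G x v (\<lambda>y. tadd (Y y) (Z y)) = tadd (LC G x v Y) (LC G x v Z)) \<and>
        (\<forall>f. msmooth G U f \<longrightarrow>
           LC G x v (\<lambda>y. tscale (f y) (Y y)) = tadd (tscale (v f) (Y x)) (tscale (f x) (LC G x v Y))) \<and>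
        (\<forall>Z. (\<forall>y\<in>U. Z y = Y y) \<longrightarrow> LC G x v Z = LC G x v Y)"
proof -
  note a = lc[unfolded levi_civita_connection_def affine_connection_def, THEN conjunct1, rule_format, OF U Y]
  show "X \<in> VF U \<Longrightarrow> (\<lambda>x. LC G x (X x) Y) \<in> VF U" by (rule a[THEN conjunct1, THEN bspec])
  show "x \<in> U \<Longrightarrow> v \<in> T x \<Longrightarrow> LC G x v Y \<in> T x \<and>
        (\<forall>w\<in>T x. LC G x (tadd v w) Y = tadd (LC G x v Y) (LC G x w Y)) \<and>
        (\<forall>a. LC G x (tscale a v) Y = tscale a (LC G x v Y)) \<and>
        (\<forall>Z\<in>VF U. LC G x v (\<lambda>y. tadd (Y y) (Z y)) = tadd (LC G x v Y) (LC G x v Z)) \<and>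
        (\<forall>f. msmooth G U f \<longrightarrow>
           LC G x v (\<lambda>y. tscale (f y) (Y y)) = tadd (tscale (v f) (Y x)) (tscale (f x) (LC G x v Y))) \<and>
        (\<forall>Z. (\<forall>y\<in>U. Z y = Y y) \<longrightarrow> LC G x v Z = LC G x v Y)"
    by (rule a[THEN conjunct2, THEN bspec, THEN bspec])
qed

lemma
  assumes U: "opn U" and Y: "Y \<in> VF U" and x: "x \<in> U" and v: "v \<in> T x"
  shows LC_tangent: "LC G x v Y \<in> T x"
    and LC_tadd: "w \<in> T x \<Longrightarrow> LC G x (tadd v w) Y = tadd (LC G x v Y) (LC G x w Y)"
    and LC_tscale: "LC G x (tscale a v) Y = tscale a (LC G x v Y)"
    and LC_add: "Z \<in> VF U \<Longrightarrow> LC G x v (\<lambda>y. tadd (Y y) (Z y)) = tadd (LC G x v Y) (LC G x v Z)"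
    and LC_leibniz: "msmooth G U f \<Longrightarrow>
      LC G x v (\<lambda>y. tscale (f y) (Y y)) = tadd (tscale (v f) (Y x)) (tscale (f x) (LC G x v Y))"
    and LC_cong: "(\<And>y. y \<in> U \<Longrightarrow> Z y = Y y) \<Longrightarrow> LC G x v Z = LC G x v Y"
proof -
  note p = LC_point[OF U Y x v]
  note p2 = p[THEN conjunct2] note p3 = p2[THEN conjunct2] note p4 = p3[THEN conjunct2]
  note p5 = p4[THEN conjunct2]
  show "LC G x v Y \<in> T x" by (rule p[THEN conjunct1])
  show "w \<in> T x \<Longrightarrow> LC G x (tadd v w) Y = tadd (LC G x v Y) (LC G x w Y)"
    by (rule p2[THEN conjunct1, THEN bspec])
  show "LC G x (tscale a v) Y = tscale a (LC G x v Y)" by (rule p3[THEN conjunct1, THEN spec])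
  show "Z \<in> VF U \<Longrightarrow> LC G x v (\<lambda>y. tadd (Y y) (Z y)) = tadd (LC G x v Y) (LC G x v Z)"
    by (rule p4[THEN conjunct1, THEN bspec])
  show "msmooth G U f \<Longrightarrow>
      LC G x v (\<lambda>y. tscale (f y) (Y y)) = tadd (tscale (v f) (Y x)) (tscale (f x) (LC G x v Y))"
    by (rule p5[THEN conjunct1, THEN spec, THEN mp])
  show "(\<And>y. y \<in> U \<Longrightarrow> Z y = Y y) \<Longrightarrow> LC G x v Z = LC G x v Y"
    using p5[THEN conjunct2, THEN spec, THEN mp, of Z] by blast
qed

lemma
  assumes U: "opn U" and Y: "Y \<in> VF U" and Z: "Z \<in> VF U" and x: "x \<in> U"
  shows LC_metric: "v \<in> T x \<Longrightarrow> v (\<lambda>y. metric G y (Y y) (Z y))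
      = metric G x (LC G x v Y) (Z x) + metric G x (Y x) (LC G x v Z)"
    and LC_torsion: "tsub (LC G x (Y x) Z) (LC G x (Z x) Y) = bracket G Y Z x"
proof -
  note p = lc[unfolded levi_civita_connection_def, THEN conjunct2, rule_format, OF U Y Z x]
  show "v \<in> T x \<Longrightarrow> v (\<lambda>y. metric G y (Y y) (Z y))
      = metric G x (LC G x v Y) (Z x) + metric G x (Y x) (LC G x v Z)"
    by (rule p[THEN conjunct1, THEN bspec])
  show "tsub (LC G x (Y x) Z) (LC G x (Z x) Y) = bracket G Y Z x" by (rule p[THEN conjunct2])
qed

definition vderiv :: "'a tvec \<Rightarrow> ('a \<Rightarrow> real^3) \<Rightarrow> real^3" where
  "vderiv v c = (\<chi> i. v (\<lambda>y. c y $ i))"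

abbreviation "lfr \<sigma> i \<equiv> (\<lambda>y. frm G (\<sigma> y) (axis i 1))"

lemma frm_expand: "p \<in> spin G \<Longrightarrow> frm G p X = tadd (tadd (tscale (X $ 1) (frm G p (axis 1 1)))
    (tscale (X $ 2) (frm G p (axis 2 1)))) (tscale (X $ 3) (frm G p (axis 3 1)))"
  by (subst axis_expand3) (simp add: frm_add frm_scale)

lemma frm_VF_var:
  assumes s: "(U, \<sigma>) \<in> lsecs G" and W: "opn W" "W \<subseteq> U" and c: "\<And>i. msmooth G W (\<lambda>y. c y $ i)"
  shows "(\<lambda>y. frm G (\<sigma> y) (c y)) \<in> VF W"
proof -
  have "(\<lambda>y. tadd (tadd (tscale (c y $ 1) (lfr \<sigma> 1 y)) (tscale (c y $ 2) (lfr \<sigma> 2 y)))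
      (tscale (c y $ 3) (lfr \<sigma> 3 y))) \<in> VF W" (is "?X \<in> _")
    by (intro VF_tadd VF_tscale c VF_subset[OF frm_VF[OF s] W(2)])
  moreover have e: "frm G (\<sigma> y) (c y) = ?X y" if "y \<in> W" for y
    using frm_expand[of "\<sigma> y"] lsec_spin[OF s] that W(2) by blast
  have "msmooth G V (\<lambda>x. frm G (\<sigma> x) (c x) f)" if V: "opn V" "V \<subseteq> W" "msmooth G V f" for V f
    by (rule msmooth_cong[OF V(1) _ VF_smooth[OF \<open>?X \<in> VF W\<close> V]]) (use e V(2) in auto)
  moreover have "frm G (\<sigma> x) (c x) \<in> T x" if "x \<in> W" for x
    using frm_tangent[of "\<sigma> x"] lsec_spin[OF s] lsec_proj[OF s] that W(2) by fastforce
  ultimately show ?thesis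
    unfolding vector_fields_def mem_Collect_eq by (intro conjI ballI allI impI)
qed

text \<open>Additivity and the Leibniz rule for a field with variable components in the frame of the gauge.\<close>
lemma LC_frm_expand:
  assumes s: "(U, \<sigma>) \<in> lsecs G" and W: "opn W" "W \<subseteq> U" and c: "\<And>i. msmooth G W (\<lambda>y. c y $ i)"
    and x: "x \<in> W" and v: "v \<in> T x"
  shows "LC G x v (\<lambda>y. frm G (\<sigma> y) (c y)) f = frm G (\<sigma> x) (vderiv v c) f
    + (\<Sum>i\<in>UNIV. c x $ i * LC G x v (lfr \<sigma> i) f)"
proof -
  have l: "lfr \<sigma> i \<in> VF W" for i by (rule VF_subset[OF frm_VF[OF s] W(2)])
  have sx: "\<sigma> x \<in> spin G" using lsec_spin[OF s] x W(2) by blast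
  let ?A = "\<lambda>i y. tscale (c y $ i) (lfr \<sigma> i y)"
  have A: "?A i \<in> VF W" for i by (intro VF_tscale l c)
  have "LC G x v (\<lambda>y. frm G (\<sigma> y) (c y)) = LC G x v (\<lambda>y. tadd (tadd (?A 1 y) (?A 2 y)) (?A 3 y))"
    by (rule LC_cong[OF W(1) VF_tadd[OF VF_tadd[OF A A] A] x v])
      (use frm_expand lsec_spin[OF s] W(2) in blast)
  also have "\<dots> = tadd (tadd (LC G x v (?A 1)) (LC G x v (?A 2))) (LC G x v (?A 3))"
    using LC_add[OF W(1) VF_tadd[OF A A] x v A] LC_add[OF W(1) A x v A] by simp
  finally show ?thesis
    unfolding LC_leibniz[OF W(1) l x v c] frm_expand[OF sx, of "vderiv v c"]
    by (simp add: tadd_def tscale_def sum_3 vderiv_def)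
qed

text \<open>Metric compatibility makes the matrix of the connection in an orthonormal frame skew, and skew matrices are exactly the
\<open>ad W\<close>.\<close>
lemma LC_lfr:
  assumes s: "(U, \<sigma>) \<in> lsecs G" and x: "x \<in> U" and v: "v \<in> T x"
  obtains W where "\<And>i. LC G x v (lfr \<sigma> i) = frm G (\<sigma> x) (ad W (axis i 1))"
proof -
  note U = lsec_open[OF s] and sx = lsec_spin[OF s x] and px = lsec_proj[OF s x]
  have l: "lfr \<sigma> i \<in> VF U" for i by (rule frm_VF[OF s])
  have "\<exists>c. LC G x v (lfr \<sigma> i) = frm G (\<sigma> x) c" for i
    using frm_surj[OF sx, of "LC G x v (lfr \<sigma> i)"] LC_tangent[OF U l x v] px by metis
  then obtain c where c: "\<And>i. LC G x v (lfr \<sigma> i) = frm G (\<sigma> x) (c i)" by metis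
  have skew: "c i $ j + c j $ i = 0" for i j
  proof -
    have "v (\<lambda>y. metric G y (lfr \<sigma> i y) (lfr \<sigma> j y)) = v (\<lambda>y. axis i 1 \<bullet> (axis j 1 :: real^3))"
      by (rule tangent_cong[OF v U x]) (use frm_metric lsec_spin[OF s] lsec_proj[OF s] in metis)
    then have "v (\<lambda>y. metric G y (lfr \<sigma> i y) (lfr \<sigma> j y)) = 0"
      using tangent_const[OF v] openin_subset[OF U] x by auto
    then show ?thesis
      using LC_metric[OF U l l x v, of i j] frm_metric[OF sx, of "c i" "axis j 1"]
        frm_metric[OF sx, of "axis i 1" "c j"] px by (simp add: c inner_axis inner_axis')
  qed
  have "c i = ad (vector [c 2 $ 3 / 2, c 3 $ 1 / 2, c 1 $ 2 / 2]) (axis i 1)" for i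
    using skew[of 1 1] skew[of 2 2] skew[of 3 3] skew[of 1 2] skew[of 1 3] skew[of 2 3] exhaust_3[of i]
    by (auto simp: ad_eq cross3_def vec_eq_iff forall_3 axis_def vector_def)
  then show thesis using that c by metis
qed

lemma conn_form_axis:
  assumes s: "(U, \<sigma>) \<in> lsecs G" and x: "x \<in> U" and v: "v \<in> T x"
  shows "LC G x v (\<lambda>y. frm G (\<sigma> y) X) = frm G (\<sigma> x) (ad (conn_form G \<sigma> x v) X)"
    and conn_form_unique: "(\<And>X. LC G x v (\<lambda>y. frm G (\<sigma> y) X) = frm G (\<sigma> x) (ad W X)) \<Longrightarrow> conn_form G \<sigma> x v = W"
proof -
  note U = lsec_open[OF s] and sx = lsec_spin[OF s x]
  have xM: "x \<in> M" using openin_subset[OF U] x by blast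
  obtain W where W: "\<And>i. LC G x v (lfr \<sigma> i) = frm G (\<sigma> x) (ad W (axis i 1))" using LC_lfr[OF s x v] by metis
  have "LC G x v (\<lambda>y. frm G (\<sigma> y) X) = frm G (\<sigma> x) (ad W X)" for X
  proof
    fix f
    have "vderiv v (\<lambda>y. X) = 0" using tangent_const[OF v xM] by (simp add: vderiv_def vec_eq_iff)
    then have "LC G x v (\<lambda>y. frm G (\<sigma> y) X) f = frm G (\<sigma> x) 0 f + (\<Sum>i\<in>UNIV. X $ i * frm G (\<sigma> x) (ad W (axis i 1)) f)"
      using LC_frm_expand[OF s U subset_refl msmooth_const x v, of X f] by (simp add: W)
    also have "frm G (\<sigma> x) 0 f = 0" using frm_scale[OF sx, of 0 0] by (simp add: tscale_def)
    also have "ad W X = X $ 1 *\<^sub>R ad W (axis 1 1) + X $ 2 *\<^sub>R ad W (axis 2 1) + X $ 3 *\<^sub>R ad W (axis 3 1)"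
      by (subst (1) axis_expand3[of X]) (simp only: ad_linear)
    then have "frm G (\<sigma> x) (ad W X) f = (\<Sum>i\<in>UNIV. X $ i * frm G (\<sigma> x) (ad W (axis i 1)) f)"
      by (simp add: frm_add[OF sx] frm_scale[OF sx] tadd_def tscale_def sum_3)
    ultimately show "LC G x v (\<lambda>y. frm G (\<sigma> y) X) f = frm G (\<sigma> x) (ad W X) f" by simp
  qed
  moreover have u: "W' = W''" if "\<And>X. LC G x v (\<lambda>y. frm G (\<sigma> y) X) = frm G (\<sigma> x) (ad W' X)"
    "\<And>X. LC G x v (\<lambda>y. frm G (\<sigma> y) X) = frm G (\<sigma> x) (ad W'' X)" for W' W''
    by (rule ad_inj, rule frm_inj[OF sx]) (use that in metis)
  ultimately have "conn_form G \<sigma> x v = W" unfolding conn_form_def by (intro the_equality) blast+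
  then show "LC G x v (\<lambda>y. frm G (\<sigma> y) X) = frm G (\<sigma> x) (ad (conn_form G \<sigma> x v) X)"
    using \<open>\<And>X. LC G x v (\<lambda>y. frm G (\<sigma> y) X) = frm G (\<sigma> x) (ad W X)\<close> by simp
  show "conn_form G \<sigma> x v = W'" if "\<And>X. LC G x v (\<lambda>y. frm G (\<sigma> y) X) = frm G (\<sigma> x) (ad W' X)" for W'
    unfolding \<open>conn_form G \<sigma> x v = W\<close>
    using u[OF \<open>\<And>X. LC G x v (\<lambda>y. frm G (\<sigma> y) X) = frm G (\<sigma> x) (ad W X)\<close> that] .
qed

lemma LC_frm:
  assumes s: "(U, \<sigma>) \<in> lsecs G" and W: "opn W" "W \<subseteq> U" and c: "\<And>i. msmooth G W (\<lambda>y. c y $ i)"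
    and x: "x \<in> W" and v: "v \<in> T x"
  shows "LC G x v (\<lambda>y. frm G (\<sigma> y) (c y)) = frm G (\<sigma> x) (vderiv v c + ad (conn_form G \<sigma> x v) (c x))"
proof
  fix f
  have xU: "x \<in> U" using x W(2) by blast
  note sx = lsec_spin[OF s xU]
  have "ad (conn_form G \<sigma> x v) (c x) = c x $ 1 *\<^sub>R ad (conn_form G \<sigma> x v) (axis 1 1)
    + c x $ 2 *\<^sub>R ad (conn_form G \<sigma> x v) (axis 2 1) + c x $ 3 *\<^sub>R ad (conn_form G \<sigma> x v) (axis 3 1)"
    by (subst (1) axis_expand3[of "c x"]) (simp only: ad_linear)
  then have "frm G (\<sigma> x) (ad (conn_form G \<sigma> x v) (c x)) f
      = (\<Sum>i\<in>UNIV. c x $ i * frm G (\<sigma> x) (ad (conn_form G \<sigma> x v) (axis i 1)) f)"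
    by (simp add: frm_add[OF sx] frm_scale[OF sx] tadd_def tscale_def sum_3)
  then show "LC G x v (\<lambda>y. frm G (\<sigma> y) (c y)) f
      = frm G (\<sigma> x) (vderiv v c + ad (conn_form G \<sigma> x v) (c x)) f"
    unfolding LC_frm_expand[OF s W c x v] frm_add[OF sx] tadd_def
    by (simp add: conn_form_axis(1)[OF s xU v])
qed

lemma conn_form_linear:
  assumes s: "(U, \<sigma>) \<in> lsecs G" and x: "x \<in> U" and v: "v \<in> T x"
  shows "w \<in> T x \<Longrightarrow> conn_form G \<sigma> x (tadd v w) = conn_form G \<sigma> x v + conn_form G \<sigma> x w"
    and "conn_form G \<sigma> x (tscale a v) = a *\<^sub>R conn_form G \<sigma> x v"
proof -
  note U = lsec_open[OF s] and sx = lsec_spin[OF s x]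
  show "conn_form G \<sigma> x (tadd v w) = conn_form G \<sigma> x v + conn_form G \<sigma> x w" if w: "w \<in> T x"
    by (rule conn_form_unique[OF s x tadd_tangent[OF v w]])
      (simp add: LC_tadd[OF U frm_VF[OF s] x v w] conn_form_axis(1)[OF s x v] conn_form_axis(1)[OF s x w] ad_linear frm_add[OF sx])
  show "conn_form G \<sigma> x (tscale a v) = a *\<^sub>R conn_form G \<sigma> x v"
    by (rule conn_form_unique[OF s x tscale_tangent[OF v]])
      (simp add: LC_tscale[OF U frm_VF[OF s] x v] conn_form_axis(1)[OF s x v] ad_linear frm_scale[OF sx])
qed

text \<open>The components of the connection form are inner products of frame fields and their covariant derivatives.\<close>
lemma conn_form_smooth:
  assumes s: "(U, \<sigma>) \<in> lsecs G" and W: "opn W" "W \<subseteq> U" and X: "X \<in> VF W"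
  shows "msmooth G W (\<lambda>y. conn_form G \<sigma> y (X y) $ i)"
proof -
  have l: "lfr \<sigma> i \<in> VF W" for i by (rule VF_subset[OF frm_VF[OF s] W(2)])
  have sm: "msmooth G W (\<lambda>y. 1/2 * metric G y (LC G y (X y) (lfr \<sigma> j)) (lfr \<sigma> k y))" for j k
    by (intro msmooth_mult msmooth_const metric_smooth LC_VF W(1) l X)
  have e: "metric G y (LC G y (X y) (lfr \<sigma> j)) (lfr \<sigma> k y) = ad (conn_form G \<sigma> y (X y)) (axis j 1) \<bullet> axis k 1"
    if y: "y \<in> W" for y j k
  proof -
    have yU: "y \<in> U" using y W(2) by blast
    show ?thesis
      unfolding conn_form_axis(1)[OF s yU VF_tangent[OF X y]]
      using frm_metric[OF lsec_spin[OF s yU]] lsec_proj[OF s yU] by simp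
  qed
  have sm': "msmooth G W (\<lambda>y. 1/2 * (ad (conn_form G \<sigma> y (X y)) (axis j 1) \<bullet> axis k 1))" for j k
    by (rule msmooth_cong[OF W(1) _ sm[of j k]]) (simp add: e)
  have "1/2 * (ad w (axis 2 1) \<bullet> axis 3 1) = w $ 1" "1/2 * (ad w (axis 3 1) \<bullet> axis 1 1) = w $ 2"
    "1/2 * (ad w (axis 1 1) \<bullet> axis 2 1) = w $ 3" for w :: "real^3"
    by (simp_all add: ad_eq cross3_def inner_vec_def sum_3 axis_def vector_def)
  then show ?thesis
    using sm'[of 2 3] sm'[of 3 1] sm'[of 1 2] exhaust_3[of i] by auto
qed

end


section \<open>Independence of the gauge\<close>

context spin3 begin

lemma tjet_cderiv: "msmooth_near G x f \<Longrightarrow> tjet x v f (f x) (cderiv v f)"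
  by (simp add: tjet_def)

lemma tjet_unique: "tjet x v f a b \<Longrightarrow> tjet x v f a' b' \<Longrightarrow> b = b'"
  by (simp add: tjet_def)

text \<open>The logarithmic derivative of an \<open>SU(2)\<close>-valued function lies in the Lie algebra: it is skew-Hermitian by
differentiating \<open>h\<^sup>* h = 1\<close> and trace-free by differentiating \<open>det h = 1\<close>.\<close>
lemma transition_jet:
  assumes N: "opn N" "x \<in> N" and v: "v \<in> T x" and h: "msmooth G N h" "\<And>y. y \<in> N \<Longrightarrow> h y \<in> SU2"
  obtains W where "\<And>i j. tjet x v (\<lambda>y. h y $ i $ j) (h x $ i $ j) ((h x ** su2 W) $ i $ j)"
proof -
  have xM: "x \<in> M" using openin_subset[OF N(1)] N(2) by blast
  interpret jet_calculus "tjet x v" by (rule jet_calculus_tangent[OF v xM])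
  let ?g = "hermitian_conj (h x)"
  note hx = h(2)[OF N(2)]
  define D where "D = (\<chi> i j. cderiv v (\<lambda>y. h y $ i $ j))"
  define K where "K = ?g ** D"
  have "msmooth G N (\<lambda>y. h y $ i $ j)" for i j
    using msmooth_linear[OF N(1) bounded_linear_compose[OF bounded_linear_vec_nth[of j] bounded_linear_vec_nth[of i]] h(1)] .
  from tjet_cderiv[OF msmooth_nearI[OF N this]]
  have jet: "tjet x v (\<lambda>y. h y $ i $ j) (h x $ i $ j) (D $ i $ j)" for i j
    by (simp add: D_def)
  have hK: "h x ** K = D"
    unfolding K_def matrix_mul_assoc SU2_D(1)[OF hx] by simp
  have "?g ** D + hermitian_conj D ** h x = 0"
  proof -
    have "(?g ** D + hermitian_conj D ** h x) $ i $ j = 0" for i j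
    proof -
      have A: "tjet x v (\<lambda>y. cnj (h y $ 1 $ i) * h y $ 1 $ j + cnj (h y $ 2 $ i) * h y $ 2 $ j)
        (cnj (h x $ 1 $ i) * h x $ 1 $ j + cnj (h x $ 2 $ i) * h x $ 2 $ j)
        ((cnj (h x $ 1 $ i) * D $ 1 $ j + cnj (D $ 1 $ i) * h x $ 1 $ j)
          + (cnj (h x $ 2 $ i) * D $ 2 $ j + cnj (D $ 2 $ i) * h x $ 2 $ j))"
        by (intro jet_add jet_mult tjet_cnj[OF v] jet)
      have e: "cnj (h y $ 1 $ i) * h y $ 1 $ j + cnj (h y $ 2 $ i) * h y $ 2 $ j = mat 1 $ i $ j"
        if "y \<in> N" for y
        using arg_cong[OF SU2_D(2)[OF h(2)[OF that]], of "\<lambda>A. A $ i $ j"] by (simp add: mm2 hermitian_conj_def)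
      have "tjet x v (\<lambda>y. mat 1 $ i $ j) (cnj (h x $ 1 $ i) * h x $ 1 $ j + cnj (h x $ 2 $ i) * h x $ 2 $ j)
        ((cnj (h x $ 1 $ i) * D $ 1 $ j + cnj (D $ 1 $ i) * h x $ 1 $ j)
          + (cnj (h x $ 2 $ i) * D $ 2 $ j + cnj (D $ 2 $ i) * h x $ 2 $ j))"
        by (rule tjet_cong[OF v N e A])
      from tjet_unique[OF this jet_const] show ?thesis
        by (simp add: mm2 hermitian_conj_def algebra_simps)
    qed
    then show ?thesis by (simp add: vec_eq_iff)
  qed
  then have "hermitian_conj K = - K"
    by (simp add: K_def hermitian_conj_mult eq_neg_iff_add_eq_0 add.commute)
  moreover have "tr2 K = 0"
  proof -
    have A: "tjet x v (\<lambda>y. h y $ 1 $ 1 * h y $ 2 $ 2 + - 1 * (h y $ 1 $ 2 * h y $ 2 $ 1))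
      (h x $ 1 $ 1 * h x $ 2 $ 2 + - 1 * (h x $ 1 $ 2 * h x $ 2 $ 1))
      ((h x $ 1 $ 1 * D $ 2 $ 2 + D $ 1 $ 1 * h x $ 2 $ 2) + - 1 * (h x $ 1 $ 2 * D $ 2 $ 1 + D $ 1 $ 2 * h x $ 2 $ 1))"
      by (intro jet_add jet_cmult jet_mult jet)
    have e: "h y $ 1 $ 1 * h y $ 2 $ 2 + - 1 * (h y $ 1 $ 2 * h y $ 2 $ 1) = 1" if "y \<in> N" for y
      using SU2_D(3)[OF h(2)[OF that]] by (simp add: det_2)
    have "tjet x v (\<lambda>y. 1)
      (h x $ 1 $ 1 * h x $ 2 $ 2 + - 1 * (h x $ 1 $ 2 * h x $ 2 $ 1))
      ((h x $ 1 $ 1 * D $ 2 $ 2 + D $ 1 $ 1 * h x $ 2 $ 2) + - 1 * (h x $ 1 $ 2 * D $ 2 $ 1 + D $ 1 $ 2 * h x $ 2 $ 1))"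
      by (rule tjet_cong[OF v N e A])
    from tjet_unique[OF this jet_const] show ?thesis
      by (simp add: K_def tr2_def mm2 hermitian_conj_SU2[OF hx] algebra_simps)
  qed
  ultimately obtain W where "su2 W = K" using su2_range by blast
  then have "tjet x v (\<lambda>y. h y $ i $ j) (h x $ i $ j) ((h x ** su2 W) $ i $ j)" for i j
    using jet hK by simp
  then show thesis using that by blast
qed

text \<open>As \<open>W\<close> is skew-Hermitian, \<open>h W X h\<^sup>* + h X (h W)\<^sup>*\<close> is the conjugate of a commutator.\<close>
lemma Ad_jet:
  assumes N: "opn N" "x \<in> N" and v: "v \<in> T x" and h: "\<And>y. y \<in> N \<Longrightarrow> h y \<in> SU2"
    and jet: "\<And>i j. tjet x v (\<lambda>y. h y $ i $ j) (h x $ i $ j) ((h x ** su2 W) $ i $ j)"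
  shows "vderiv v (\<lambda>y. Ad (h y) X) = Ad (h x) (ad W X)"
proof -
  have xM: "x \<in> M" using openin_subset[OF N(1)] N(2) by blast
  interpret jet_calculus "tjet x v" by (rule jet_calculus_tangent[OF v xM])
  let ?S = "su2 X" and ?K = "su2 W" and ?g = "hermitian_conj (h x)"
  note hx = h[OF N(2)]
  have "hermitian_conj (h x ** ?K) = - (?K ** ?g)"
    by (simp add: hermitian_conj_mult hermitian_conj_su2 mat2_ring)
  then have gj: "tjet x v (\<lambda>y. hermitian_conj (h y) $ i $ j) (?g $ i $ j) ((- (?K ** ?g)) $ i $ j)" for i j
    using tjet_cnj[OF v jet, of j i] by (simp add: hermitian_conj_def vec_eq_iff)
  have E: "h x ** ?K ** ?S ** ?g + h x ** ?S ** (- (?K ** ?g)) = su2 (Ad (h x) (ad W X))"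
    by (simp add: su2_Ad[OF hx] su2_ad mat2_ring matrix_mul_assoc)
  have A: "tjet x v (\<lambda>y. (h y ** ?S ** hermitian_conj (h y)) $ i $ j) ((h x ** ?S ** ?g) $ i $ j)
     ((h x ** ?K ** ?S ** ?g + h x ** ?S ** (- (?K ** ?g))) $ i $ j)" for i j
  proof -
    have 1: "tjet x v (\<lambda>y. (h y ** ?S) $ i $ k) ((h x ** ?S) $ i $ k) ((h x ** ?K ** ?S) $ i $ k)" for k
      using jet_add[OF jet_mult[OF jet jet_const[of "?S $ 1 $ k"]] jet_mult[OF jet jet_const[of "?S $ 2 $ k"]], of i 1 i 2]
      by (simp add: mm2)
    show ?thesis
      using jet_add[OF jet_mult[OF 1 gj] jet_mult[OF 1 gj], of 1 1 j 2 2 j]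
      by (simp add: mm2[of _ "hermitian_conj _"] mm2[of _ "- _"] algebra_simps)
  qed
  have e: "(h y ** ?S ** hermitian_conj (h y)) $ i $ j = su2 (Ad (h y) X) $ i $ j" if "y \<in> N" for y i j
    by (simp add: su2_Ad[OF h[OF that]])
  have "tjet x v (\<lambda>y. su2 (Ad (h y) X) $ i $ j) ((h x ** ?S ** ?g) $ i $ j) (su2 (Ad (h x) (ad W X)) $ i $ j)" for i j
    by (rule tjet_cong[OF v N e A[unfolded E]])
  from this[of 1 1] this[of 1 2] show ?thesis
    by (simp add: tjet_def cderiv_def su2_entries vderiv_def vec_eq_iff forall_3 complex_eq_iff)
qed

lemma Ad_smooth:
  assumes N: "opn N" and h: "\<And>y. y \<in> N \<Longrightarrow> h y \<in> SU2" "msmooth G N h"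
  shows "msmooth G N (\<lambda>y. Ad (h y) X $ i)"
proof -
  have e: "msmooth G N (\<lambda>y. h y $ i $ j)" for i j
    using msmooth_linear[OF N(1) bounded_linear_compose[OF bounded_linear_vec_nth[of j] bounded_linear_vec_nth[of i]] h(2)] .
  have c: "msmooth G N (\<lambda>y. hermitian_conj (h y) $ i $ j)" for i j
    using msmooth_linear[OF N bounded_linear_cnj e[of j i]] by (simp add: hermitian_conj_def)
  have A: "msmooth G N (\<lambda>y. (h y ** su2 X ** hermitian_conj (h y)) $ i $ j)" for i j
    unfolding mm2 by (intro msmooth_add msmooth_mult msmooth_const e c N)
  have s: "msmooth G N (\<lambda>y. su2 (Ad (h y) X) $ i $ j)" for i j
    by (rule msmooth_cong[OF N _ A[of i j]]) (simp add: su2_Ad[OF h(1)])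
  from s[of 1 1] s[of 1 2] show ?thesis
    using exhaust_3[of i] by (auto simp: msmooth_Re_Im_iff[OF N] su2_entries)
qed

text \<open>The transformation law of a connection form, with \<open>W\<close> in the role of \<open>h\<^sup>-\<^sup>1 dh\<close>.\<close>
lemma conn_form_gauge:
  assumes s: "(U, \<sigma>) \<in> lsecs G" and s': "(U', \<sigma>') \<in> lsecs G" and x: "x \<in> U \<inter> U'" and v: "v \<in> T x"
    and h: "msmooth G (U \<inter> U') h" "\<And>y. y \<in> U \<inter> U' \<Longrightarrow> h y \<in> SU2" "\<And>y. y \<in> U \<inter> U' \<Longrightarrow> \<sigma>' y = act G (\<sigma> y) (h y)"
    and jet: "\<And>i j. tjet x v (\<lambda>y. h y $ i $ j) (h x $ i $ j) ((h x ** su2 W) $ i $ j)"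
  shows "conn_form G \<sigma>' x v = W + Ad (hermitian_conj (h x)) (conn_form G \<sigma> x v)"
proof (rule conn_form_unique[OF s'])
  fix X
  let ?N = "U \<inter> U'" and ?w = "conn_form G \<sigma> x v" and ?g = "hermitian_conj (h x)"
  have N: "opn ?N" "?N \<subseteq> U" using lsec_open[OF s] lsec_open[OF s'] by auto
  note hx = h(2)[OF x]
  have sx: "\<sigma> x \<in> spin G" using lsec_spin[OF s] x by blast
  have f: "frm G (\<sigma>' y) Z = frm G (\<sigma> y) (Ad (h y) Z)" if "y \<in> ?N" for y Z
    using h(2,3)[OF that] frm_act lsec_spin[OF s] that by simp
  have "Ad (h x) (Ad ?g ?w) = ?w" using Ad_conj_Ad[OF SU2_conj[OF hx], of ?w] by simp
  then have a: "Ad (h x) (ad (W + Ad ?g ?w) X) = Ad (h x) (ad W X) + ad ?w (Ad (h x) X)"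
    by (simp add: ad_linear Ad_add[OF hx] Ad_ad[OF hx])
  have "LC G x v (\<lambda>y. frm G (\<sigma>' y) X) = LC G x v (\<lambda>y. frm G (\<sigma> y) (Ad (h y) X))"
    by (rule LC_cong[OF N(1) frm_VF_var[OF s N Ad_smooth[OF N(1) h(2,1)]] x v]) (simp_all add: f)
  also have "\<dots> = frm G (\<sigma> x) (Ad (h x) (ad W X) + ad ?w (Ad (h x) X))"
    using LC_frm[OF s N Ad_smooth[OF N(1) h(2,1)] x v, of X] Ad_jet[OF N(1) x v h(2) jet] by simp
  also have "\<dots> = frm G (\<sigma>' x) (ad (W + Ad ?g ?w) X)" unfolding f[OF x] a ..
  finally show "LC G x v (\<lambda>y. frm G (\<sigma>' y) X) = frm G (\<sigma>' x) (ad (W + Ad ?g ?w) X)" .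
qed (use x v in auto)

text \<open>Sections over an open set are needed because the connection Laplacian differentiates along a local frame, which
produces sections that are smooth only near a point.\<close>
definition lsection :: "int \<Rightarrow> 'a set \<Rightarrow> ('a, 'p) section_S \<Rightarrow> bool" where
  "lsection m N s \<longleftrightarrow> opn N \<and> (\<forall>y\<in>N. s y \<in> fibre G m y) \<and>
     (\<forall>(U, \<sigma>)\<in>lsecs G. \<forall>k. msmooth G (U \<inter> N) (\<lambda>y. coeff (val (s y) (\<sigma> y)) k))"

definition nabla :: "('a \<Rightarrow> 'p) \<Rightarrow> int \<Rightarrow> 'a \<Rightarrow> 'a tvec \<Rightarrow> ('a, 'p) section_S \<Rightarrow> complex poly" where
  "nabla \<sigma> m x v s = tderiv m v (\<lambda>y. val (s y) (\<sigma> y))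
     + dL (of_int m) (su2 (conn_form G \<sigma> x v)) (val (s x) (\<sigma> x))"

lemma lsectionD:
  assumes "lsection m N s"
  shows "opn N" "y \<in> N \<Longrightarrow> s y \<in> fibre G m y"
    "(U, \<sigma>) \<in> lsecs G \<Longrightarrow> msmooth G (U \<inter> N) (\<lambda>y. coeff (val (s y) (\<sigma> y)) k)"
  using assms unfolding lsection_def by auto

lemma lsection_val:
  assumes "lsection m N s" "(U, \<sigma>) \<in> lsecs G" "y \<in> U" "y \<in> N"
  shows "val (s y) (\<sigma> y) \<in> Vpoly m"
  by (rule val_Vpoly[OF lsectionD(2)[OF assms(1,4)] lsec_spin[OF assms(2,3)] lsec_proj[OF assms(2,3)]])

lemma lsection_jet:
  assumes L: "lsection m N s" and s: "(U, \<sigma>) \<in> lsecs G" and x: "x \<in> U" "x \<in> N" and v: "v \<in> T x"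
  shows "tpjet x v (\<lambda>y. val (s y) (\<sigma> y)) (val (s x) (\<sigma> x)) (tderiv m v (\<lambda>y. val (s y) (\<sigma> y)))"
    and "tderiv m v (\<lambda>y. val (s y) (\<sigma> y)) \<in> Vpoly m"
proof -
  have o: "opn (U \<inter> N)" using lsec_open[OF s] lsectionD(1)[OF L] by blast
  show "tpjet x v (\<lambda>y. val (s y) (\<sigma> y)) (val (s x) (\<sigma> x)) (tderiv m v (\<lambda>y. val (s y) (\<sigma> y)))"
    by (rule pjet_tderiv[OF v o]) (use x lsection_val[OF L s] lsectionD(3)[OF L s] in auto)
  show "tderiv m v (\<lambda>y. val (s y) (\<sigma> y)) \<in> Vpoly m"
    by (rule tderiv_Vpoly[OF v o]) (use x lsection_val[OF L s] in auto)
qed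

lemma nabla_Vpoly:
  assumes L: "lsection m N s" and s: "(U, \<sigma>) \<in> lsecs G" and x: "x \<in> U" "x \<in> N" and v: "v \<in> T x"
  shows "nabla \<sigma> m x v s \<in> Vpoly m"
  unfolding nabla_def
  by (intro Vpoly_add dL_Vpoly lsection_jet(2)[OF assms] lsection_val[OF L s x])

text \<open>The derivative of \<open>\<rho>(h)\<close> produces \<open>\<rho>(h) \<rho>\<^sub>*(W)\<close>, which is the inhomogeneous part of the new connection form; the
other part is absorbed by equivariance of \<open>\<rho>\<^sub>*\<close>.\<close>
lemma nabla_gauge:
  assumes L: "lsection m N s" and s: "(U, \<sigma>) \<in> lsecs G" and s': "(U', \<sigma>') \<in> lsecs G"
    and x: "x \<in> U \<inter> U'" "x \<in> N" and v: "v \<in> T x"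
    and h: "msmooth G (U \<inter> U') h" "\<And>y. y \<in> U \<inter> U' \<Longrightarrow> h y \<in> SU2" "\<And>y. y \<in> U \<inter> U' \<Longrightarrow> \<sigma>' y = act G (\<sigma> y) (h y)"
  shows "rho m (h x) (nabla \<sigma>' m x v s) = nabla \<sigma> m x v s"
proof (cases "m \<ge> 0")
  case True
  have o: "opn (U \<inter> U')" using lsec_open[OF s] lsec_open[OF s'] by blast
  have xM: "x \<in> M" using openin_subset[OF o] x by blast
  interpret jet_calculus "tjet x v" by (rule jet_calculus_tangent[OF v xM])
  let ?f = "\<lambda>y. val (s y) (\<sigma> y)" and ?f' = "\<lambda>y. val (s y) (\<sigma>' y)" and ?g = "hermitian_conj (h x)"
  let ?w = "conn_form G \<sigma> x v"
  obtain W where jet: "\<And>i j. tjet x v (\<lambda>y. h y $ i $ j) (h x $ i $ j) ((h x ** su2 W) $ i $ j)"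
    using transition_jet[OF o x(1) v h(1,2)] by metis
  note hx = h(2)[OF x(1)]
  have x': "x \<in> U" "x \<in> U'" using x by auto
  note V' = lsection_val[OF L s' x'(2) x(2)]
  have f: "?f y = rho m (h y) (?f' y)" if y: "y \<in> U \<inter> U' \<inter> N" for y
    using val_act[OF lsectionD(2)[OF L] lsec_spin[OF s] lsec_proj[OF s], of y "h y"] y h(2,3)[of y] by simp
  have A: "tpjet x v (\<lambda>y. rho m (h y) (?f' y)) (rho m (h x) (?f' x))
      (rho m (h x) (tderiv m v ?f' + dL (of_int m) (su2 W) (?f' x)))"
    by (rule rho_jet[OF jet lsection_jet(1)[OF L s' x'(2) x(2) v] V' True])
  have "tpjet x v ?f (rho m (h x) (?f' x))
      (rho m (h x) (tderiv m v ?f' + dL (of_int m) (su2 W) (?f' x)))"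
    by (rule pjet_cong[OF v xM _ _ f[symmetric] A, of "U \<inter> U' \<inter> N"]) (use o lsectionD(1)[OF L] x in auto)
  then have d: "tderiv m v ?f = rho m (h x) (tderiv m v ?f' + dL (of_int m) (su2 W) (?f' x))"
    using pjet_unique[OF v xM lsection_jet(1)[OF L s x'(1) x(2) v]] by blast
  have "rho m (h x) (dL (of_int m) (su2 (Ad ?g ?w)) (?f' x))
      = dL (of_int m) (su2 (Ad (h x) (Ad ?g ?w))) (rho m (h x) (?f' x))"
    by (simp add: rho_dL[OF hx V'] su2_Ad[OF hx])
  also have "\<dots> = dL (of_int m) (su2 ?w) (?f x)"
    using Ad_conj_Ad[OF SU2_conj[OF hx], of ?w] f[of x] x by simp
  moreover have "conn_form G \<sigma>' x v = W + Ad ?g ?w"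
    by (rule conn_form_gauge[OF s s' x(1) v h jet])
  ultimately show ?thesis
    unfolding nabla_def d by (simp add: su2_add op_matrix_linear linop_add[OF linop_rho])
next
  case False
  then show ?thesis
    using nabla_Vpoly[OF L s _ x(2) v] nabla_Vpoly[OF L s' _ x(2) v] x by (simp add: Vpoly_neg linop_0[OF linop_rho])
qed

text \<open>The gauge in the definition of \<open>covd\<close> varies from point to point; this lemma replaces it by one fixed gauge around
the point, so that covariant derivatives can be iterated.\<close>
lemma covd_val:
  assumes L: "lsection m N s" and s: "(U, \<sigma>) \<in> lsecs G" and x: "x \<in> U" "x \<in> N" and v: "v \<in> T x"
  shows "covd G m x v s \<in> fibre G m x" "val (covd G m x v s) (\<sigma> x) = nabla \<sigma> m x v s"
proof -
  define \<tau> where "\<tau> = some_lsec G x"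
  have "\<exists>c. c \<in> lsecs G \<and> x \<in> fst c" using s x by force
  note c = someI_ex[OF this]
  define V where "V = fst (SOME c. c \<in> lsecs G \<and> x \<in> fst c)"
  have t: "(V, \<tau>) \<in> lsecs G" "x \<in> V"
    using c unfolding \<tau>_def V_def some_lsec_def by simp_all
  have c: "covd G m x v s = cls G m (\<tau> x) (nabla \<tau> m x v s)"
    unfolding covd_def \<tau>_def[symmetric] Let_def nabla_def
    using drho_eq[OF lsection_val[OF L t x(2)]] by simp
  note tx = lsec_spin[OF t] lsec_proj[OF t] nabla_Vpoly[OF L t x(2) v]
  show fib: "covd G m x v s \<in> fibre G m x" unfolding c by (rule cls_fibre(1)[OF tx])
  obtain h where h: "msmooth G (U \<inter> V) h" "\<And>y. y \<in> U \<inter> V \<Longrightarrow> h y \<in> SU2"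
    "\<And>y. y \<in> U \<inter> V \<Longrightarrow> \<tau> y = act G (\<sigma> y) (h y)" using lsec_transition[OF s t(1)] by metis
  have xx: "x \<in> U \<inter> V" using x t by blast
  have "val (covd G m x v s) (\<sigma> x) = rho m (h x) (val (covd G m x v s) (\<tau> x))"
    using val_act[OF fib lsec_spin[OF s x(1)] lsec_proj[OF s x(1)] h(2)[OF xx]] h(3)[OF xx] by simp
  also have "\<dots> = rho m (h x) (nabla \<tau> m x v s)" unfolding c cls_fibre(2)[OF tx] ..
  also have "\<dots> = nabla \<sigma> m x v s" by (rule nabla_gauge[OF L s t(1) xx x(2) v h])
  finally show "val (covd G m x v s) (\<sigma> x) = nabla \<sigma> m x v s" .
qed

end


section \<open>Covariant derivatives in a gauge\<close>

lemma linop_coeff: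
  assumes "linop A" "p \<in> Vpoly m"
  shows "coeff (A p) j = (\<Sum>k\<le>nat m. coeff p k * coeff (A (monom 1 k)) j)"
proof -
  have "A p = (\<Sum>k\<le>nat m. smult (coeff p k) (A (monom 1 k)))"
    by (subst Vpoly_expand'[OF assms(2)]) (simp add: linop_sum[OF assms(1)] linop_smult[OF assms(1)])
  then show ?thesis by (simp add: coeff_sum)
qed

lemma dL_su2: "dL \<mu> (su2 w) p = (\<Sum>i\<in>UNIV. smult (of_real (w $ i)) (dL \<mu> (sigma i) p))"
  by (simp add: su2_def sum_3 op_matrix_linear)

context spin3 begin

definition smooth_poly :: "int \<Rightarrow> 'a set \<Rightarrow> ('a \<Rightarrow> complex poly) \<Rightarrow> bool" where
  "smooth_poly m W F \<longleftrightarrow> opn W \<and> (\<forall>y\<in>W. F y \<in> Vpoly m) \<and> (\<forall>k. msmooth G W (\<lambda>y. coeff (F y) k))"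

lemma smooth_polyD: "smooth_poly m W F \<Longrightarrow> opn W" "smooth_poly m W F \<Longrightarrow> y \<in> W \<Longrightarrow> F y \<in> Vpoly m"
  "smooth_poly m W F \<Longrightarrow> msmooth G W (\<lambda>y. coeff (F y) k)"
  by (simp_all add: smooth_poly_def)

lemma smooth_poly_subset: "smooth_poly m W F \<Longrightarrow> opn V \<Longrightarrow> V \<subseteq> W \<Longrightarrow> smooth_poly m V F"
  unfolding smooth_poly_def using msmooth_subset by blast

lemma smooth_poly_cong:
  assumes "smooth_poly m W F" "\<And>y. y \<in> W \<Longrightarrow> F y = F' y"
  shows "smooth_poly m W F'"
proof -
  have "msmooth G W (\<lambda>y. coeff (F' y) k)" for k
    by (rule msmooth_cong[OF smooth_polyD(1)[OF assms(1)] _ smooth_polyD(3)[OF assms(1)], of k]) (simp add: assms(2))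
  then show ?thesis
    using assms unfolding smooth_poly_def by fastforce
qed

lemma smooth_poly_sum:
  assumes "opn W" "\<And>i. i \<in> I \<Longrightarrow> smooth_poly m W (F i)"
  shows "smooth_poly m W (\<lambda>y. \<Sum>i\<in>I. F i y)"
  unfolding smooth_poly_def
proof (intro conjI ballI allI)
  show "(\<Sum>i\<in>I. F i y) \<in> Vpoly m" if "y \<in> W" for y
    using assms that by (intro Vpoly_sum) (simp add: smooth_poly_def)
  show "msmooth G W (\<lambda>y. coeff (\<Sum>i\<in>I. F i y) k)" for k
    unfolding coeff_sum by (intro msmooth_sum assms(1) smooth_polyD(3)[OF assms(2)])
qed (rule assms(1))

lemma smooth_poly_add:
  assumes "smooth_poly m W F" "smooth_poly m W F'"
  shows "smooth_poly m W (\<lambda>y. F y + F' y)"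
  unfolding smooth_poly_def coeff_add
  by (intro conjI ballI allI msmooth_add smooth_polyD(1)[OF assms(1)] smooth_polyD(3)[OF assms(1)]
      smooth_polyD(3)[OF assms(2)] Vpoly_add smooth_polyD(2)[OF assms(1)] smooth_polyD(2)[OF assms(2)])

lemma smooth_poly_linop:
  assumes A: "linop A" "\<And>p. p \<in> Vpoly m \<Longrightarrow> A p \<in> Vpoly m'" and F: "smooth_poly m W F"
  shows "smooth_poly m' W (\<lambda>y. A (F y))"
  unfolding smooth_poly_def
proof (intro conjI ballI allI)
  note W = smooth_polyD(1)[OF F]
  show "opn W" by (rule W)
  show "A (F y) \<in> Vpoly m'" if "y \<in> W" for y by (rule A(2)[OF smooth_polyD(2)[OF F that]])
  have s: "msmooth G W (\<lambda>y. \<Sum>k\<le>nat m. coeff (F y) k * coeff (A (monom 1 k)) j)" for j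
    by (intro msmooth_sum msmooth_mult msmooth_const W smooth_polyD(3)[OF F])
  show "msmooth G W (\<lambda>y. coeff (A (F y)) j)" for j
    by (rule msmooth_cong[OF W _ s]) (simp add: linop_coeff[OF A(1) smooth_polyD(2)[OF F]])
qed

lemma smooth_poly_rscale:
  assumes F: "smooth_poly m W F" and c: "msmooth G W c"
  shows "smooth_poly m W (\<lambda>y. smult (of_real (c y)) (F y))"
  unfolding smooth_poly_def
proof (intro conjI ballI allI)
  note W = smooth_polyD(1)[OF F]
  show "opn W" by (rule W)
  show "smult (of_real (c y)) (F y) \<in> Vpoly m" if "y \<in> W" for y
    by (rule Vpoly_smult[OF smooth_polyD(2)[OF F that]])
  show "msmooth G W (\<lambda>y. coeff (smult (of_real (c y)) (F y)) k)" for k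
    unfolding coeff_smult
    by (rule msmooth_mult[OF W msmooth_linear[OF W bounded_linear_of_real c] smooth_polyD(3)[OF F]])
qed

lemma smooth_poly_jet:
  assumes F: "smooth_poly m W F" and x: "x \<in> W" and v: "v \<in> T x"
  shows "tpjet x v F (F x) (tderiv m v F)" "tderiv m v F \<in> Vpoly m"
  by (rule pjet_tderiv[OF v smooth_polyD(1)[OF F] x smooth_polyD(2)[OF F] smooth_polyD(3)[OF F]], assumption)
    (rule tderiv_Vpoly[OF v smooth_polyD(1)[OF F] x smooth_polyD(2)[OF F]])

lemma smooth_poly_base: "smooth_poly m W F \<Longrightarrow> x \<in> W \<Longrightarrow> x \<in> M"
  using openin_subset[OF smooth_polyD(1)] by blast

text \<open>The covariant derivative of a polynomial-valued function in the gauge \<open>\<sigma>\<close>.\<close>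
definition cov_loc :: "('a \<Rightarrow> 'p) \<Rightarrow> int \<Rightarrow> 'a \<Rightarrow> 'a tvec \<Rightarrow> ('a \<Rightarrow> complex poly) \<Rightarrow> complex poly" where
  "cov_loc \<sigma> m x v F = tderiv m v F + dL (of_int m) (su2 (conn_form G \<sigma> x v)) (F x)"

lemma cov_loc_Vpoly: "smooth_poly m W F \<Longrightarrow> x \<in> W \<Longrightarrow> v \<in> T x \<Longrightarrow> cov_loc \<sigma> m x v F \<in> Vpoly m"
  unfolding cov_loc_def by (intro Vpoly_add dL_Vpoly smooth_poly_jet(2) smooth_polyD(2))

lemma cov_loc_jet:
  assumes F: "smooth_poly m W F" and x: "x \<in> W" and v: "v \<in> T x" and j: "tpjet x v F p q"
  shows "cov_loc \<sigma> m x v F = q + dL (of_int m) (su2 (conn_form G \<sigma> x v)) p"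
  using pjet_unique[OF v smooth_poly_base[OF F x] smooth_poly_jet(1)[OF F x v] j] by (simp add: cov_loc_def)

lemma cov_loc_cong:
  assumes W: "opn W" "x \<in> W" and v: "v \<in> T x" and e: "\<And>y. y \<in> W \<Longrightarrow> F y = F' y"
  shows "cov_loc \<sigma> m x v F = cov_loc \<sigma> m x v F'"
proof -
  have "v (\<lambda>y. Re (coeff (F y) k)) = v (\<lambda>y. Re (coeff (F' y) k))"
    "v (\<lambda>y. Im (coeff (F y) k)) = v (\<lambda>y. Im (coeff (F' y) k))" for k
    by (rule tangent_cong[OF v W]; simp add: e)+
  then show ?thesis using e[OF W(2)] by (simp add: cov_loc_def tderiv_def)
qed

lemma cov_loc_sum:
  assumes W: "opn W" and F: "\<And>i. i \<in> I \<Longrightarrow> smooth_poly m W (F i)" and x: "x \<in> W" and v: "v \<in> T x"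
  shows "cov_loc \<sigma> m x v (\<lambda>y. \<Sum>i\<in>I. F i y) = (\<Sum>i\<in>I. cov_loc \<sigma> m x v (F i))"
proof -
  have xM: "x \<in> M" using openin_subset[OF W] x by blast
  interpret jet_calculus "tjet x v" by (rule jet_calculus_tangent[OF v xM])
  have "tpjet x v (\<lambda>y. \<Sum>i\<in>I. F i y) (\<Sum>i\<in>I. F i x) (\<Sum>i\<in>I. tderiv m v (F i))"
    by (intro pjet_sum smooth_poly_jet(1)[OF F x v])
  from cov_loc_jet[OF smooth_poly_sum[OF W F] x v this] show ?thesis
    by (simp add: cov_loc_def sum.distrib linop_sum[OF linop_dL])
qed

text \<open>Infinitesimal equivariance moves \<open>\<rho>\<^sub>*(\<omega>)\<close> past \<open>\<rho>(Y)\<close>: the Clifford homomorphisms are parallel.\<close>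
lemma cov_loc_clifford:
  assumes c: "clifford m m' \<rho>" and F: "smooth_poly m W F" and x: "x \<in> W" and v: "v \<in> T x"
  shows "cov_loc \<sigma> m' x v (\<lambda>y. \<rho> Y (F y)) = \<rho> Y (cov_loc \<sigma> m x v F) + \<rho> (ad (conn_form G \<sigma> x v) Y) (F x)"
proof -
  note xM = smooth_poly_base[OF F x]
  interpret jet_calculus "tjet x v" by (rule jet_calculus_tangent[OF v xM])
  note A = cliffordD(1)[OF c, of Y]
  have sm: "smooth_poly m' W (\<lambda>y. \<rho> Y (F y))" by (rule smooth_poly_linop[OF A cliffordD(2)[OF c] F])
  have l: "\<rho> Y p = (\<Sum>k\<le>nat m. smult (coeff p k) (\<rho> Y (monom 1 k)))" if "p \<in> Vpoly m" for p
    by (subst Vpoly_expand'[OF that]) (simp add: linop_sum[OF A] linop_smult[OF A])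
  have "tpjet x v (\<lambda>y. \<Sum>k\<le>nat m. smult (coeff (F y) k) (\<rho> Y (monom 1 k)))
    (\<Sum>k\<le>nat m. smult (coeff (F x) k) (\<rho> Y (monom 1 k)))
    (\<Sum>k\<le>nat m. smult (coeff (F x) k) 0 + smult (coeff (tderiv m v F) k) (\<rho> Y (monom 1 k)))"
    by (intro pjet_sum pjet_smult pjet_const pjet_coeff[OF smooth_poly_jet(1)[OF F x v]])
  then have j: "tpjet x v (\<lambda>y. \<Sum>k\<le>nat m. smult (coeff (F y) k) (\<rho> Y (monom 1 k))) (\<rho> Y (F x)) (\<rho> Y (tderiv m v F))"
    by (simp add: l[OF smooth_polyD(2)[OF F x]] l[OF smooth_poly_jet(2)[OF F x v]])
  have "tpjet x v (\<lambda>y. \<rho> Y (F y)) (\<rho> Y (F x)) (\<rho> Y (tderiv m v F))"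
    by (rule pjet_cong[OF v xM smooth_polyD(1)[OF F] x _ j]) (rule l[OF smooth_polyD(2)[OF F], symmetric])
  from cov_loc_jet[OF sm x v this] show ?thesis
    by (simp add: cov_loc_def linop_add[OF A] cliffordD(6)[OF c smooth_polyD(2)[OF F x]])
qed

lemma cov_loc_rscale:
  assumes F: "smooth_poly m W F" and c: "msmooth G W c" and x: "x \<in> W" and v: "v \<in> T x"
  shows "cov_loc \<sigma> m x v (\<lambda>y. smult (of_real (c y)) (F y))
    = smult (of_real (v c)) (F x) + smult (of_real (c x)) (cov_loc \<sigma> m x v F)"
proof -
  note xM = smooth_poly_base[OF F x]
  interpret jet_calculus "tjet x v" by (rule jet_calculus_tangent[OF v xM])
  have "tpjet x v (\<lambda>y. smult (of_real (c y)) (F y)) (smult (of_real (c x)) (F x))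
      (smult (of_real (c x)) (tderiv m v F) + smult (of_real (v c)) (F x))"
    by (rule pjet_smult[OF tjet_of_real[OF v xM msmooth_nearI[OF smooth_polyD(1)[OF F] x c]] smooth_poly_jet(1)[OF F x v]])
  from cov_loc_jet[OF smooth_poly_rscale[OF F c] x v this] show ?thesis
    by (simp add: cov_loc_def linop_smult[OF linop_dL] smult_add_right)
qed

lemma tderiv_smooth:
  assumes F: "smooth_poly m W F" and X: "X \<in> VF W"
  shows "smooth_poly m W (\<lambda>y. tderiv m (X y) F)"
  unfolding smooth_poly_def
  proof (intro conjI ballI allI)
    note o = smooth_polyD(1)[OF F]
    show "opn W" by (rule o)
    show "tderiv m (X y) F \<in> Vpoly m" if "y \<in> W" for y by (rule smooth_poly_jet(2)[OF F that VF_tangent[OF X that]])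
    show "msmooth G W (\<lambda>y. coeff (tderiv m (X y) F) k)" for k
    proof (cases "k \<le> nat m")
      case True
      have r: "msmooth G W (\<lambda>y. Re (coeff (F y) k))" "msmooth G W (\<lambda>y. Im (coeff (F y) k))"
        using smooth_polyD(3)[OF F, of k] unfolding msmooth_Re_Im_iff[OF o] by auto
      show ?thesis
        using VF_smooth[OF X o subset_refl r(1)] VF_smooth[OF X o subset_refl r(2)] True
        unfolding msmooth_Re_Im_iff[OF o] by (simp add: tderiv_def coeff_sum)
    qed (simp add: tderiv_def coeff_sum msmooth_const)
  qed

lemma cov_loc_smooth:
  assumes s: "(U, \<sigma>) \<in> lsecs G" and F: "smooth_poly m W F" and W: "W \<subseteq> U" and X: "X \<in> VF W"
  shows "smooth_poly m W (\<lambda>y. cov_loc \<sigma> m y (X y) F)"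
proof -
  note o = smooth_polyD(1)[OF F]
  note 1 = tderiv_smooth[OF F X]
  have 2: "smooth_poly m W (\<lambda>y. dL (of_int m) (su2 (conn_form G \<sigma> y (X y))) (F y))"
    unfolding dL_su2
    by (rule smooth_poly_sum[OF o smooth_poly_rscale[OF smooth_poly_linop[OF linop_dL dL_Vpoly F] conn_form_smooth[OF s o W X]]])
  show ?thesis unfolding cov_loc_def by (rule smooth_poly_add[OF 1 2])
qed

lemma cov_loc_linear:
  assumes s: "(U, \<sigma>) \<in> lsecs G" and x: "x \<in> U"
  shows "cov_loc \<sigma> m x (frm G (\<sigma> x) Y) F = (\<Sum>i\<in>UNIV. smult (of_real (Y $ i)) (cov_loc \<sigma> m x (lfr \<sigma> i x) F))"
proof -
  note sx = lsec_spin[OF s x]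
  have t: "frm G (\<sigma> x) Z \<in> T x" for Z using frm_tangent[OF sx] lsec_proj[OF s x] by simp
  have a: "cov_loc \<sigma> m x (tadd v w) F = cov_loc \<sigma> m x v F + cov_loc \<sigma> m x w F" if "v \<in> T x" "w \<in> T x" for v w
  proof -
    have "Complex (a + b) (c + d) = Complex a c + Complex b d" for a b c d by (simp add: complex_eq_iff)
    then have "tderiv m (tadd v w) F = tderiv m v F + tderiv m w F"
      by (simp add: poly_eq_iff tderiv_def tadd_def coeff_sum)
    then show ?thesis
      by (simp add: cov_loc_def conn_form_linear(1)[OF s x that] su2_add op_matrix_linear)
  qed
  have b: "cov_loc \<sigma> m x (tscale c v) F = smult (of_real c) (cov_loc \<sigma> m x v F)" if "v \<in> T x" for v c
  proof -
    have "Complex (c * a) (c * b) = of_real c * Complex a b" for a b by (simp add: complex_eq_iff)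
    then have "tderiv m (tscale c v) F = smult (of_real c) (tderiv m v F)"
      by (simp add: poly_eq_iff tderiv_def tscale_def coeff_sum)
    then show ?thesis
      by (simp add: cov_loc_def conn_form_linear(2)[OF s x that] su2_scaleR op_matrix_linear smult_add_right)
  qed
  show ?thesis
    unfolding frm_expand[OF sx, of Y] sum_3
    by (simp only: a b t tadd_tangent tscale_tangent)
qed

subsection \<open>Orthonormal frames\<close>

text \<open>The rows of a real square matrix are orthonormal if and only if its columns are. This is why sums over an
orthonormal frame do not depend on the frame.\<close>
lemma orthonormal_sum:
  fixes Y :: "3 \<Rightarrow> real^3" and b :: "3 \<Rightarrow> 3 \<Rightarrow> complex poly"
  assumes "\<And>i j. Y i \<bullet> Y j = (if i = j then 1 else 0)"
  shows "(\<Sum>i\<in>UNIV. \<Sum>j\<in>UNIV. \<Sum>k\<in>UNIV. smult (of_real (Y i $ j * Y i $ k)) (b j k)) = (\<Sum>j\<in>UNIV. b j j)"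
proof -
  define A where "A = (\<chi> i. Y i)"
  have "A ** transpose A = mat 1"
    using assms by (simp add: A_def matrix_matrix_mult_def transpose_def mat_def inner_vec_def vec_eq_iff)
  then have "transpose A ** A = mat 1" using matrix_left_right_inverse by blast
  then have "(transpose A ** A) $ j $ k = (if j = k then 1 else 0)" for j k by (simp add: mat_def)
  then have o: "(\<Sum>i\<in>UNIV. Y i $ j * Y i $ k) = (if j = k then 1 else 0)" for j k
    by (simp add: A_def matrix_matrix_mult_def transpose_def)
  have "(\<Sum>i\<in>UNIV. \<Sum>j\<in>UNIV. \<Sum>k\<in>UNIV. smult (of_real (Y i $ j * Y i $ k)) (b j k))
      = (\<Sum>j\<in>UNIV. \<Sum>k\<in>UNIV. \<Sum>i\<in>UNIV. smult (of_real (Y i $ j * Y i $ k)) (b j k))"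
    unfolding sum_3 by (simp only: ac_simps)
  also have "\<dots> = (\<Sum>j\<in>UNIV. \<Sum>k\<in>UNIV. smult (of_real (\<Sum>i\<in>UNIV. Y i $ j * Y i $ k)) (b j k))"
    by (simp only: sum_3 of_real_add smult_add_left)
  also have "\<dots> = (\<Sum>j\<in>UNIV. b j j)" unfolding o by (simp add: sum_3)
  finally show ?thesis .
qed

lemma local_frame:
  assumes "x \<in> M"
  obtains U where "opn U" "x \<in> U" "oriented_onframe G U (local_frame G x)"
proof -
  obtain U \<sigma> where s: "(U, \<sigma>) \<in> lsecs G" "x \<in> U" using lsec_cover[OF assms] .
  have "oriented_onframe G U (\<lambda>i. lfr \<sigma> i)"
    unfolding oriented_onframe_def
    using frm_VF[OF s(1)] frm_onb[OF lsec_spin[OF s(1)]] lsec_proj[OF s(1)] by simp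
  then have "\<exists>E U. opn U \<and> x \<in> U \<and> oriented_onframe G U E" using lsec_open[OF s(1)] s(2) by blast
  from someI_ex[OF this] show thesis using that unfolding local_frame_def by blast
qed

text \<open>The components of the frame \<open>E\<close> in the frame of the gauge are inner products, hence smooth.\<close>
lemma frame_components:
  assumes E: "oriented_onframe G V E" and s: "(U, \<sigma>) \<in> lsecs G" and V: "opn V"
  obtains Y where "\<And>i y. y \<in> U \<inter> V \<Longrightarrow> frm G (\<sigma> y) (Y i y) = E i y"
    "\<And>i j y. y \<in> U \<inter> V \<Longrightarrow> Y i y \<bullet> Y j y = (if i = j then 1 else 0)"
    "\<And>i j. msmooth G (U \<inter> V) (\<lambda>y. Y i y $ j)"
proof -
  have EV: "E i \<in> VF V" for i using E by (simp add: oriented_onframe_def)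
  define Y where "Y i y = (SOME Z. frm G (\<sigma> y) Z = E i y)" for i y
  have Y: "frm G (\<sigma> y) (Y i y) = E i y" if "y \<in> U \<inter> V" for i y
  proof -
    have "\<exists>Z. frm G (\<sigma> y) Z = E i y"
      using frm_surj[OF lsec_spin[OF s], of y "E i y"] lsec_proj[OF s, of y] VF_tangent[OF EV, of y i] that by auto
    from someI_ex[OF this] show ?thesis by (simp add: Y_def)
  qed
  have g: "metric G y (frm G (\<sigma> y) A) (frm G (\<sigma> y) B) = A \<bullet> B" if "y \<in> U" for y A B
    using frm_metric[OF lsec_spin[OF s that]] lsec_proj[OF s that] by simp
  have on: "Y i y \<bullet> Y j y = (if i = j then 1 else 0)" if y: "y \<in> U \<inter> V" for i j y
  proof -
    have "metric G y (E i y) (E j y) = (if i = j then 1 else 0)"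
      using E y by (simp add: oriented_onframe_def oriented_onb_def)
    then show ?thesis using g[of y "Y i y" "Y j y"] Y[OF y] y by simp
  qed
  have o: "opn (U \<inter> V)" using lsec_open[OF s] V by blast
  have sm: "msmooth G (U \<inter> V) (\<lambda>y. metric G y (E i y) (lfr \<sigma> j y))" for i j
    by (intro metric_smooth o VF_subset[OF EV] VF_subset[OF frm_VF[OF s]]) auto
  have "msmooth G (U \<inter> V) (\<lambda>y. Y i y $ j)" for i j
    by (rule msmooth_cong[OF o _ sm[of i j]]) (simp add: Y[symmetric] g inner_axis)
  with Y on show thesis using that by blast
qed

lemma local_frame_at:
  assumes s: "(U, \<sigma>) \<in> lsecs G" and x: "x \<in> U"
  obtains Y where "\<And>i. frm G (\<sigma> x) (Y i) = local_frame G x i x"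
    "\<And>i j. Y i \<bullet> Y j = (if i = j then 1 else 0)"
proof -
  have "x \<in> M" using openin_subset[OF lsec_open[OF s]] x by blast
  then obtain V where V: "opn V" "x \<in> V" "oriented_onframe G V (local_frame G x)"
    by (rule local_frame)
  obtain Y where "\<And>i y. y \<in> U \<inter> V \<Longrightarrow> frm G (\<sigma> y) (Y i y) = local_frame G x i y"
    "\<And>i j y. y \<in> U \<inter> V \<Longrightarrow> Y i y \<bullet> Y j y = (if i = j then 1 else 0)"
    using frame_components[OF V(3) s V(1)] by metis
  then show thesis using that[of "\<lambda>i. Y i x"] x V(2) by simp
qed

end


section \<open>Dirac operators and the Laplacian in a gauge\<close>

context spin3 begin

definition dirac :: "(real^3 \<Rightarrow> complex poly \<Rightarrow> complex poly) \<Rightarrow> int \<Rightarrow> ('a, 'p) section_S \<Rightarrow> ('a, 'p) section_S" where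
  "dirac \<rho> m s = (\<lambda>x. let E = local_frame G x in
     fsum3 (\<lambda>i. cliff_bundle G \<rho> (E i x) (covd G m x (E i x) s)))"

lemma D_dirac: "D_zero G m = dirac (cliff_zero m) m" "D_plus G m = dirac (cliff_plus m) m"
  "D_minus G m = dirac (cliff_minus m) m"
  by (simp_all add: fun_eq_iff D_zero_def D_plus_def D_minus_def dirac_def)

abbreviation "loc s \<sigma> \<equiv> (\<lambda>y. val (s y) (\<sigma> y))"

lemma nabla_cov_loc: "nabla \<sigma> m x v s = cov_loc \<sigma> m x v (loc s \<sigma>)"
  by (simp add: nabla_def cov_loc_def)

lemma lsection_smooth_poly:
  assumes L: "lsection m N s" and s: "(U, \<sigma>) \<in> lsecs G"
  shows "smooth_poly m (U \<inter> N) (loc s \<sigma>)"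
  unfolding smooth_poly_def using lsec_open[OF s] lsectionD(1,3)[OF L] lsection_val[OF L s] s by blast

lemma lsectionI:
  assumes N: "opn N" and "\<And>U \<sigma> y. (U, \<sigma>) \<in> lsecs G \<Longrightarrow> y \<in> U \<Longrightarrow> y \<in> N \<Longrightarrow> s y \<in> fibre G m y"
    and "\<And>U \<sigma>. (U, \<sigma>) \<in> lsecs G \<Longrightarrow> smooth_poly m (U \<inter> N) (loc s \<sigma>)"
  shows "lsection m N s"
proof -
  have "s y \<in> fibre G m y" if y: "y \<in> N" for y
  proof -
    have "y \<in> M" using openin_subset[OF N] y by blast
    then obtain U \<sigma> where "(U, \<sigma>) \<in> lsecs G" "y \<in> U" by (rule lsec_cover)
    then show ?thesis using assms(2) y by blast
  qed
  then show ?thesis using N smooth_polyD(3)[OF assms(3)] unfolding lsection_def by blast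
qed

lemma lfr_tangent: "(U, \<sigma>) \<in> lsecs G \<Longrightarrow> x \<in> U \<Longrightarrow> lfr \<sigma> i x \<in> T x"
  by (rule VF_tangent[OF frm_VF])

lemma clifford_expand:
  assumes c: "clifford m m' \<rho>" and v: "v \<in> Vpoly m"
  shows "\<rho> Y v = (\<Sum>j\<in>UNIV. smult (of_real (Y $ j)) (\<rho> (axis j 1) v))"
  by (subst axis_expand3) (simp only: cliffordD(3)[OF c v] cliffordD(4)[OF c v] sum_3)

lemma clifford_bilinear:
  fixes n :: "3 \<Rightarrow> complex poly"
  assumes c: "clifford m m' \<rho>" and n: "\<And>k. n k \<in> Vpoly m"
  shows "\<rho> Y (\<Sum>k\<in>UNIV. smult (of_real (Z $ k)) (n k))
    = (\<Sum>j\<in>UNIV. \<Sum>k\<in>UNIV. smult (of_real (Y $ j * Z $ k)) (\<rho> (axis j 1) (n k)))"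
  unfolding linop_sum[OF cliffordD(1)[OF c]] linop_smult[OF cliffordD(1)[OF c]] clifford_expand[OF c n, of Y]
  by (simp add: sum_3 smult_add_right ac_simps)

lemma dirac_val:
  assumes L: "lsection m N s" and c: "clifford m m' \<rho>" and s: "(U, \<sigma>) \<in> lsecs G" and x: "x \<in> U" "x \<in> N"
  shows "dirac \<rho> m s x \<in> fibre G m' x"
    and "val (dirac \<rho> m s x) (\<sigma> x) = (\<Sum>i\<in>UNIV. \<rho> (axis i 1) (cov_loc \<sigma> m x (lfr \<sigma> i x) (loc s \<sigma>)))"
proof -
  let ?E = "local_frame G x" and ?n = "\<lambda>v. cov_loc \<sigma> m x v (loc s \<sigma>)"
  obtain Y where Y: "\<And>i. frm G (\<sigma> x) (Y i) = ?E i x" "\<And>i j. Y i \<bullet> Y j = (if i = j then 1 else 0)"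
    using local_frame_at[OF s x(1)] by metis
  note sx = lsec_spin[OF s x(1)] lsec_proj[OF s x(1)]
  have t: "?E i x \<in> T x" for i using frm_tangent[OF sx(1), of "Y i"] Y(1) sx(2) by simp
  note cv = covd_val[OF L s x t, unfolded nabla_cov_loc]
  note F = lsection_smooth_poly[OF L s]
  have xN: "x \<in> U \<inter> N" using x by blast
  have nV: "?n v \<in> Vpoly m" if "v \<in> T x" for v by (rule cov_loc_Vpoly[OF F xN that])
  note l = lfr_tangent[OF s x(1)]
  note cb = cliff_bundle_fibre[OF c cv(1) t]
  show "dirac \<rho> m s x \<in> fibre G m' x"
    unfolding dirac_def Let_def by (rule fsum3_fibre(1)[OF cb(1)])
  have nE: "?n (?E i x) = (\<Sum>k\<in>UNIV. smult (of_real (Y i $ k)) (?n (lfr \<sigma> k x)))" for i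
    unfolding Y(1)[of i, symmetric] by (rule cov_loc_linear[OF s x(1)])
  have "val (dirac \<rho> m s x) (\<sigma> x) = (\<Sum>i\<in>UNIV. \<rho> (Y i) (?n (?E i x)))"
    unfolding dirac_def Let_def fsum3_fibre(2)[OF cb(1) sx] by (simp only: cb(2)[OF sx Y(1)] cv(2))
  also have "\<dots> = (\<Sum>i\<in>UNIV. \<Sum>j\<in>UNIV. \<Sum>k\<in>UNIV.
      smult (of_real (Y i $ j * Y i $ k)) (\<rho> (axis j 1) (?n (lfr \<sigma> k x))))"
    unfolding nE clifford_bilinear[OF c nV[OF l]] ..
  also have "\<dots> = (\<Sum>i\<in>UNIV. \<rho> (axis i 1) (?n (lfr \<sigma> i x)))"
    by (rule orthonormal_sum[OF Y(2)])
  finally show "val (dirac \<rho> m s x) (\<sigma> x) = (\<Sum>i\<in>UNIV. \<rho> (axis i 1) (?n (lfr \<sigma> i x)))" .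
qed

lemma cov_loc_lfr_smooth:
  assumes "smooth_poly m W F" "(U, \<sigma>) \<in> lsecs G" "W \<subseteq> U"
  shows "smooth_poly m W (\<lambda>y. cov_loc \<sigma> m y (lfr \<sigma> i y) F)"
  by (rule cov_loc_smooth[OF assms(2,1,3) VF_subset[OF frm_VF[OF assms(2)] assms(3)]])

lemma dirac_lsection:
  assumes L: "lsection m N s" and c: "clifford m m' \<rho>"
  shows "lsection m' N (dirac \<rho> m s)"
proof (rule lsectionI[OF lsectionD(1)[OF L]])
  fix U \<sigma> assume s: "(U, \<sigma>) \<in> lsecs G"
  show "dirac \<rho> m s y \<in> fibre G m' y" if "y \<in> U" "y \<in> N" for y
    using dirac_val(1)[OF L c s that] .
  note F = lsection_smooth_poly[OF L s]
  have "smooth_poly m' (U \<inter> N) (\<lambda>y. \<Sum>i\<in>UNIV. \<rho> (axis i 1) (cov_loc \<sigma> m y (lfr \<sigma> i y) (loc s \<sigma>)))"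
    by (rule smooth_poly_sum[OF smooth_polyD(1)[OF F] smooth_poly_linop[OF cliffordD(1)[OF c] cliffordD(2)[OF c]
          cov_loc_lfr_smooth[OF F s Int_lower1]]])
  then show "smooth_poly m' (U \<inter> N) (loc (dirac \<rho> m s) \<sigma>)"
    by (rule smooth_poly_cong) (simp add: dirac_val(2)[OF L c s])
qed

lemma covd_lsection:
  assumes L: "lsection m N s" and X: "X \<in> VF N"
  shows "lsection m N (\<lambda>y. covd G m y (X y) s)"
proof (rule lsectionI[OF lsectionD(1)[OF L]])
  fix U \<sigma> assume s: "(U, \<sigma>) \<in> lsecs G"
  show "covd G m y (X y) s \<in> fibre G m y" if "y \<in> U" "y \<in> N" for y
    by (rule covd_val(1)[OF L s that VF_tangent[OF X that(2)]])
  have "smooth_poly m (U \<inter> N) (\<lambda>y. cov_loc \<sigma> m y (X y) (loc s \<sigma>))"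
    by (rule cov_loc_smooth[OF s lsection_smooth_poly[OF L s] _ VF_subset[OF X]]) auto
  then show "smooth_poly m (U \<inter> N) (loc (\<lambda>y. covd G m y (X y) s) \<sigma>)"
    by (rule smooth_poly_cong) (simp add: covd_val(2)[OF L s] VF_tangent[OF X] nabla_cov_loc)
qed

text \<open>The Hessian \<open>\<nabla>\<^sub>i \<nabla>\<^sub>j F - \<nabla>\<^bsub>\<nabla>\<^sub>i e\<^sub>j\<^esub> F\<close>, with \<open>\<nabla>\<^sub>i e\<^sub>j\<close> expanded in the frame of the gauge.\<close>
definition hess :: "('a \<Rightarrow> 'p) \<Rightarrow> int \<Rightarrow> ('a \<Rightarrow> complex poly) \<Rightarrow> 'a \<Rightarrow> 3 \<Rightarrow> 3 \<Rightarrow> complex poly" where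
  "hess \<sigma> m F x i j = cov_loc \<sigma> m x (lfr \<sigma> i x) (\<lambda>y. cov_loc \<sigma> m y (lfr \<sigma> j y) F)
     - (\<Sum>k\<in>UNIV. smult (of_real (ad (conn_form G \<sigma> x (lfr \<sigma> i x)) (axis j 1) $ k)) (cov_loc \<sigma> m x (lfr \<sigma> k x) F))"

lemma ad_skew: "ad w (axis j 1) $ k = - ad w (axis k 1) $ j"
  using exhaust_3[of j] exhaust_3[of k] by (auto simp: ad_eq cross3_def axis_def vector_def)

lemma ad_expand:
  fixes w :: "3 \<Rightarrow> real^3"
  shows "ad (\<Sum>l\<in>UNIV. a l *\<^sub>R w l) Y = (\<Sum>l\<in>UNIV. \<Sum>k\<in>UNIV. (a l * Y $ k) *\<^sub>R ad (w l) (axis k 1))"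
proof -
  have e: "ad W Y = Y $ 1 *\<^sub>R ad W (axis 1 1) + Y $ 2 *\<^sub>R ad W (axis 2 1) + Y $ 3 *\<^sub>R ad W (axis 3 1)" for W
    by (subst (1) axis_expand3[of Y]) (simp only: ad_linear)
  have "ad (\<Sum>l\<in>UNIV. a l *\<^sub>R w l) Y = (\<Sum>l\<in>UNIV. a l *\<^sub>R ad (w l) Y)"
    by (simp only: sum_3 ad_linear)
  then show ?thesis unfolding e sum_3 by (simp only: scaleR_add_right scaleR_scaleR)
qed

lemma hess_Vpoly:
  assumes "smooth_poly m W F" "(U, \<sigma>) \<in> lsecs G" "W \<subseteq> U" "x \<in> W"
  shows "hess \<sigma> m F x i j \<in> Vpoly m"
proof -
  have "x \<in> U" using assms by blast
  note l = lfr_tangent[OF assms(2) this]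
  have "hess \<sigma> m F x i j = cov_loc \<sigma> m x (lfr \<sigma> i x) (\<lambda>y. cov_loc \<sigma> m y (lfr \<sigma> j y) F)
     + smult (-1) (\<Sum>k\<in>UNIV. smult (of_real (ad (conn_form G \<sigma> x (lfr \<sigma> i x)) (axis j 1) $ k)) (cov_loc \<sigma> m x (lfr \<sigma> k x) F))"
    by (simp add: hess_def)
  then show ?thesis
    by (simp only:) (intro Vpoly_add Vpoly_smult Vpoly_sum cov_loc_Vpoly[OF assms(1,4) l]
        cov_loc_Vpoly[OF cov_loc_lfr_smooth[OF assms(1-3)] assms(4) l])
qed

text \<open>Differentiating the inner operator gives \<open>b(e\<^sub>j) \<nabla>\<^sub>i \<nabla>\<^sub>j F\<close> and the terms \<open>b(\<nabla>\<^sub>i e\<^sub>j) \<nabla>\<^sub>j F\<close>. As the connection matrix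
is skew in \<open>j, k\<close>, the latter are the correction \<open>- b(e\<^sub>j) \<nabla>\<^bsub>\<nabla>\<^sub>i e\<^sub>j\<^esub> F\<close> of the Hessian.\<close>
lemma dirac_dirac_val:
  assumes L: "lsection m N s" and b: "clifford m m' b" and a: "clifford m' m'' a"
    and s: "(U, \<sigma>) \<in> lsecs G" and x: "x \<in> U" "x \<in> N"
  shows "val (dirac a m' (dirac b m s) x) (\<sigma> x)
     = (\<Sum>i\<in>UNIV. \<Sum>j\<in>UNIV. a (axis i 1) (b (axis j 1) (hess \<sigma> m (loc s \<sigma>) x i j)))"
proof -
  let ?F = "loc s \<sigma>" and ?W = "U \<inter> N"
  note F = lsection_smooth_poly[OF L s]
  have W: "?W \<subseteq> U" "x \<in> ?W" using x by auto
  note l = lfr_tangent[OF s x(1)]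
  let ?n = "\<lambda>k. cov_loc \<sigma> m x (lfr \<sigma> k x) ?F"
  note nV = cov_loc_Vpoly[OF F W(2) l]
  note lb = linop_sum[OF cliffordD(1)[OF b]] linop_smult[OF cliffordD(1)[OF b]] linop_diff[OF cliffordD(1)[OF b]]
  have *: "cov_loc \<sigma> m' x (lfr \<sigma> i x) (loc (dirac b m s) \<sigma>) = (\<Sum>j\<in>UNIV. b (axis j 1) (hess \<sigma> m ?F x i j))" for i
  proof -
    let ?w = "conn_form G \<sigma> x (lfr \<sigma> i x)"
    note G1 = cov_loc_lfr_smooth[OF F s W(1)]
    have "cov_loc \<sigma> m' x (lfr \<sigma> i x) (loc (dirac b m s) \<sigma>)
        = cov_loc \<sigma> m' x (lfr \<sigma> i x) (\<lambda>y. \<Sum>j\<in>UNIV. b (axis j 1) (cov_loc \<sigma> m y (lfr \<sigma> j y) ?F))"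
      by (rule cov_loc_cong[OF smooth_polyD(1)[OF F] W(2) l]) (simp add: dirac_val(2)[OF L b s])
    also have "\<dots> = (\<Sum>j\<in>UNIV. cov_loc \<sigma> m' x (lfr \<sigma> i x) (\<lambda>y. b (axis j 1) (cov_loc \<sigma> m y (lfr \<sigma> j y) ?F)))"
      by (rule cov_loc_sum[OF smooth_polyD(1)[OF F] smooth_poly_linop[OF cliffordD(1)[OF b] cliffordD(2)[OF b] G1] W(2) l])
    also have "\<dots> = (\<Sum>j\<in>UNIV. b (axis j 1) (cov_loc \<sigma> m x (lfr \<sigma> i x) (\<lambda>y. cov_loc \<sigma> m y (lfr \<sigma> j y) ?F))
        + b (ad ?w (axis j 1)) (?n j))"
      by (simp only: cov_loc_clifford[OF b G1 W(2) l])
    also have "\<dots> = (\<Sum>j\<in>UNIV. b (axis j 1) (hess \<sigma> m ?F x i j))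
        + ((\<Sum>j\<in>UNIV. \<Sum>k\<in>UNIV. smult (of_real (ad ?w (axis j 1) $ k)) (b (axis j 1) (?n k)))
        + (\<Sum>j\<in>UNIV. \<Sum>k\<in>UNIV. smult (of_real (ad ?w (axis j 1) $ k)) (b (axis k 1) (?n j))))"
      by (simp add: hess_def lb sum.distrib sum_subtractf clifford_expand[OF b nV, of "ad ?w _"])
    also have "(\<Sum>j\<in>UNIV. \<Sum>k\<in>UNIV. smult (of_real (ad ?w (axis j 1) $ k)) (b (axis j 1) (?n k)))
        + (\<Sum>j\<in>UNIV. \<Sum>k\<in>UNIV. smult (of_real (ad ?w (axis j 1) $ k)) (b (axis k 1) (?n j))) = 0"
    proof -
      have "(\<Sum>j\<in>UNIV. \<Sum>k\<in>UNIV. smult (of_real (ad ?w (axis j 1) $ k)) (b (axis j 1) (?n k)))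
         = (\<Sum>j\<in>UNIV. \<Sum>k\<in>UNIV. smult (of_real (- ad ?w (axis k 1) $ j)) (b (axis j 1) (?n k)))"
        by (subst ad_skew) (rule refl)
      also have "\<dots> = - (\<Sum>k\<in>UNIV. \<Sum>j\<in>UNIV. smult (of_real (ad ?w (axis k 1) $ j)) (b (axis j 1) (?n k)))"
        by (subst sum.swap) (simp add: sum_negf)
      finally show ?thesis by simp
    qed
    finally show ?thesis by simp
  qed
  show ?thesis
    unfolding dirac_val(2)[OF dirac_lsection[OF L b] a s x] * linop_sum[OF cliffordD(1)[OF a]] ..
qed

text \<open>Tensoriality of the Hessian: for \<open>X = \<Sum>\<^sub>j y\<^sub>j e\<^sub>j\<close> the derivatives \<open>d\<^sub>j\<close> of the components \<open>y\<^sub>j\<close> cancel between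
\<open>\<nabla>\<^sub>X \<nabla>\<^sub>X F\<close> and \<open>\<nabla>\<^bsub>\<nabla>\<^sub>X X\<^esub> F\<close>. Here \<open>n j\<close> is \<open>\<nabla>\<^sub>j F\<close>, \<open>N l j\<close> is \<open>\<nabla>\<^sub>l \<nabla>\<^sub>j F\<close> and \<open>C\<close> are the connection coefficients.\<close>
lemma hess_sum:
  fixes n :: "3 \<Rightarrow> complex poly" and d y :: "3 \<Rightarrow> real"
  shows "(\<Sum>j\<in>UNIV. smult (of_real (d j)) (n j) + smult (of_real (y j)) (\<Sum>l\<in>UNIV. smult (of_real (y l)) (N l j)))
     - (\<Sum>j\<in>UNIV. smult (of_real (d j + (\<Sum>l\<in>UNIV. \<Sum>k\<in>UNIV. y l * y k * C l k j))) (n j))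
     = (\<Sum>l\<in>UNIV. \<Sum>j\<in>UNIV. smult (of_real (y l * y j)) (N l j - (\<Sum>k\<in>UNIV. smult (of_real (C l j k)) (n k))))"
  by (rule poly_ext) (simp add: sum_3 algebra_simps)

text \<open>By tensoriality the frame of the definition may be replaced by the frame of the gauge.\<close>
lemma laplacian_val:
  assumes L: "lsection m N s" and s: "(U, \<sigma>) \<in> lsecs G" and x: "x \<in> U" "x \<in> N"
  shows "connection_laplacian G m s x \<in> fibre G m x"
    and "val (connection_laplacian G m s x) (\<sigma> x) = - (\<Sum>j\<in>UNIV. hess \<sigma> m (loc s \<sigma>) x j j)"
proof -
  have "x \<in> M" using openin_subset[OF lsec_open[OF s]] x by blast
  then obtain V where V: "opn V" "x \<in> V" "oriented_onframe G V (local_frame G x)"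
    by (rule local_frame)
  let ?E = "local_frame G x" and ?F = "loc s \<sigma>" and ?N = "N \<inter> V" and ?W = "U \<inter> (N \<inter> V)"
  obtain Y where Y: "\<And>i y. y \<in> U \<inter> V \<Longrightarrow> frm G (\<sigma> y) (Y i y) = ?E i y"
    "\<And>i j y. y \<in> U \<inter> V \<Longrightarrow> Y i y \<bullet> Y j y = (if i = j then 1 else 0)"
    "\<And>i j. msmooth G (U \<inter> V) (\<lambda>y. Y i y $ j)"
    using frame_components[OF V(3) s V(1)] by metis
  have E: "?E i \<in> VF V" for i using V(3) by (simp add: oriented_onframe_def)
  have EN: "?E i \<in> VF ?N" for i by (rule VF_subset[OF E]) auto
  have L': "lsection m ?N s"
  proof (rule lsectionI)
    show "opn ?N" using lsectionD(1)[OF L] V(1) by blast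
    show "s y \<in> fibre G m y" if "y \<in> ?N" for y using lsectionD(2)[OF L] that by blast
    show "smooth_poly m (U' \<inter> ?N) (loc s \<sigma>')" if "(U', \<sigma>') \<in> lsecs G" for U' \<sigma>'
      by (rule smooth_poly_subset[OF lsection_smooth_poly[OF L that]])
        (use lsec_open[OF that] lsectionD(1)[OF L] V(1) in auto)
  qed
  have xN: "x \<in> ?N" and xW: "x \<in> ?W" and xUV: "x \<in> U \<inter> V" and WU: "?W \<subseteq> U" and WUV: "?W \<subseteq> U \<inter> V"
    using x V(2) by auto
  note F = lsection_smooth_poly[OF L' s]
  note oW = smooth_polyD(1)[OF F]
  note sx = lsec_spin[OF s x(1)] lsec_proj[OF s x(1)]
  have Et: "?E i y \<in> T y" if "y \<in> V" for i y by (rule VF_tangent[OF E that])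
  note Ex = Et[OF V(2)]
  note cL = covd_lsection[OF L' EN]
  note c1 = covd_val[OF cL s x(1) xN Ex, unfolded nabla_cov_loc]
  have LCt: "LC G x (?E i x) (?E i) \<in> T x" for i by (rule LC_tangent[OF V(1) E V(2) Ex])
  note c2 = covd_val[OF L' s x(1) xN LCt, unfolded nabla_cov_loc]
  note fs = fsub_fibre[OF c1(1) c2(1)]
  show "connection_laplacian G m s x \<in> fibre G m x"
    unfolding connection_laplacian_def Let_def by (intro fscale_fibre(1) fsum3_fibre(1) fs(1))
  let ?n = "\<lambda>k y. cov_loc \<sigma> m y (lfr \<sigma> k y) ?F"
  note nS = cov_loc_lfr_smooth[OF F s WU]
  have main: "cov_loc \<sigma> m x (?E i x) (loc (\<lambda>y. covd G m y (?E i y) s) \<sigma>) - cov_loc \<sigma> m x (LC G x (?E i x) (?E i)) ?F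
      = (\<Sum>l\<in>UNIV. \<Sum>j\<in>UNIV. smult (of_real (Y i x $ l * Y i x $ j)) (hess \<sigma> m ?F x l j))" for i
  proof -
    let ?v = "?E i x" and ?w = "conn_form G \<sigma> x (?E i x)"
    have Ysm: "msmooth G ?W (\<lambda>y. Y i y $ j)" for j by (rule msmooth_subset[OF Y(3) WUV])
    have "cov_loc \<sigma> m x ?v (loc (\<lambda>y. covd G m y (?E i y) s) \<sigma>)
        = cov_loc \<sigma> m x ?v (\<lambda>y. \<Sum>j\<in>UNIV. smult (of_real (Y i y $ j)) (?n j y))"
    proof (rule cov_loc_cong[OF oW xW Ex])
      fix y assume y: "y \<in> ?W"
      then have y': "y \<in> U" "y \<in> ?N" "y \<in> U \<inter> V" "y \<in> V" by auto
      show "val (covd G m y (?E i y) s) (\<sigma> y) = (\<Sum>j\<in>UNIV. smult (of_real (Y i y $ j)) (?n j y))"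
        using covd_val(2)[OF L' s y'(1,2) Et[OF y'(4)], of i] cov_loc_linear[OF s y'(1), of m "Y i y" ?F]
        unfolding nabla_cov_loc Y(1)[OF y'(3)] by (rule trans)
    qed
    also have "\<dots> = (\<Sum>j\<in>UNIV. smult (of_real (?v (\<lambda>y. Y i y $ j))) (?n j x)
        + smult (of_real (Y i x $ j)) (cov_loc \<sigma> m x ?v (?n j)))"
      by (subst cov_loc_sum[OF oW smooth_poly_rscale[OF nS Ysm] xW Ex]) (simp only: cov_loc_rscale[OF nS Ysm xW Ex])
    finally have 1: "cov_loc \<sigma> m x ?v (loc (\<lambda>y. covd G m y (?E i y) s) \<sigma>)
      = (\<Sum>j\<in>UNIV. smult (of_real (vderiv ?v (Y i) $ j)) (?n j x) + smult (of_real (Y i x $ j)) (cov_loc \<sigma> m x ?v (?n j)))"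
      by (simp add: vderiv_def)
    have "LC G x ?v (?E i) = LC G x ?v (\<lambda>y. frm G (\<sigma> y) (Y i y))"
      by (rule LC_cong[OF oW frm_VF_var[OF s oW WU Ysm] xW Ex]) (use Y(1) in auto)
    also have "\<dots> = frm G (\<sigma> x) (vderiv ?v (Y i) + ad ?w (Y i x))"
      by (rule LC_frm[OF s oW WU Ysm xW Ex])
    finally have e: "LC G x ?v (?E i) = frm G (\<sigma> x) (vderiv ?v (Y i) + ad ?w (Y i x))" .
    have 2: "cov_loc \<sigma> m x (LC G x ?v (?E i)) ?F
      = (\<Sum>j\<in>UNIV. smult (of_real (vderiv ?v (Y i) $ j + ad ?w (Y i x) $ j)) (?n j x))"
      unfolding e cov_loc_linear[OF s x(1), of m "vderiv ?v (Y i) + ad ?w (Y i x)"] by (simp only: vector_add_component)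
    have v: "?v = frm G (\<sigma> x) (Y i x)" using Y(1)[OF xUV] by simp
    have t: "frm G (\<sigma> x) Z \<in> T x" for Z using frm_tangent[OF sx(1)] sx(2) by simp
    let ?wl = "\<lambda>l. conn_form G \<sigma> x (lfr \<sigma> l x)"
    have w: "?w = (\<Sum>l\<in>UNIV. Y i x $ l *\<^sub>R ?wl l)"
      unfolding v frm_expand[OF sx(1), of "Y i x"] sum_3
      by (simp only: conn_form_linear[OF s x(1)] t tadd_tangent tscale_tangent)
    have "ad ?w (Y i x) = (\<Sum>l\<in>UNIV. \<Sum>k\<in>UNIV. (Y i x $ l * Y i x $ k) *\<^sub>R ad (?wl l) (axis k 1))"
      unfolding w by (rule ad_expand)
    then have 3: "ad ?w (Y i x) $ j = (\<Sum>l\<in>UNIV. \<Sum>k\<in>UNIV. Y i x $ l * Y i x $ k * ad (?wl l) (axis k 1) $ j)" for j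
      by simp
    have 4: "cov_loc \<sigma> m x ?v (?n j) = (\<Sum>l\<in>UNIV. smult (of_real (Y i x $ l)) (cov_loc \<sigma> m x (lfr \<sigma> l x) (?n j)))" for j
      by (subst v) (rule cov_loc_linear[OF s x(1)])
    show ?thesis
      unfolding 1 2 3 4 hess_def by (rule hess_sum)
  qed
  have "val (connection_laplacian G m s x) (\<sigma> x)
     = - (\<Sum>i\<in>UNIV. \<Sum>l\<in>UNIV. \<Sum>j\<in>UNIV. smult (of_real (Y i x $ l * Y i x $ j)) (hess \<sigma> m ?F x l j))"
    unfolding connection_laplacian_def Let_def fscale_fibre(2)[OF fsum3_fibre(1)[OF fs(1)] sx]
      fsum3_fibre(2)[OF fs(1) sx] fs(2)[OF sx] c1(2) c2(2) main by simp
  also have "\<dots> = - (\<Sum>j\<in>UNIV. hess \<sigma> m ?F x j j)"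
    by (subst orthonormal_sum[OF Y(2)[OF xUV]]) (rule refl)
  finally show "val (connection_laplacian G m s x) (\<sigma> x) = - (\<Sum>j\<in>UNIV. hess \<sigma> m ?F x j j)" .
qed

end


section \<open>Curvature\<close>

context spin3 begin

lemma LC_tsub:
  assumes U: "opn U" and Y: "Y \<in> VF U" and Z: "Z \<in> VF U" and x: "x \<in> U" and v: "v \<in> T x"
  shows "LC G x v (\<lambda>y. tsub (Y y) (Z y)) = tsub (LC G x v Y) (LC G x v Z)"
proof -
  have t: "tsub a b = tadd a (tscale (-1) b)" for a b :: "'a tvec"
    by (simp add: tsub_def tadd_def tscale_def)
  have xM: "x \<in> M" using openin_subset[OF U] x by blast
  have Z': "(\<lambda>y. tscale (-1) (Z y)) \<in> VF U" by (rule VF_tscale[OF Z msmooth_const])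
  show ?thesis
    unfolding t LC_add[OF U Y x v Z'] LC_leibniz[OF U Z x v msmooth_const]
    using tangent_const[OF v xM] by (simp add: tadd_def tscale_def)
qed

text \<open>As the torsion vanishes, the cyclic sum of the curvature is the cyclic sum of \<open>[X, [Y, Z]]\<close>, which is zero by the
Jacobi identity.\<close>
lemma bianchi:
  assumes U: "opn U" and X: "X \<in> VF U" and Y: "Y \<in> VF U" and Z: "Z \<in> VF U" and x: "x \<in> U"
  shows "curvature G X Y Z x f + curvature G Y Z X x f + curvature G Z X Y x f = 0"
proof -
  \<comment> \<open>The nine terms of the three curvatures are regrouped by the field that is differentiated in the end.\<close>
  have key: "LC G x (A x) (\<lambda>y. LC G y (B y) C) f - LC G x (A x) (\<lambda>y. LC G y (C y) B) f
      - LC G x (bracket G B C x) A f = bracket G A (bracket G B C) x f"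
    if A: "A \<in> VF U" and B: "B \<in> VF U" and C: "C \<in> VF U" for A B C
  proof -
    note v = VF_tangent[OF A x] and br = bracket_VF[OF B C U]
    have "LC G x (A x) (\<lambda>y. tsub (LC G y (B y) C) (LC G y (C y) B)) = LC G x (A x) (bracket G B C)"
      by (rule LC_cong[OF U br x v]) (rule LC_torsion[OF U B C])
    then have "tsub (LC G x (A x) (\<lambda>y. LC G y (B y) C)) (LC G x (A x) (\<lambda>y. LC G y (C y) B))
        = LC G x (A x) (bracket G B C)"
      by (simp only: LC_tsub[OF U LC_VF[OF U C B] LC_VF[OF U B C] x v])
    from fun_cong[OF this, of f] show ?thesis
      using fun_cong[OF LC_torsion[OF U A br x], of f] unfolding tsub_def by linarith
  qed
  have "bracket G X (bracket G Y Z) x f + bracket G Y (bracket G Z X) x f + bracket G Z (bracket G X Y) x f = 0"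
  proof (cases "msmooth_near G x f")
    case True
    show ?thesis
      unfolding bracket_bracket[OF X Y Z U x True] bracket_bracket[OF Y Z X U x True] bracket_bracket[OF Z X Y U x True]
      by simp
  qed (simp add: bracket_def)
  then show ?thesis
    unfolding key[OF X Y Z, symmetric] key[OF Y Z X, symmetric] key[OF Z X Y, symmetric]
    by (simp add: curvature_def tsub_def)
qed

abbreviation "cfr \<sigma> a \<equiv> (\<lambda>y. frm G (\<sigma> y) a)"

definition omega :: "('a \<Rightarrow> 'p) \<Rightarrow> real^3 \<Rightarrow> 'a \<Rightarrow> real^3" where
  "omega \<sigma> a y = conn_form G \<sigma> y (frm G (\<sigma> y) a)"

text \<open>The curvature form \<open>d\<omega> + \<omega> \<and> \<omega>\<close> on the fields \<open>frm a\<close> and \<open>frm b\<close>. The last term is the value of \<open>\<omega>\<close> on their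
bracket, which \<open>bracket_cfr\<close> computes from the vanishing torsion.\<close>
definition curv :: "('a \<Rightarrow> 'p) \<Rightarrow> 'a \<Rightarrow> real^3 \<Rightarrow> real^3 \<Rightarrow> real^3" where
  "curv \<sigma> x a b = vderiv (cfr \<sigma> a x) (omega \<sigma> b) - vderiv (cfr \<sigma> b x) (omega \<sigma> a) + ad (omega \<sigma> a x) (omega \<sigma> b x)
     - omega \<sigma> (ad (omega \<sigma> a x) b - ad (omega \<sigma> b x) a) x"

lemma ad_jacobi: "ad u (ad v w) - ad v (ad u w) = ad (ad u v) w"
  by (simp add: ad_eq cross3_def vector_def vec_eq_iff forall_3 algebra_simps)

lemma ad_diff: "ad (u - v) w = ad u w - ad v w" "ad w (u - v) = ad w u - ad w v"
  by (simp_all add: ad_eq cross3_def vector_def vec_eq_iff forall_3 algebra_simps)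

context
  fixes U \<sigma> x
  assumes s: "(U, \<sigma>) \<in> lsecs G" and x: "x \<in> U"
begin

lemma gauge_basics:
  shows gauge_open: "opn U" and gauge_spin: "\<sigma> x \<in> spin G" and gauge_base: "x \<in> M" and gauge_field: "cfr \<sigma> a \<in> VF U" and gauge_tangent: "cfr \<sigma> a x \<in> T x"
  using lsec_open[OF s] lsec_spin[OF s x] openin_subset[OF lsec_open[OF s]] x frm_VF[OF s]
    VF_tangent[OF frm_VF[OF s] x] by auto

lemma omega_smooth: "msmooth G U (\<lambda>y. omega \<sigma> a y $ i)"
  unfolding omega_def by (rule conn_form_smooth[OF s gauge_open subset_refl gauge_field])

lemma bracket_cfr: "bracket G (cfr \<sigma> a) (cfr \<sigma> b) x = frm G (\<sigma> x) (ad (omega \<sigma> a x) b - ad (omega \<sigma> b x) a)"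
proof -
  have "bracket G (cfr \<sigma> a) (cfr \<sigma> b) x = tsub (frm G (\<sigma> x) (ad (omega \<sigma> a x) b)) (frm G (\<sigma> x) (ad (omega \<sigma> b x) a))"
    using LC_torsion[OF gauge_open gauge_field gauge_field x, of a b] by (simp add: conn_form_axis(1)[OF s x gauge_tangent] omega_def)
  then show ?thesis
    using frm_linear[OF gauge_spin, of 1 "ad (omega \<sigma> a x) b" "-1" "ad (omega \<sigma> b x) a"]
    by (simp add: tsub_def tadd_def tscale_def)
qed

lemma vderiv_ad:
  assumes v: "v \<in> T x" and w: "\<And>i. msmooth G U (\<lambda>y. w y $ i)"
  shows "vderiv v (\<lambda>y. ad (w y) X) = ad (vderiv v w) X" "msmooth G U (\<lambda>y. ad (w y) X $ i)"
proof -
  have n: "msmooth_near G x (\<lambda>y. w y $ i)" for i by (rule msmooth_nearI[OF gauge_open x w])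
  have l: "v (\<lambda>y. p * w y $ i - q * w y $ j) = p * v (\<lambda>y. w y $ i) - q * v (\<lambda>y. w y $ j)" for p q i j
    using tangent_diff[OF v msmooth_near_mult[OF msmooth_near_const[OF gauge_base] n] msmooth_near_mult[OF msmooth_near_const[OF gauge_base] n]]
      tangent_scale[OF v n] by simp
  have e: "ad u X $ 1 = (2 * X $ 3) * u $ 2 - (2 * X $ 2) * u $ 3"
    "ad u X $ 2 = (2 * X $ 1) * u $ 3 - (2 * X $ 3) * u $ 1"
    "ad u X $ 3 = (2 * X $ 2) * u $ 1 - (2 * X $ 1) * u $ 2" for u
    by (simp_all add: ad_eq cross3_def vector_def algebra_simps)
  show "vderiv v (\<lambda>y. ad (w y) X) = ad (vderiv v w) X"
    unfolding vec_eq_iff forall_3 e by (simp add: vderiv_def e l)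
  have "msmooth G U (\<lambda>y. p * w y $ i + (- q) * w y $ j)" for p q i j
    by (intro msmooth_add msmooth_mult msmooth_const gauge_open w)
  then have "msmooth G U (\<lambda>y. p * w y $ i - q * w y $ j)" for p q i j by simp
  then show "msmooth G U (\<lambda>y. ad (w y) X $ i)"
    using exhaust_3[of i] by (auto simp: e)
qed

lemma LC_LC:
  "LC G x (cfr \<sigma> a x) (\<lambda>y. LC G y (cfr \<sigma> b y) (cfr \<sigma> X))
    = frm G (\<sigma> x) (ad (vderiv (cfr \<sigma> a x) (omega \<sigma> b)) X + ad (omega \<sigma> a x) (ad (omega \<sigma> b x) X))"
proof -
  have "LC G x (cfr \<sigma> a x) (\<lambda>y. LC G y (cfr \<sigma> b y) (cfr \<sigma> X))
      = LC G x (cfr \<sigma> a x) (\<lambda>y. frm G (\<sigma> y) (ad (omega \<sigma> b y) X))"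
  proof (rule LC_cong[OF gauge_open frm_VF_var[OF s gauge_open subset_refl vderiv_ad(2)[OF gauge_tangent omega_smooth]] x gauge_tangent])
    fix y assume y: "y \<in> U"
    show "LC G y (cfr \<sigma> b y) (cfr \<sigma> X) = frm G (\<sigma> y) (ad (omega \<sigma> b y) X)"
      unfolding omega_def by (rule conn_form_axis(1)[OF s y VF_tangent[OF frm_VF[OF s] y]])
  qed
  also have "\<dots> = frm G (\<sigma> x) (ad (vderiv (cfr \<sigma> a x) (omega \<sigma> b)) X + ad (omega \<sigma> a x) (ad (omega \<sigma> b x) X))"
    unfolding LC_frm[OF s gauge_open subset_refl vderiv_ad(2)[OF gauge_tangent omega_smooth] x gauge_tangent] vderiv_ad(1)[OF gauge_tangent omega_smooth]
    by (simp add: omega_def)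
  finally show ?thesis .
qed

lemma curvature_cfr:
  "curvature G (cfr \<sigma> a) (cfr \<sigma> b) (cfr \<sigma> X) x = frm G (\<sigma> x) (ad (curv \<sigma> x a b) X)"
proof -
  have b: "LC G x (bracket G (cfr \<sigma> a) (cfr \<sigma> b) x) (cfr \<sigma> X)
      = frm G (\<sigma> x) (ad (omega \<sigma> (ad (omega \<sigma> a x) b - ad (omega \<sigma> b x) a) x) X)"
    unfolding bracket_cfr omega_def by (rule conn_form_axis(1)[OF s x gauge_tangent])
  have t: "tsub (frm G (\<sigma> x) A) (frm G (\<sigma> x) B) = frm G (\<sigma> x) (A - B)" for A B
    using frm_linear[OF gauge_spin, of 1 A "-1" B] by (simp add: tsub_def tadd_def tscale_def)
  show ?thesis
    unfolding curvature_def LC_LC b t curv_def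
    by (rule arg_cong[of _ _ "frm G (\<sigma> x)"])
      (simp add: ad_linear ad_diff ad_jacobi[of "omega \<sigma> a x" "omega \<sigma> b x" X, symmetric])
qed

lemma curv_bianchi:
  "ad (curv \<sigma> x a b) d + ad (curv \<sigma> x b d) a + ad (curv \<sigma> x d a) b = 0"
proof -
  have "frm G (\<sigma> x) (ad (curv \<sigma> x a b) d + ad (curv \<sigma> x b d) a + ad (curv \<sigma> x d a) b) = frm G (\<sigma> x) 0"
  proof
    fix f
    show "frm G (\<sigma> x) (ad (curv \<sigma> x a b) d + ad (curv \<sigma> x b d) a + ad (curv \<sigma> x d a) b) f = frm G (\<sigma> x) 0 f"
      using bianchi[OF gauge_open gauge_field gauge_field gauge_field x, of a b d f] frm_scale[OF gauge_spin, of 0 0]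
      by (simp add: curvature_cfr frm_add[OF gauge_spin] tadd_def tscale_def)
  qed
  then show ?thesis by (rule frm_inj[OF gauge_spin])
qed

lemma omega_linear: "y \<in> U \<Longrightarrow> omega \<sigma> (a - b) y = omega \<sigma> a y - omega \<sigma> b y"
  using conn_form_linear[OF s _ VF_tangent[OF frm_VF[OF s]]] frm_linear[OF lsec_spin[OF s], of y 1 a "-1" b]
    tscale_tangent[OF VF_tangent[OF frm_VF[OF s]]]
  by (simp add: omega_def tscale_def[of 1])

lemma curv_antisym: "curv \<sigma> x b a = - curv \<sigma> x a b"
proof -
  have "omega \<sigma> (- y) x = - omega \<sigma> y x" for y
    using omega_linear[OF x, of 0 y] omega_linear[OF x, of 0 0] by simp
  from this[of "ad (omega \<sigma> a x) b - ad (omega \<sigma> b x) a"] show ?thesis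
    by (simp add: curv_def ad_eq cross_skew[of "omega \<sigma> b x" "omega \<sigma> a x"])
qed

lemma curv_diff: "curv \<sigma> x a (b - d) = curv \<sigma> x a b - curv \<sigma> x a d"
proof -
  have n: "msmooth_near G x (\<lambda>y. omega \<sigma> b y $ i)" for b i by (rule msmooth_nearI[OF gauge_open x omega_smooth])
  have "cfr \<sigma> a x (\<lambda>y. omega \<sigma> (b - d) y $ i) = cfr \<sigma> a x (\<lambda>y. omega \<sigma> b y $ i - omega \<sigma> d y $ i)" for i
    by (rule tangent_cong[OF gauge_tangent gauge_open x]) (simp add: omega_linear)
  then have 1: "vderiv (cfr \<sigma> a x) (omega \<sigma> (b - d)) = vderiv (cfr \<sigma> a x) (omega \<sigma> b) - vderiv (cfr \<sigma> a x) (omega \<sigma> d)"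
    by (simp add: vderiv_def vec_eq_iff tangent_diff[OF gauge_tangent n n])
  have 2: "vderiv (cfr \<sigma> (b - d) x) w = vderiv (cfr \<sigma> b x) w - vderiv (cfr \<sigma> d x) w" for w
    using frm_linear[OF gauge_spin, of 1 b "-1" d] by (simp add: vderiv_def vec_eq_iff tadd_def tscale_def)
  show ?thesis
    unfolding curv_def 1 2 ad_diff omega_linear[OF x] by simp
qed

lemma curv_sectional:
  assumes K: "constant_sectional_curvature G c"
    and i: "\<And>p q. p *\<^sub>R a + q *\<^sub>R b = 0 \<Longrightarrow> p = 0 \<and> q = 0"
  shows "ad (curv \<sigma> x a b) b \<bullet> a = c * ((a \<bullet> a) * (b \<bullet> b) - (a \<bullet> b)\<^sup>2)"
proof -
  have "p = 0 \<and> q = 0" if "tadd (tscale p (cfr \<sigma> a x)) (tscale q (cfr \<sigma> b x)) = (\<lambda>f. 0)" for p q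
  proof (rule i, rule frm_inj[OF gauge_spin])
    show "frm G (\<sigma> x) (p *\<^sub>R a + q *\<^sub>R b) = frm G (\<sigma> x) 0"
      using that frm_linear[OF gauge_spin, of p a q b] frm_scale[OF gauge_spin, of 0 0] by (simp add: tscale_def)
  qed
  then have sec: "sectional_curvature G (cfr \<sigma> a) (cfr \<sigma> b) x = c"
    using K[unfolded constant_sectional_curvature_def, rule_format, OF gauge_open gauge_field gauge_field x, of a b] by blast
  have "b \<noteq> 0" using i[of 0 1] by auto
  have "(a \<bullet> a) * (b \<bullet> b) - (a \<bullet> b)\<^sup>2 \<noteq> 0"
  proof
    assume "(a \<bullet> a) * (b \<bullet> b) - (a \<bullet> b)\<^sup>2 = 0"
    then have "((b \<bullet> b) *\<^sub>R a + (- (a \<bullet> b)) *\<^sub>R b) \<bullet> ((b \<bullet> b) *\<^sub>R a + (- (a \<bullet> b)) *\<^sub>R b) = 0"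
      by (simp add: inner_diff_left inner_diff_right inner_commute power2_eq_square algebra_simps)
    then have "(b \<bullet> b) *\<^sub>R a + (- (a \<bullet> b)) *\<^sub>R b = 0" by simp
    from i[OF this] \<open>b \<noteq> 0\<close> show False by simp
  qed
  then show ?thesis
    using sec frm_metric[OF gauge_spin] lsec_proj[OF s x]
    by (simp add: sectional_curvature_def curvature_cfr field_simps)
qed

text \<open>In three dimensions the curvature is a linear operator on the Lie algebra that maps the normal \<open>n = a \<times> b\<close> of a plane to
\<open>curv a b\<close>. The sectional curvatures say that its quadratic form is \<open>- (c/2) |n|\<^sup>2\<close>, and the first Bianchi identity
says that it is symmetric.\<close>
lemma curv_constant:
  assumes K: "constant_sectional_curvature G c"
  shows "curv \<sigma> x (axis 1 1) (axis 2 1) = (- c / 2) *\<^sub>R axis 3 1"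
    "curv \<sigma> x (axis 2 1) (axis 3 1) = (- c / 2) *\<^sub>R axis 1 1"
    "curv \<sigma> x (axis 3 1) (axis 1 1) = (- c / 2) *\<^sub>R axis 2 1"
proof -
  let ?e1 = "axis 1 1 :: real^3" and ?e2 = "axis 2 1 :: real^3" and ?e3 = "axis 3 1 :: real^3"
  note S = ad_eq cross3_def vector_def inner_vec_def sum_3 axis_def power2_eq_square vec_eq_iff forall_3
  \<comment> \<open>The values of the curvature operator on the normals \<open>e\<^sub>1\<close>, \<open>e\<^sub>2\<close>, \<open>e\<^sub>3\<close>.\<close>
  define F1 F2 F3 where F: "F1 = curv \<sigma> x ?e2 ?e3" "F2 = curv \<sigma> x ?e3 ?e1" "F3 = curv \<sigma> x ?e1 ?e2"
  have "ad F3 ?e3 + ad F1 ?e1 + ad F2 ?e2 = 0" unfolding F by (rule curv_bianchi)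
  then have sym: "F1 $ 2 = F2 $ 1" "F1 $ 3 = F3 $ 1" "F2 $ 3 = F3 $ 2" by (simp_all add: S)
  have "ad F3 ?e2 \<bullet> ?e1 = c * ((?e1 \<bullet> ?e1) * (?e2 \<bullet> ?e2) - (?e1 \<bullet> ?e2)\<^sup>2)"
    "ad F1 ?e3 \<bullet> ?e2 = c * ((?e2 \<bullet> ?e2) * (?e3 \<bullet> ?e3) - (?e2 \<bullet> ?e3)\<^sup>2)"
    "ad F2 ?e1 \<bullet> ?e3 = c * ((?e3 \<bullet> ?e3) * (?e1 \<bullet> ?e1) - (?e3 \<bullet> ?e1)\<^sup>2)"
    unfolding F by (rule curv_sectional[OF K]; simp add: S)+
  then have diag: "F1 $ 1 = - c / 2" "F2 $ 2 = - c / 2" "F3 $ 3 = - c / 2" by (simp_all add: S)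
  \<comment> \<open>The planes with the normals \<open>e\<^sub>1 + e\<^sub>2\<close>, \<open>e\<^sub>2 + e\<^sub>3\<close>, \<open>e\<^sub>3 + e\<^sub>1\<close> give the off-diagonal entries of the quadratic form.\<close>
  have "curv \<sigma> x ?e3 (?e1 - ?e2) = F1 + F2" "curv \<sigma> x ?e1 (?e2 - ?e3) = F2 + F3"
    "curv \<sigma> x ?e2 (?e3 - ?e1) = F3 + F1"
    unfolding curv_diff F using curv_antisym[of ?e2 ?e3] curv_antisym[of ?e1 ?e2] curv_antisym[of ?e3 ?e1] by simp_all
  moreover have "ad (curv \<sigma> x ?e3 (?e1 - ?e2)) (?e1 - ?e2) \<bullet> ?e3
      = c * ((?e3 \<bullet> ?e3) * ((?e1 - ?e2) \<bullet> (?e1 - ?e2)) - (?e3 \<bullet> (?e1 - ?e2))\<^sup>2)"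
    "ad (curv \<sigma> x ?e1 (?e2 - ?e3)) (?e2 - ?e3) \<bullet> ?e1
      = c * ((?e1 \<bullet> ?e1) * ((?e2 - ?e3) \<bullet> (?e2 - ?e3)) - (?e1 \<bullet> (?e2 - ?e3))\<^sup>2)"
    "ad (curv \<sigma> x ?e2 (?e3 - ?e1)) (?e3 - ?e1) \<bullet> ?e2
      = c * ((?e2 \<bullet> ?e2) * ((?e3 - ?e1) \<bullet> (?e3 - ?e1)) - (?e2 \<bullet> (?e3 - ?e1))\<^sup>2)"
    by (rule curv_sectional[OF K]; simp add: S)+
  ultimately have "F1 $ 2 + F2 $ 1 = 0" "F2 $ 3 + F3 $ 2 = 0" "F3 $ 1 + F1 $ 3 = 0"
    using diag by (simp_all add: S algebra_simps)
  with sym diag have "F3 = (- c / 2) *\<^sub>R ?e3" "F1 = (- c / 2) *\<^sub>R ?e1" "F2 = (- c / 2) *\<^sub>R ?e2"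
    by (simp_all add: vec_eq_iff forall_3 axis_def)
  then show "curv \<sigma> x ?e1 ?e2 = (- c / 2) *\<^sub>R ?e3" "curv \<sigma> x ?e2 ?e3 = (- c / 2) *\<^sub>R ?e1"
    "curv \<sigma> x ?e3 ?e1 = (- c / 2) *\<^sub>R ?e2" unfolding F by auto
qed

end

end


section \<open>Curvature of the spinor bundles\<close>

lemma dL_su2_linear:
  "dL \<mu> (su2 (v + w)) p = dL \<mu> (su2 v) p + dL \<mu> (su2 w) p"
  "dL \<mu> (su2 (v - w)) p = dL \<mu> (su2 v) p - dL \<mu> (su2 w) p"
proof -
  show a: "dL \<mu> (su2 (v + w)) p = dL \<mu> (su2 v) p + dL \<mu> (su2 w) p" for v w
    by (simp add: su2_add op_matrix_linear)
  from a[of "v - w" w] show "dL \<mu> (su2 (v - w)) p = dL \<mu> (su2 v) p - dL \<mu> (su2 w) p" by simp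
qed

lemma su2_axis: "su2 (axis k 1) = sigma k"
  using exhaust_3[of k] by (auto simp: su2_def sum_3 axis_def)

lemma ad_axis_sum: "ad u w = (\<Sum>k\<in>UNIV. w $ k *\<^sub>R ad u (axis k 1))"
  by (simp add: vec_eq_iff forall_3 sum_3 ad_eq cross3_def axis_def vector_def algebra_simps)

text \<open>The Casimir operator of \<open>V\<^sub>m\<close>, and two invariant maps between representations of different highest weight, which
have to vanish.\<close>
lemma casimir:
  "(\<Sum>k\<in>UNIV. dL \<mu> (su2 (axis k 1)) (dL \<mu> (su2 (axis k 1)) p)) = smult (- \<mu> * (\<mu> + 2)) p"
  "(\<Sum>k\<in>UNIV. dP (su2 (axis k 1)) (dL \<mu> (su2 (axis k 1)) p)) = 0"
  "(\<Sum>k\<in>UNIV. dN \<mu> (su2 (axis k 1)) (dL \<mu> (su2 (axis k 1)) p)) = 0"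
  by (rule poly_ext; simp add: su2_axis sum_3 sigma_entries dL_def dP_def dN_def pderiv_add pderiv_diff pderiv_smult
      pderiv_mult pderiv_pCons pderiv_minus algebra_simps)+

context spin3 begin

lemma cov_loc_add:
  assumes F: "smooth_poly m W F" and F': "smooth_poly m W F'" and x: "x \<in> W" and v: "v \<in> T x"
  shows "cov_loc \<sigma> m x v (\<lambda>y. F y + F' y) = cov_loc \<sigma> m x v F + cov_loc \<sigma> m x v F'"
proof -
  interpret jet_calculus "tjet x v" by (rule jet_calculus_tangent[OF v smooth_poly_base[OF F x]])
  from cov_loc_jet[OF smooth_poly_add[OF F F'] x v pjet_add[OF smooth_poly_jet(1)[OF F x v] smooth_poly_jet(1)[OF F' x v]]]
  show ?thesis by (simp add: cov_loc_def linop_add[OF linop_dL])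
qed

lemma tderiv_bracket:
  assumes F: "smooth_poly m W F" and x: "x \<in> W"
  shows "tderiv m (X x) (\<lambda>y. tderiv m (Y y) F) - tderiv m (Y x) (\<lambda>y. tderiv m (X y) F)
    = tderiv m (bracket G X Y x) F"
proof -
  have c: "coeff (tderiv m v H) k = (if k \<le> nat m then Complex (v (\<lambda>y. Re (coeff (H y) k))) (v (\<lambda>y. Im (coeff (H y) k))) else 0)"
    for v and H :: "'a \<Rightarrow> complex poly" and k
    by (simp add: tderiv_def coeff_sum)
  have n: "msmooth_near G x (\<lambda>y. Re (coeff (F y) k))" "msmooth_near G x (\<lambda>y. Im (coeff (F y) k))" for k
    using msmooth_near_Re_Im[OF msmooth_nearI[OF smooth_polyD(1)[OF F] x smooth_polyD(3)[OF F]]] by blast+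
  show ?thesis
    by (rule poly_eqI) (simp add: c bracket_def n complex_eq_iff)
qed

text \<open>The term \<open>\<rho>\<^sub>*([\<omega>\<^sub>a, \<omega>\<^sub>b])\<close> arises because \<open>\<rho>\<^sub>*(\<omega>\<^sub>b)\<close> is written in the constant Clifford maps of the axes, which are
only parallel together with the frame.\<close>
lemma cov_loc_cov_loc:
  assumes s: "(U, \<sigma>) \<in> lsecs G" and F: "smooth_poly m W F" and W: "W \<subseteq> U" and x: "x \<in> W"
  shows "cov_loc \<sigma> m x (cfr \<sigma> a x) (\<lambda>y. cov_loc \<sigma> m y (cfr \<sigma> b y) F)
    = tderiv m (cfr \<sigma> a x) (\<lambda>y. tderiv m (cfr \<sigma> b y) F)
      + dL (of_int m) (su2 (omega \<sigma> a x)) (tderiv m (cfr \<sigma> b x) F)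
      + dL (of_int m) (su2 (vderiv (cfr \<sigma> a x) (omega \<sigma> b))) (F x)
      + dL (of_int m) (su2 (omega \<sigma> b x)) (cov_loc \<sigma> m x (cfr \<sigma> a x) F)
      + dL (of_int m) (su2 (ad (omega \<sigma> a x) (omega \<sigma> b x))) (F x)"
proof -
  let ?\<mu> = "of_int m :: complex" and ?v = "cfr \<sigma> a x"
  have xU: "x \<in> U" using x W by blast
  note o = smooth_polyD(1)[OF F] and v = gauge_tangent[OF s xU] and xV = smooth_polyD(2)[OF F x]
  note sm = msmooth_subset[OF omega_smooth[OF s xU] W]
  have d1: "smooth_poly m W (\<lambda>y. tderiv m (cfr \<sigma> b y) F)"
    by (rule tderiv_smooth[OF F VF_subset[OF frm_VF[OF s] W]])
  have e: "dL ?\<mu> (su2 (omega \<sigma> b y)) p = (\<Sum>k\<in>UNIV. smult (of_real (omega \<sigma> b y $ k)) (cliff_zero m (axis k 1) p))"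
    if "p \<in> Vpoly m" for y p
    by (simp add: dL_su2 cliff_zero_eq[OF that] su2_axis)
  have dk: "smooth_poly m W (\<lambda>y. cliff_zero m (axis k 1) (F y))" for k
    by (rule smooth_poly_linop[OF cliffordD(1)[OF clifford_zero] cliffordD(2)[OF clifford_zero] F])
  have d2: "smooth_poly m W (\<lambda>y. \<Sum>k\<in>UNIV. smult (of_real (omega \<sigma> b y $ k)) (cliff_zero m (axis k 1) (F y)))"
    by (rule smooth_poly_sum[OF o smooth_poly_rscale[OF dk sm]])
  have "cov_loc \<sigma> m x ?v (\<lambda>y. \<Sum>k\<in>UNIV. smult (of_real (omega \<sigma> b y $ k)) (cliff_zero m (axis k 1) (F y)))
      = (\<Sum>k\<in>UNIV. smult (of_real (vderiv ?v (omega \<sigma> b) $ k)) (cliff_zero m (axis k 1) (F x))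
        + smult (of_real (omega \<sigma> b x $ k)) (cliff_zero m (axis k 1) (cov_loc \<sigma> m x ?v F)
            + cliff_zero m (ad (omega \<sigma> a x) (axis k 1)) (F x)))"
    unfolding cov_loc_sum[OF o smooth_poly_rscale[OF dk sm] x v] cov_loc_rscale[OF dk sm x v] cov_loc_clifford[OF clifford_zero F x v]
    by (simp add: vderiv_def omega_def)
  also have "\<dots> = (\<Sum>k\<in>UNIV. smult (of_real (vderiv ?v (omega \<sigma> b) $ k)) (dL ?\<mu> (sigma k) (F x)))
      + (\<Sum>k\<in>UNIV. smult (of_real (omega \<sigma> b x $ k)) (dL ?\<mu> (sigma k) (cov_loc \<sigma> m x ?v F)))
      + (\<Sum>k\<in>UNIV. smult (of_real (omega \<sigma> b x $ k)) (dL ?\<mu> (su2 (ad (omega \<sigma> a x) (axis k 1))) (F x)))"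
    by (simp add: cliff_zero_eq[OF xV] cliff_zero_eq[OF cov_loc_Vpoly[OF F x v]] su2_axis smult_add_right sum.distrib)
  also have "(\<Sum>k\<in>UNIV. smult (of_real (omega \<sigma> b x $ k)) (dL ?\<mu> (su2 (ad (omega \<sigma> a x) (axis k 1))) (F x)))
      = dL ?\<mu> (su2 (ad (omega \<sigma> a x) (omega \<sigma> b x))) (F x)"
    by (subst (2) ad_axis_sum) (simp add: sum_3 su2_add su2_scaleR op_matrix_linear)
  finally have n2: "cov_loc \<sigma> m x ?v (\<lambda>y. \<Sum>k\<in>UNIV. smult (of_real (omega \<sigma> b y $ k)) (cliff_zero m (axis k 1) (F y)))
      = dL ?\<mu> (su2 (vderiv ?v (omega \<sigma> b))) (F x) + dL ?\<mu> (su2 (omega \<sigma> b x)) (cov_loc \<sigma> m x ?v F)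
      + dL ?\<mu> (su2 (ad (omega \<sigma> a x) (omega \<sigma> b x))) (F x)"
    by (simp only: dL_su2[symmetric])
  have "cov_loc \<sigma> m x ?v (\<lambda>y. cov_loc \<sigma> m y (cfr \<sigma> b y) F) = cov_loc \<sigma> m x ?v (\<lambda>y. tderiv m (cfr \<sigma> b y) F
      + (\<Sum>k\<in>UNIV. smult (of_real (omega \<sigma> b y $ k)) (cliff_zero m (axis k 1) (F y))))"
    by (rule cov_loc_cong[OF o x v]) (simp add: cov_loc_def e[OF smooth_polyD(2)[OF F], symmetric], simp add: omega_def)
  also have "\<dots> = cov_loc \<sigma> m x ?v (\<lambda>y. tderiv m (cfr \<sigma> b y) F)
      + (dL ?\<mu> (su2 (vderiv ?v (omega \<sigma> b))) (F x) + dL ?\<mu> (su2 (omega \<sigma> b x)) (cov_loc \<sigma> m x ?v F)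
      + dL ?\<mu> (su2 (ad (omega \<sigma> a x) (omega \<sigma> b x))) (F x))"
    unfolding cov_loc_add[OF d1 d2 x v] n2 ..
  also have "cov_loc \<sigma> m x ?v (\<lambda>y. tderiv m (cfr \<sigma> b y) F)
      = tderiv m ?v (\<lambda>y. tderiv m (cfr \<sigma> b y) F) + dL ?\<mu> (su2 (omega \<sigma> a x)) (tderiv m (cfr \<sigma> b x) F)"
    by (simp add: cov_loc_def omega_def)
  finally show ?thesis by (simp only: add.assoc)
qed

text \<open>The Ricci identity. The same combination of \<open>\<omega>\<close> and its derivatives as in \<open>curvature_cfr\<close> appears, with \<open>\<rho>\<^sub>*\<close> in place
of \<open>ad\<close>, because \<open>\<rho>\<^sub>*\<close> is a homomorphism of Lie algebras.\<close>
lemma hess_commutator: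
  assumes s: "(U, \<sigma>) \<in> lsecs G" and F: "smooth_poly m W F" and W: "W \<subseteq> U" and x: "x \<in> W"
  shows "hess \<sigma> m F x i j - hess \<sigma> m F x j i
    = dL (of_int m) (su2 (curv \<sigma> x (axis i 1) (axis j 1))) (F x)"
proof -
  let ?\<mu> = "of_int m :: complex" and ?a = "axis i 1 :: real^3" and ?b = "axis j 1 :: real^3"
  have xU: "x \<in> U" using x W by blast
  let ?T = "ad (omega \<sigma> ?a x) ?b - ad (omega \<sigma> ?b x) ?a"
  have br: "(\<Sum>k\<in>UNIV. smult (of_real (ad (omega \<sigma> ?a x) ?b $ k)) (cov_loc \<sigma> m x (lfr \<sigma> k x) F))
      - (\<Sum>k\<in>UNIV. smult (of_real (ad (omega \<sigma> ?b x) ?a $ k)) (cov_loc \<sigma> m x (lfr \<sigma> k x) F))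
      = tderiv m (bracket G (lfr \<sigma> i) (lfr \<sigma> j) x) F + dL ?\<mu> (su2 (omega \<sigma> ?T x)) (F x)"
  proof -
    have "(\<Sum>k\<in>UNIV. smult (of_real (ad (omega \<sigma> ?a x) ?b $ k)) (cov_loc \<sigma> m x (lfr \<sigma> k x) F))
      - (\<Sum>k\<in>UNIV. smult (of_real (ad (omega \<sigma> ?b x) ?a $ k)) (cov_loc \<sigma> m x (lfr \<sigma> k x) F))
      = (\<Sum>k\<in>UNIV. smult (of_real (?T $ k)) (cov_loc \<sigma> m x (lfr \<sigma> k x) F))"
      by (simp add: sum_subtractf smult_diff_left)
    also have "\<dots> = cov_loc \<sigma> m x (frm G (\<sigma> x) ?T) F" by (rule cov_loc_linear[OF s xU, symmetric])
    finally show ?thesis unfolding bracket_cfr[OF s xU] by (simp only: cov_loc_def omega_def)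
  qed
  have w: "dL ?\<mu> (su2 (omega \<sigma> ?a x)) (dL ?\<mu> (su2 (omega \<sigma> ?b x)) (F x))
      - dL ?\<mu> (su2 (omega \<sigma> ?b x)) (dL ?\<mu> (su2 (omega \<sigma> ?a x)) (F x)) = dL ?\<mu> (su2 (ad (omega \<sigma> ?a x) (omega \<sigma> ?b x))) (F x)"
    by (simp add: weyl_relations(5) su2_ad)
  have sk: "ad (omega \<sigma> ?b x) (omega \<sigma> ?a x) = 0 - ad (omega \<sigma> ?a x) (omega \<sigma> ?b x)"
    by (simp add: ad_eq cross_skew[of "omega \<sigma> ?b x" "omega \<sigma> ?a x"])
  have n: "cov_loc \<sigma> m x (lfr \<sigma> k x) F = tderiv m (lfr \<sigma> k x) F + dL ?\<mu> (su2 (omega \<sigma> (axis k 1) x)) (F x)" for k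
    by (simp add: cov_loc_def omega_def)
  have z: "dL ?\<mu> (su2 0) p = 0" for p by (simp add: dL_su2)
  have "hess \<sigma> m F x i j - hess \<sigma> m F x j i
     = cov_loc \<sigma> m x (lfr \<sigma> i x) (\<lambda>y. cov_loc \<sigma> m y (lfr \<sigma> j y) F) - cov_loc \<sigma> m x (lfr \<sigma> j x) (\<lambda>y. cov_loc \<sigma> m y (lfr \<sigma> i y) F)
      - ((\<Sum>k\<in>UNIV. smult (of_real (ad (omega \<sigma> ?a x) ?b $ k)) (cov_loc \<sigma> m x (lfr \<sigma> k x) F))
      - (\<Sum>k\<in>UNIV. smult (of_real (ad (omega \<sigma> ?b x) ?a $ k)) (cov_loc \<sigma> m x (lfr \<sigma> k x) F)))"
    by (simp add: hess_def omega_def)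
  also have "\<dots> = dL ?\<mu> (su2 (vderiv (lfr \<sigma> i x) (omega \<sigma> ?b))) (F x) - dL ?\<mu> (su2 (vderiv (lfr \<sigma> j x) (omega \<sigma> ?a))) (F x)
      + dL ?\<mu> (su2 (ad (omega \<sigma> ?a x) (omega \<sigma> ?b x))) (F x) - dL ?\<mu> (su2 (omega \<sigma> ?T x)) (F x)"
    unfolding br cov_loc_cov_loc[OF s F W x] tderiv_bracket[OF F x, of "lfr \<sigma> i" "lfr \<sigma> j", symmetric] n[of i] n[of j] sk dL_su2_linear z
      linop_add[OF linop_dL] w[symmetric]
    by simp
  also have "\<dots> = dL ?\<mu> (su2 (curv \<sigma> x ?a ?b)) (F x)"
    by (simp add: curv_def dL_su2_linear)
  finally show ?thesis .
qed

end


section \<open>The Weitzenboeck formulas\<close>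

lemma ad_axis:
  "ad (axis i 1) (axis i 1) = 0 *\<^sub>R axis i 1"
  "ad (axis 1 1) (axis 2 1) = 2 *\<^sub>R axis 3 1" "ad (axis 2 1) (axis 1 1) = (- 2) *\<^sub>R axis 3 1"
  "ad (axis 2 1) (axis 3 1) = 2 *\<^sub>R axis 1 1" "ad (axis 3 1) (axis 2 1) = (- 2) *\<^sub>R axis 1 1"
  "ad (axis 3 1) (axis 1 1) = 2 *\<^sub>R axis 2 1" "ad (axis 1 1) (axis 3 1) = (- 2) *\<^sub>R axis 2 1"
  by (simp_all add: ad_eq cross3_def axis_def vector_def vec_eq_iff forall_3)

text \<open>Contraction of a skew coefficient with the commutators of the Hessian; the factor \<open>2\<close> from \<open>ad\<close>, which is twice the cross
product, cancels the \<open>1/2\<close> of the curvature.\<close>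
lemma antisymmetric_contraction:
  fixes D :: "real^3 \<Rightarrow> complex poly \<Rightarrow> complex poly" and H :: "3 \<Rightarrow> 3 \<Rightarrow> complex poly"
  assumes D: "\<And>a Y p. D (a *\<^sub>R Y) p = smult (of_real a) (D Y p)" "\<And>Y. linop (D Y)"
    and H: "H 1 2 - H 2 1 = smult (of_real (- c / 2)) (q 3)" "H 2 3 - H 3 2 = smult (of_real (- c / 2)) (q 1)"
      "H 3 1 - H 1 3 = smult (of_real (- c / 2)) (q 2)"
  shows "(\<Sum>i\<in>UNIV. \<Sum>j\<in>UNIV. D (ad (axis i 1) (axis j 1)) (H i j))
    = smult (of_real (- c)) (\<Sum>k\<in>UNIV. D (axis k 1) (q k))"
proof -
  have "(\<Sum>i\<in>UNIV. \<Sum>j\<in>UNIV. D (ad (axis i 1) (axis j 1)) (H i j))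
     = smult 2 (D (axis 3 1) (H 1 2 - H 2 1) + D (axis 1 1) (H 2 3 - H 3 2) + D (axis 2 1) (H 3 1 - H 1 3))"
    unfolding sum_3 ad_axis D(1) linop_diff[OF D(2)] by (simp add: smult_add_right smult_diff_right)
  also have "\<dots> = smult (of_real (- c)) (\<Sum>k\<in>UNIV. D (axis k 1) (q k))"
    unfolding H linop_smult[OF D(2)] sum_3 by (simp add: smult_add_right smult_diff_right)
  finally show ?thesis .
qed

context
  fixes H :: "3 \<Rightarrow> 3 \<Rightarrow> complex poly" and \<mu> :: complex and c :: real and f :: "complex poly"
  assumes H: "H 1 2 - H 2 1 = smult (of_real (- c / 2)) (dL \<mu> (su2 (axis 3 1)) f)"
    "H 2 3 - H 3 2 = smult (of_real (- c / 2)) (dL \<mu> (su2 (axis 1 1)) f)"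
    "H 3 1 - H 1 3 = smult (of_real (- c / 2)) (dL \<mu> (su2 (axis 2 1)) f)"
begin

lemma contraction_dL:
  "(\<Sum>i\<in>UNIV. \<Sum>j\<in>UNIV. dL \<mu> (su2 (ad (axis i 1) (axis j 1))) (H i j)) = smult (of_real c * \<mu> * (\<mu> + 2)) f"
  using antisymmetric_contraction[of "\<lambda>Y. dL \<mu> (su2 Y)" H c "\<lambda>k. dL \<mu> (su2 (axis k 1)) f", OF _ linop_dL H]
  by (simp add: su2_scaleR op_matrix_linear casimir mult.assoc)

lemma contraction_dP:
  "(\<Sum>i\<in>UNIV. \<Sum>j\<in>UNIV. dP (su2 (ad (axis i 1) (axis j 1))) (H i j)) = 0"
  using antisymmetric_contraction[of "\<lambda>Y. dP (su2 Y)" H c "\<lambda>k. dL \<mu> (su2 (axis k 1)) f", OF _ linop_dP H]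
  by (simp add: su2_scaleR op_matrix_linear casimir)

lemma contraction_dN:
  "(\<Sum>i\<in>UNIV. \<Sum>j\<in>UNIV. dN \<mu> (su2 (ad (axis i 1) (axis j 1))) (H i j)) = 0"
  using antisymmetric_contraction[of "\<lambda>Y. dN \<mu> (su2 Y)" H c "\<lambda>k. dL \<mu> (su2 (axis k 1)) f", OF _ linop_dN H]
  by (simp add: su2_scaleR op_matrix_linear casimir)

lemma smult_sums: "(\<Sum>i\<in>UNIV. \<Sum>j\<in>UNIV. smult a (F i j)) = smult a (\<Sum>i\<in>UNIV. \<Sum>j\<in>UNIV. F i j)"
  for F :: "3 \<Rightarrow> 3 \<Rightarrow> complex poly"
  by (simp add: sum_3 smult_add_right)

lemma trace_sum: "(\<Sum>i\<in>UNIV. \<Sum>j\<in>UNIV. smult (a * of_real (axis i 1 \<bullet> (axis j 1 :: real^3))) (H i j))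
   = smult a (\<Sum>j\<in>UNIV. H j j)"
  by (simp add: sum_3 inner_axis_axis smult_add_right)

lemma contraction_Delta:
  "(\<Sum>i\<in>UNIV. \<Sum>j\<in>UNIV. dL \<mu> (su2 (axis i 1)) (dL \<mu> (su2 (axis j 1)) (H i j))
      + dP (su2 (axis i 1)) (dN \<mu> (su2 (axis j 1)) (H i j)))
   = smult (\<mu>\<^sup>2) (- (\<Sum>j\<in>UNIV. H j j)) + smult (\<mu>\<^sup>2 * (\<mu> + 2) / 2 * of_real c) f"
proof -
  have "(\<Sum>i\<in>UNIV. \<Sum>j\<in>UNIV. dL \<mu> (su2 (axis i 1)) (dL \<mu> (su2 (axis j 1)) (H i j))
      + dP (su2 (axis i 1)) (dN \<mu> (su2 (axis j 1)) (H i j)))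
    = (\<Sum>i\<in>UNIV. \<Sum>j\<in>UNIV. smult (- \<mu>\<^sup>2 * of_real (axis i 1 \<bullet> (axis j 1 :: real^3))) (H i j))
      + (\<Sum>i\<in>UNIV. \<Sum>j\<in>UNIV. smult (\<mu> / 2) (dL \<mu> (su2 (ad (axis i 1) (axis j 1))) (H i j)))"
    by (simp add: weyl_relations(1) tr2_su2_su2 su2_ad[symmetric] sum.distrib sum_subtractf sum_negf)
  also have "\<dots> = smult (\<mu>\<^sup>2) (- (\<Sum>j\<in>UNIV. H j j)) + smult (\<mu>\<^sup>2 * (\<mu> + 2) / 2 * of_real c) f"
    unfolding trace_sum smult_sums contraction_dL by (simp add: power2_eq_square mult_ac)
  finally show ?thesis .
qed

lemma contraction_Delta_tilde:
  "(\<Sum>i\<in>UNIV. \<Sum>j\<in>UNIV. dL \<mu> (su2 (axis i 1)) (dL \<mu> (su2 (axis j 1)) (H i j))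
      + dN (\<mu> + 2) (su2 (axis i 1)) (dP (su2 (axis j 1)) (H i j)))
   = smult ((\<mu> + 2)\<^sup>2) (- (\<Sum>j\<in>UNIV. H j j)) - smult (\<mu> * (\<mu> + 2)\<^sup>2 / 2 * of_real c) f"
proof -
  have "(\<Sum>i\<in>UNIV. \<Sum>j\<in>UNIV. dL \<mu> (su2 (axis i 1)) (dL \<mu> (su2 (axis j 1)) (H i j))
      + dN (\<mu> + 2) (su2 (axis i 1)) (dP (su2 (axis j 1)) (H i j)))
    = (\<Sum>i\<in>UNIV. \<Sum>j\<in>UNIV. smult (- (\<mu> + 2)\<^sup>2 * of_real (axis i 1 \<bullet> (axis j 1 :: real^3))) (H i j))
      - (\<Sum>i\<in>UNIV. \<Sum>j\<in>UNIV. smult ((\<mu> + 2) / 2) (dL \<mu> (su2 (ad (axis i 1) (axis j 1))) (H i j)))"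
    by (simp add: weyl_relations(2) tr2_su2_su2 su2_ad[symmetric] sum_subtractf sum_negf)
  also have "\<dots> = smult ((\<mu> + 2)\<^sup>2) (- (\<Sum>j\<in>UNIV. H j j)) - smult (\<mu> * (\<mu> + 2)\<^sup>2 / 2 * of_real c) f"
    unfolding trace_sum smult_sums contraction_dL by (simp add: power2_eq_square mult_ac)
  finally show ?thesis .
qed

lemma contraction_plus:
  "(\<Sum>i\<in>UNIV. \<Sum>j\<in>UNIV. dL (\<mu> + 2) (su2 (axis i 1)) (dP (su2 (axis j 1)) (H i j))
      - dP (su2 (axis i 1)) (dL \<mu> (su2 (axis j 1)) (H i j))) = 0"
  by (simp add: weyl_relations(3) su2_ad[symmetric] smult_sums contraction_dP)

lemma contraction_minus:
  "(\<Sum>i\<in>UNIV. \<Sum>j\<in>UNIV. dL (\<mu> - 2) (su2 (axis i 1)) (dN \<mu> (su2 (axis j 1)) (H i j))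
      - dN \<mu> (su2 (axis i 1)) (dL \<mu> (su2 (axis j 1)) (H i j))) = 0"
  by (simp add: weyl_relations(4) su2_ad[symmetric] smult_sums contraction_dN del: smult_minus_left)

end

context spin3 begin

lemma sections_iff: "s \<in> sections G m \<longleftrightarrow> lsection m M s"
proof -
  have "U \<inter> M = U" if "(U, \<sigma>) \<in> lsecs G" for U \<sigma>
    using openin_subset[OF lsec_open[OF that]] by blast
  then show ?thesis
    unfolding sections_def lsection_def by auto
qed

text \<open>By equivariance, sections agree at \<open>x\<close> as soon as their values in one gauge agree at \<open>x\<close>.\<close>
lemma section_eqI:
  assumes "\<And>x. x \<in> M \<Longrightarrow> A x \<in> fibre G k x" "\<And>x. x \<in> M \<Longrightarrow> B x \<in> fibre G k x"
    and "\<And>x U \<sigma>. x \<in> M \<Longrightarrow> (U, \<sigma>) \<in> lsecs G \<Longrightarrow> x \<in> U \<Longrightarrow> val (A x) (\<sigma> x) = val (B x) (\<sigma> x)"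
  shows "section_eq G A B"
  unfolding section_eq_def
proof
  fix x assume x: "x \<in> M"
  then obtain U \<sigma> where g: "(U, \<sigma>) \<in> lsecs G" "x \<in> U" by (rule lsec_cover)
  show "A x = B x"
    by (rule fibre_eqI[OF assms(1,2)[OF x] lsec_spin[OF g] lsec_proj[OF g] assms(3)[OF x g]])
qed

context
  fixes m :: int and s :: "('a, 'p) section_S" and c :: real
  assumes s: "s \<in> sections G m" and K: "constant_sectional_curvature G c"
begin

lemma s_lsection: "lsection m M s"
  using s by (simp add: sections_iff)

lemma curvature_of_hess:
  assumes g: "(U, \<sigma>) \<in> lsecs G" and x: "x \<in> U"
  shows "hess \<sigma> m (loc s \<sigma>) x 1 2 - hess \<sigma> m (loc s \<sigma>) x 2 1
      = smult (of_real (- c / 2)) (dL (of_int m) (su2 (axis 3 1)) (loc s \<sigma> x))"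
    and "hess \<sigma> m (loc s \<sigma>) x 2 3 - hess \<sigma> m (loc s \<sigma>) x 3 2
      = smult (of_real (- c / 2)) (dL (of_int m) (su2 (axis 1 1)) (loc s \<sigma> x))"
    and "hess \<sigma> m (loc s \<sigma>) x 3 1 - hess \<sigma> m (loc s \<sigma>) x 1 3
      = smult (of_real (- c / 2)) (dL (of_int m) (su2 (axis 2 1)) (loc s \<sigma> x))"
proof -
  have x': "x \<in> U \<inter> M" using x openin_subset[OF lsec_open[OF g]] by blast
  note h = hess_commutator[OF g lsection_smooth_poly[OF s_lsection g] Int_lower1 x']
  show "hess \<sigma> m (loc s \<sigma>) x 1 2 - hess \<sigma> m (loc s \<sigma>) x 2 1
      = smult (of_real (- c / 2)) (dL (of_int m) (su2 (axis 3 1)) (loc s \<sigma> x))"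
    "hess \<sigma> m (loc s \<sigma>) x 2 3 - hess \<sigma> m (loc s \<sigma>) x 3 2
      = smult (of_real (- c / 2)) (dL (of_int m) (su2 (axis 1 1)) (loc s \<sigma> x))"
    "hess \<sigma> m (loc s \<sigma>) x 3 1 - hess \<sigma> m (loc s \<sigma>) x 1 3
      = smult (of_real (- c / 2)) (dL (of_int m) (su2 (axis 2 1)) (loc s \<sigma> x))"
    unfolding h curv_constant[OF g x K] su2_scaleR op_matrix_linear by (rule refl)+
qed

lemma hess_in_Vpoly: "(U, \<sigma>) \<in> lsecs G \<Longrightarrow> x \<in> U \<Longrightarrow> hess \<sigma> m (loc s \<sigma>) x i j \<in> Vpoly m"
  by (rule hess_Vpoly[OF lsection_smooth_poly[OF s_lsection] _ Int_lower1])
    (use openin_subset[OF lsec_open] in blast)+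

lemma dirac_dirac_fibre:
  assumes "clifford m m' b" "clifford m' m'' a" "x \<in> M"
  shows "dirac a m' (dirac b m s) x \<in> fibre G m'' x"
  by (rule lsectionD(2)[OF dirac_lsection[OF dirac_lsection[OF s_lsection assms(1)] assms(2)] assms(3)])

lemmas clifford_minus_plus = clifford_plus[of "m - 2", unfolded diff_add_cancel]
lemmas clifford_plus_minus = clifford_minus[of "m + 2", unfolded add_diff_cancel_right']

lemma Delta_formula:
  "section_eq G (D_zero G m (D_zero G m s) \<oplus> D_plus G (m - 2) (D_minus G m s))
      ((real_of_int m)\<^sup>2 \<odot> connection_laplacian G m s
        \<oplus> ((real_of_int m)\<^sup>2 * (real_of_int m + 2) / 2 * c) \<odot> s)"
  unfolding D_dirac sadd_def sscale_def
proof (rule section_eqI)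
  fix x assume x: "x \<in> M"
  note f1 = dirac_dirac_fibre[OF clifford_zero clifford_zero x] dirac_dirac_fibre[OF clifford_minus clifford_minus_plus x]
  show "fadd (dirac (cliff_zero m) m (dirac (cliff_zero m) m s) x)
      (dirac (cliff_plus (m - 2)) (m - 2) (dirac (cliff_minus m) m s) x) \<in> fibre G m x"
    by (rule fadd_fibre(1)[OF f1])
  obtain V \<tau> where "(V, \<tau>) \<in> lsecs G" "x \<in> V" using lsec_cover[OF x] .
  note lap = laplacian_val(1)[OF s_lsection this x]
  note f2 = fscale_fibre[OF lap] fscale_fibre[OF lsectionD(2)[OF s_lsection x]]
  show "fadd (fscale (of_real ((real_of_int m)\<^sup>2)) (connection_laplacian G m s x))
      (fscale (of_real ((real_of_int m)\<^sup>2 * (real_of_int m + 2) / 2 * c)) (s x)) \<in> fibre G m x"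
    by (intro fadd_fibre(1) f2(1,3))
  fix U \<sigma> assume g: "(U, \<sigma>) \<in> lsecs G" "x \<in> U"
  note p = lsec_spin[OF g] lsec_proj[OF g]
  note V = hess_in_Vpoly[OF g]
  show "val (fadd (dirac (cliff_zero m) m (dirac (cliff_zero m) m s) x)
      (dirac (cliff_plus (m - 2)) (m - 2) (dirac (cliff_minus m) m s) x)) (\<sigma> x)
    = val (fadd (fscale (of_real ((real_of_int m)\<^sup>2)) (connection_laplacian G m s x))
      (fscale (of_real ((real_of_int m)\<^sup>2 * (real_of_int m + 2) / 2 * c)) (s x))) (\<sigma> x)"
    unfolding fadd_fibre(2)[OF f1 p] fadd_fibre(2)[OF f2(1) f2(3) p] f2(2)[OF p] f2(4)[OF p]
      dirac_dirac_val[OF s_lsection clifford_zero clifford_zero g x] dirac_dirac_val[OF s_lsection clifford_minus clifford_minus_plus g x]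
      laplacian_val(2)[OF s_lsection g x]
    using contraction_Delta[OF curvature_of_hess[OF g]]
    by (simp add: cliff_zero_eq[OF V] cliff_minus_eq[OF V] cliff_zero_eq[OF dL_Vpoly[OF V]]
        cliff_plus_eq[OF dN_Vpoly[OF V]] sum.distrib)
qed

lemma Delta_tilde_formula:
  "section_eq G (D_zero G m (D_zero G m s) \<oplus> D_minus G (m + 2) (D_plus G m s))
      ((real_of_int m + 2)\<^sup>2 \<odot> connection_laplacian G m s
        \<ominus> (real_of_int m * (real_of_int m + 2)\<^sup>2 / 2 * c) \<odot> s)"
  unfolding D_dirac sadd_def ssub_def sscale_def
proof (rule section_eqI)
  fix x assume x: "x \<in> M"
  note f1 = dirac_dirac_fibre[OF clifford_zero clifford_zero x] dirac_dirac_fibre[OF clifford_plus clifford_plus_minus x]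
  show "fadd (dirac (cliff_zero m) m (dirac (cliff_zero m) m s) x)
      (dirac (cliff_minus (m + 2)) (m + 2) (dirac (cliff_plus m) m s) x) \<in> fibre G m x"
    by (rule fadd_fibre(1)[OF f1])
  obtain V \<tau> where "(V, \<tau>) \<in> lsecs G" "x \<in> V" using lsec_cover[OF x] .
  note lap = laplacian_val(1)[OF s_lsection this x]
  note f2 = fscale_fibre[OF lap] fscale_fibre[OF lsectionD(2)[OF s_lsection x]]
  show "fsub (fscale (of_real ((real_of_int m + 2)\<^sup>2)) (connection_laplacian G m s x))
      (fscale (of_real (real_of_int m * (real_of_int m + 2)\<^sup>2 / 2 * c)) (s x)) \<in> fibre G m x"
    by (intro fsub_fibre(1) f2(1,3))
  fix U \<sigma> assume g: "(U, \<sigma>) \<in> lsecs G" "x \<in> U"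
  note p = lsec_spin[OF g] lsec_proj[OF g]
  note V = hess_in_Vpoly[OF g]
  show "val (fadd (dirac (cliff_zero m) m (dirac (cliff_zero m) m s) x)
      (dirac (cliff_minus (m + 2)) (m + 2) (dirac (cliff_plus m) m s) x)) (\<sigma> x)
    = val (fsub (fscale (of_real ((real_of_int m + 2)\<^sup>2)) (connection_laplacian G m s x))
      (fscale (of_real (real_of_int m * (real_of_int m + 2)\<^sup>2 / 2 * c)) (s x))) (\<sigma> x)"
    unfolding fadd_fibre(2)[OF f1 p] fsub_fibre(2)[OF f2(1) f2(3) p] f2(2)[OF p] f2(4)[OF p]
      dirac_dirac_val[OF s_lsection clifford_zero clifford_zero g x] dirac_dirac_val[OF s_lsection clifford_plus clifford_plus_minus g x]
      laplacian_val(2)[OF s_lsection g x]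
    using contraction_Delta_tilde[OF curvature_of_hess[OF g]]
    by (simp add: cliff_zero_eq[OF V] cliff_plus_eq[OF V] cliff_zero_eq[OF dL_Vpoly[OF V]]
        cliff_minus_eq[OF dP_Vpoly[OF V]] sum.distrib)
qed

lemma plus_val:
  assumes x: "x \<in> M" and g: "(U, \<sigma>) \<in> lsecs G" "x \<in> U"
  shows "val (dirac (cliff_zero (m + 2)) (m + 2) (dirac (cliff_plus m) m s) x) (\<sigma> x)
    = val (dirac (cliff_plus m) m (dirac (cliff_zero m) m s) x) (\<sigma> x)"
proof -
  note V = hess_in_Vpoly[OF g]
  show ?thesis
    unfolding dirac_dirac_val[OF s_lsection clifford_plus clifford_zero g x] dirac_dirac_val[OF s_lsection clifford_zero clifford_plus g x]
    using contraction_plus[OF curvature_of_hess[OF g]]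
    by (simp add: cliff_zero_eq[OF V] cliff_plus_eq[OF V] cliff_zero_eq[OF dP_Vpoly[OF V]]
        cliff_plus_eq[OF dL_Vpoly[OF V]] sum_subtractf)
qed

lemma minus_val:
  assumes x: "x \<in> M" and g: "(U, \<sigma>) \<in> lsecs G" "x \<in> U"
  shows "val (dirac (cliff_zero (m - 2)) (m - 2) (dirac (cliff_minus m) m s) x) (\<sigma> x)
    = val (dirac (cliff_minus m) m (dirac (cliff_zero m) m s) x) (\<sigma> x)"
proof -
  note V = hess_in_Vpoly[OF g]
  show ?thesis
    unfolding dirac_dirac_val[OF s_lsection clifford_minus clifford_zero g x] dirac_dirac_val[OF s_lsection clifford_zero clifford_minus g x]
    using contraction_minus[OF curvature_of_hess[OF g]]
    by (simp add: cliff_zero_eq[OF V] cliff_minus_eq[OF V] cliff_zero_eq[OF dN_Vpoly[OF V]]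
        cliff_minus_eq[OF dL_Vpoly[OF V]] sum_subtractf)
qed

lemma D_zero_D_plus:
  "section_eq G (D_zero G (m + 2) (D_plus G m s)) (D_plus G m (D_zero G m s))"
  "section_eq G (D_zero G (m + 2) (D_plus G m s) \<ominus> D_plus G m (D_zero G m s)) (fzero G)"
proof -
  let ?A = "dirac (cliff_zero (m + 2)) (m + 2) (dirac (cliff_plus m) m s)"
  let ?B = "dirac (cliff_plus m) m (dirac (cliff_zero m) m s)"
  note A = dirac_dirac_fibre[OF clifford_plus clifford_zero] and B = dirac_dirac_fibre[OF clifford_zero clifford_plus]
  show "section_eq G (D_zero G (m + 2) (D_plus G m s)) (D_plus G m (D_zero G m s))"
    unfolding D_dirac
  proof (rule section_eqI)
    show "?A x \<in> fibre G (m + 2) x" "?B x \<in> fibre G (m + 2) x" if "x \<in> M" for x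
      by (rule A[OF that], rule B[OF that])
    show "val (?A x) (\<sigma> x) = val (?B x) (\<sigma> x)" if "x \<in> M" "(U, \<sigma>) \<in> lsecs G" "x \<in> U" for x U \<sigma>
      by (rule plus_val[OF that])
  qed
  show "section_eq G (D_zero G (m + 2) (D_plus G m s) \<ominus> D_plus G m (D_zero G m s)) (fzero G)"
    unfolding D_dirac ssub_def
  proof (rule section_eqI)
    show "fsub (?A x) (?B x) \<in> fibre G (m + 2) x" "fzero G x \<in> fibre G (m + 2) x" if "x \<in> M" for x
      by (rule fsub_fibre(1)[OF A[OF that] B[OF that]], rule fzero_fibre(1)[OF that])
    show "val (fsub (?A x) (?B x)) (\<sigma> x) = val (fzero G x) (\<sigma> x)"
      if x: "x \<in> M" and g: "(U, \<sigma>) \<in> lsecs G" "x \<in> U" for x U \<sigma>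
      unfolding fsub_fibre(2)[OF A[OF x] B[OF x] lsec_spin[OF g] lsec_proj[OF g]]
        fzero_fibre(2)[OF x lsec_spin[OF g] lsec_proj[OF g]] plus_val[OF x g] by simp
  qed
qed

lemma D_zero_D_minus:
  "section_eq G (D_zero G (m - 2) (D_minus G m s)) (D_minus G m (D_zero G m s))"
  "section_eq G (D_zero G (m - 2) (D_minus G m s) \<ominus> D_minus G m (D_zero G m s)) (fzero G)"
proof -
  let ?A = "dirac (cliff_zero (m - 2)) (m - 2) (dirac (cliff_minus m) m s)"
  let ?B = "dirac (cliff_minus m) m (dirac (cliff_zero m) m s)"
  note A = dirac_dirac_fibre[OF clifford_minus clifford_zero] and B = dirac_dirac_fibre[OF clifford_zero clifford_minus]
  show "section_eq G (D_zero G (m - 2) (D_minus G m s)) (D_minus G m (D_zero G m s))"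
    unfolding D_dirac
  proof (rule section_eqI)
    show "?A x \<in> fibre G (m - 2) x" "?B x \<in> fibre G (m - 2) x" if "x \<in> M" for x
      by (rule A[OF that], rule B[OF that])
    show "val (?A x) (\<sigma> x) = val (?B x) (\<sigma> x)" if "x \<in> M" "(U, \<sigma>) \<in> lsecs G" "x \<in> U" for x U \<sigma>
      by (rule minus_val[OF that])
  qed
  show "section_eq G (D_zero G (m - 2) (D_minus G m s) \<ominus> D_minus G m (D_zero G m s)) (fzero G)"
    unfolding D_dirac ssub_def
  proof (rule section_eqI)
    show "fsub (?A x) (?B x) \<in> fibre G (m - 2) x" "fzero G x \<in> fibre G (m - 2) x" if "x \<in> M" for x
      by (rule fsub_fibre(1)[OF A[OF that] B[OF that]], rule fzero_fibre(1)[OF that])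
    show "val (fsub (?A x) (?B x)) (\<sigma> x) = val (fzero G x) (\<sigma> x)"
      if x: "x \<in> M" and g: "(U, \<sigma>) \<in> lsecs G" "x \<in> U" for x U \<sigma>
      unfolding fsub_fibre(2)[OF A[OF x] B[OF x] lsec_spin[OF g] lsec_proj[OF g]]
        fzero_fibre(2)[OF x lsec_spin[OF g] lsec_proj[OF g]] minus_val[OF x g] by simp
  qed
qed

end

lemma dirac_section: "clifford m m' \<rho> \<Longrightarrow> s \<in> sections G m \<Longrightarrow> dirac \<rho> m s \<in> sections G m'"
  unfolding sections_iff by (rule dirac_lsection)

lemma dirac_cong:
  assumes c: "clifford m m' \<rho>" and s: "s \<in> sections G m" "t \<in> sections G m" and e: "section_eq G s t"
  shows "section_eq G (dirac \<rho> m s) (dirac \<rho> m t)"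
proof (rule section_eqI)
  note Ls = s(1)[unfolded sections_iff] note Lt = s(2)[unfolded sections_iff]
  show "dirac \<rho> m s x \<in> fibre G m' x" "dirac \<rho> m t x \<in> fibre G m' x" if "x \<in> M" for x
    using lsectionD(2)[OF dirac_lsection[OF Ls c] that] lsectionD(2)[OF dirac_lsection[OF Lt c] that] by auto
  fix x U \<sigma> assume x: "x \<in> M" and g: "(U, \<sigma>) \<in> lsecs G" "x \<in> U"
  have "cov_loc \<sigma> m x (lfr \<sigma> i x) (loc s \<sigma>) = cov_loc \<sigma> m x (lfr \<sigma> i x) (loc t \<sigma>)" for i
    by (rule cov_loc_cong[OF lsec_open[OF g(1)] g(2) lfr_tangent[OF g]])
      (use e openin_subset[OF lsec_open[OF g(1)]] in \<open>auto simp: section_eq_def\<close>)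
  then show "val (dirac \<rho> m s x) (\<sigma> x) = val (dirac \<rho> m t x) (\<sigma> x)"
    by (simp add: dirac_val(2)[OF Ls c g x] dirac_val(2)[OF Lt c g x])
qed

lemma sadd_section:
  assumes "s \<in> sections G m" "t \<in> sections G m"
  shows "s \<oplus> t \<in> sections G m"
  unfolding sections_iff
proof (rule lsectionI)
  note Ls = assms(1)[unfolded sections_iff] note Lt = assms(2)[unfolded sections_iff]
  note f = fadd_fibre[OF lsectionD(2)[OF Ls] lsectionD(2)[OF Lt]]
  show "opn M" by simp
  show "(s \<oplus> t) y \<in> fibre G m y" if "y \<in> M" for y unfolding sadd_def by (rule f(1)[OF that that])
  fix U \<sigma> assume g: "(U, \<sigma>) \<in> lsecs G"
  show "smooth_poly m (U \<inter> M) (loc (s \<oplus> t) \<sigma>)"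
    by (rule smooth_poly_cong[OF smooth_poly_add[OF lsection_smooth_poly[OF Ls g] lsection_smooth_poly[OF Lt g]]])
      (simp add: sadd_def f(2) lsec_spin[OF g] lsec_proj[OF g])
qed

lemma dirac_add:
  assumes c: "clifford m m' \<rho>" and s: "s \<in> sections G m" "t \<in> sections G m"
  shows "section_eq G (dirac \<rho> m (s \<oplus> t)) (dirac \<rho> m s \<oplus> dirac \<rho> m t)"
proof (rule section_eqI)
  note Ls = s(1)[unfolded sections_iff] note Lt = s(2)[unfolded sections_iff]
  note Lst = sadd_section[OF s, unfolded sections_iff]
  note f = fadd_fibre[OF lsectionD(2)[OF Ls] lsectionD(2)[OF Lt]]
  note fd = fadd_fibre[OF lsectionD(2)[OF dirac_lsection[OF Ls c]] lsectionD(2)[OF dirac_lsection[OF Lt c]]]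
  show "dirac \<rho> m (s \<oplus> t) x \<in> fibre G m' x" if "x \<in> M" for x
    by (rule lsectionD(2)[OF dirac_lsection[OF Lst c] that])
  show "(dirac \<rho> m s \<oplus> dirac \<rho> m t) x \<in> fibre G m' x" if "x \<in> M" for x
    unfolding sadd_def by (rule fd(1)[OF that that])
  fix x U \<sigma> assume x: "x \<in> M" and g: "(U, \<sigma>) \<in> lsecs G" "x \<in> U"
  note F = lsection_smooth_poly[OF Ls g(1)] and F' = lsection_smooth_poly[OF Lt g(1)]
  have xU: "x \<in> U \<inter> M" using x g by blast
  note l = lfr_tangent[OF g]
  have "cov_loc \<sigma> m x (lfr \<sigma> i x) (loc (s \<oplus> t) \<sigma>) = cov_loc \<sigma> m x (lfr \<sigma> i x) (\<lambda>y. loc s \<sigma> y + loc t \<sigma> y)" for i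
    by (rule cov_loc_cong[OF smooth_polyD(1)[OF F] xU l])
      (simp add: sadd_def f(2) lsec_spin[OF g(1)] lsec_proj[OF g(1)])
  then have "val (dirac \<rho> m (s \<oplus> t) x) (\<sigma> x) = val (dirac \<rho> m s x) (\<sigma> x) + val (dirac \<rho> m t x) (\<sigma> x)"
    by (simp add: dirac_val(2)[OF Lst c g x] cov_loc_add[OF F F' xU l] linop_add[OF cliffordD(1)[OF c]]
        dirac_val(2)[OF Ls c g x] dirac_val(2)[OF Lt c g x] sum.distrib)
  then show "val (dirac \<rho> m (s \<oplus> t) x) (\<sigma> x) = val ((dirac \<rho> m s \<oplus> dirac \<rho> m t) x) (\<sigma> x)"
    unfolding sadd_def[of "dirac \<rho> m s"] fd(2)[OF x x lsec_spin[OF g] lsec_proj[OF g]] .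
qed

lemma section_eq_trans: "section_eq G a b \<Longrightarrow> section_eq G b d \<Longrightarrow> section_eq G a d"
  and section_eq_sym: "section_eq G a b \<Longrightarrow> section_eq G b a"
  and section_eq_sadd: "section_eq G a b \<Longrightarrow> section_eq G a' b' \<Longrightarrow> section_eq G (a \<oplus> a') (b \<oplus> b')"
  by (simp_all add: section_eq_def sadd_def)

text \<open>Formal: \<open>A\<close> commutes with \<open>A\<^sup>2\<close> and \<open>Q\<close>, and \<open>Q\<close> commutes with \<open>A\<^sup>2\<close> and itself. Sections are only compared over
the manifold, so congruence of the operators for \<open>section_eq\<close> has to be assumed.\<close>
lemma commute_sum:
  assumes A: "\<And>s. s \<in> \<Gamma> \<Longrightarrow> A s \<in> \<Gamma>" "\<And>s t. s \<in> \<Gamma> \<Longrightarrow> t \<in> \<Gamma> \<Longrightarrow> section_eq G s t \<Longrightarrow> section_eq G (A s) (A t)"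
      "\<And>s t. s \<in> \<Gamma> \<Longrightarrow> t \<in> \<Gamma> \<Longrightarrow> section_eq G (A (s \<oplus> t)) (A s \<oplus> A t)"
    and Q: "\<And>s. s \<in> \<Gamma> \<Longrightarrow> Q s \<in> \<Gamma>" "\<And>s t. s \<in> \<Gamma> \<Longrightarrow> t \<in> \<Gamma> \<Longrightarrow> section_eq G s t \<Longrightarrow> section_eq G (Q s) (Q t)"
      "\<And>s t. s \<in> \<Gamma> \<Longrightarrow> t \<in> \<Gamma> \<Longrightarrow> section_eq G (Q (s \<oplus> t)) (Q s \<oplus> Q t)"
    and AQ: "\<And>s. s \<in> \<Gamma> \<Longrightarrow> section_eq G (A (Q s)) (Q (A s))"
    and s: "s \<in> \<Gamma>"
  shows "section_eq G (A (A (A s)) \<oplus> Q (A s)) (A (A (A s) \<oplus> Q s))"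
    and "section_eq G (A (A (Q s)) \<oplus> Q (Q s)) (Q (A (A s) \<oplus> Q s))"
proof -
  note A1 = A(1)[OF s] and Q1 = Q(1)[OF s]
  note A2 = A(1)[OF A1]
  have r: "section_eq G a a" for a by (simp add: section_eq_def)
  have "section_eq G (A (A (A s)) \<oplus> Q (A s)) (A (A (A s)) \<oplus> A (Q s))"
    by (rule section_eq_sadd[OF r section_eq_sym[OF AQ[OF s]]])
  then show "section_eq G (A (A (A s)) \<oplus> Q (A s)) (A (A (A s) \<oplus> Q s))"
    using section_eq_sym[OF A(3)[OF A2 Q1]] by (rule section_eq_trans)
  have "section_eq G (A (A (Q s))) (A (Q (A s)))"
    by (rule A(2)[OF A(1)[OF Q1] Q(1)[OF A1] AQ[OF s]])
  then have "section_eq G (A (A (Q s))) (Q (A (A s)))" using AQ[OF A1] by (rule section_eq_trans)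
  from section_eq_sadd[OF this r]
  show "section_eq G (A (A (Q s)) \<oplus> Q (Q s)) (Q (A (A s) \<oplus> Q s))"
    using section_eq_sym[OF Q(3)[OF A2 Q1]] by (rule section_eq_trans)
qed

text \<open>The operator \<open>b a\<close> commutes with \<open>D\<^sup>0\<close> because \<open>D\<^sup>0\<close> can be moved first past \<open>b\<close> and then past \<open>a\<close>.\<close>
lemma commute_dirac:
  assumes a: "clifford m m' a" and b: "clifford m' m b"
    and 1: "\<And>s. s \<in> sections G m \<Longrightarrow> section_eq G (D_zero G m' (dirac a m s)) (dirac a m (D_zero G m s))"
    and 2: "\<And>s. s \<in> sections G m' \<Longrightarrow> section_eq G (D_zero G m (dirac b m' s)) (dirac b m' (D_zero G m' s))"
    and s: "s \<in> sections G m"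
  defines "Q \<equiv> \<lambda>s. dirac b m' (dirac a m s)"
  shows "section_eq G (D_zero G m (D_zero G m (D_zero G m s)) \<oplus> Q (D_zero G m s)) (D_zero G m (D_zero G m (D_zero G m s) \<oplus> Q s))"
    and "section_eq G (D_zero G m (D_zero G m (Q s)) \<oplus> Q (Q s)) (Q (D_zero G m (D_zero G m s) \<oplus> Q s))"
proof -
  note sa = dirac_section[OF a] and sb = dirac_section[OF b]
  note z = dirac_section[OF clifford_zero]
  have Q1: "Q t \<in> sections G m" if "t \<in> sections G m" for t unfolding Q_def by (rule sb[OF sa[OF that]])
  have Q2: "section_eq G (Q t) (Q u)" if "t \<in> sections G m" "u \<in> sections G m" "section_eq G t u" for t u
    unfolding Q_def by (rule dirac_cong[OF b sa[OF that(1)] sa[OF that(2)] dirac_cong[OF a that]])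
  have Q3: "section_eq G (Q (t \<oplus> u)) (Q t \<oplus> Q u)" if "t \<in> sections G m" "u \<in> sections G m" for t u
    unfolding Q_def
    by (rule section_eq_trans[OF dirac_cong[OF b sa[OF sadd_section[OF that]]
            sadd_section[OF sa[OF that(1)] sa[OF that(2)]] dirac_add[OF a that]]
          dirac_add[OF b sa[OF that(1)] sa[OF that(2)]]])
  have AQ: "section_eq G (D_zero G m (Q t)) (Q (D_zero G m t))" if t: "t \<in> sections G m" for t
    unfolding Q_def
    by (rule section_eq_trans[OF 2[OF sa[OF t]]])
      (rule dirac_cong[OF b _ _ 1[OF t]], simp_all add: D_dirac sa z t)
  show "section_eq G (D_zero G m (D_zero G m (D_zero G m s)) \<oplus> Q (D_zero G m s)) (D_zero G m (D_zero G m (D_zero G m s) \<oplus> Q s))"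
    "section_eq G (D_zero G m (D_zero G m (Q s)) \<oplus> Q (Q s)) (Q (D_zero G m (D_zero G m s) \<oplus> Q s))"
    by (rule commute_sum[of "sections G m" "D_zero G m" Q];
        (rule Q1 Q2 Q3 AQ s | simp add: D_dirac z dirac_cong[OF clifford_zero] dirac_add[OF clifford_zero]); assumption?)+
qed

end

theorem proposition6p2:
  fixes G :: "('a, 'p) spin_manifold" and c :: real and m :: int
  assumes "oriented_riemannian_3manifold G"
    and "levi_civita_connection G"
    and "spin_structure G"
    and "constant_sectional_curvature G c"
    and "m \<ge> 0"
  shows "\<forall>s\<in>sections G m.
    section_eq G (D_zero G m (D_zero G m s) \<oplus> D_plus G (m - 2) (D_minus G m s))
      ((real_of_int m)\<^sup>2 \<odot> connection_laplacian G m s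
        \<oplus> ((real_of_int m)\<^sup>2 * (real_of_int m + 2) / 2 * c) \<odot> s) \<and>
    section_eq G (D_zero G m (D_zero G m s) \<oplus> D_minus G (m + 2) (D_plus G m s))
      ((real_of_int m + 2)\<^sup>2 \<odot> connection_laplacian G m s
        \<ominus> (real_of_int m * (real_of_int m + 2)\<^sup>2 / 2 * c) \<odot> s) \<and>
    section_eq G (D_zero G (m + 2) (D_plus G m s) \<ominus> D_plus G m (D_zero G m s)) (fzero G) \<and>
    section_eq G (D_zero G (m - 2) (D_minus G m s) \<ominus> D_minus G m (D_zero G m s)) (fzero G) \<and>
    section_eq G (Delta G m (D_zero G m s)) (D_zero G m (Delta G m s)) \<and>
    section_eq G (Delta_tilde G m (D_zero G m s)) (D_zero G m (Delta_tilde G m s)) \<and>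
    section_eq G (Delta G m (D_plus G (m - 2) (D_minus G m s)))
      (D_plus G (m - 2) (D_minus G m (Delta G m s))) \<and>
    section_eq G (Delta_tilde G m (D_minus G (m + 2) (D_plus G m s)))
      (D_minus G (m + 2) (D_plus G m (Delta_tilde G m s)))"
proof -
  interpret spin3 G
    using assms by unfold_locales (auto simp: oriented_riemannian_3manifold_def)
  note K = assms(4)
  have plus: "section_eq G (D_zero G m (dirac (cliff_plus (m - 2)) (m - 2) s)) (dirac (cliff_plus (m - 2)) (m - 2) (D_zero G (m - 2) s))"
    if "s \<in> sections G (m - 2)" for s
    using D_zero_D_plus(1)[OF that K] by (simp add: D_dirac)
  have minus: "section_eq G (D_zero G m (dirac (cliff_minus (m + 2)) (m + 2) s)) (dirac (cliff_minus (m + 2)) (m + 2) (D_zero G (m + 2) s))"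
    if "s \<in> sections G (m + 2)" for s
    using D_zero_D_minus(1)[OF that K] by (simp add: D_dirac)
  note cd = commute_dirac[OF clifford_minus clifford_plus[of "m - 2", unfolded diff_add_cancel]
      D_zero_D_minus(1)[OF _ K, unfolded D_dirac(3)] plus]
  note cdt = commute_dirac[OF clifford_plus clifford_minus[of "m + 2", unfolded add_diff_cancel_right']
      D_zero_D_plus(1)[OF _ K, unfolded D_dirac(2)] minus]
  show ?thesis
    unfolding Delta_def Delta_tilde_def
    by (intro ballI conjI Delta_formula[OF _ K] Delta_tilde_formula[OF _ K] D_zero_D_plus(2)[OF _ K]
        D_zero_D_minus(2)[OF _ K]; (assumption | simp only: D_dirac(2,3), rule cd cdt, assumption)+)
qed

end
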